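(* Let $h\in\mathfrak{D}_{1}$, let $V$ be a nonempty open subset of $\mathbb{R}$ and let $\sigma>0$. Let $L_{\sigma}$ be the set of all irrational reals $\rho$ such that for every $K>0$ there exists $(p,q)\in\mathbb{Z}\times\mathbb{N}$ with $|\rho-p/q|<K/q^{\sigma+2}$. Then \[ \sum_{q\geq1} h(q^{-(2+\sigma)/2})=\infty \ \Longrightarrow\ \mathcal{H}^h(L_{\sigma}\cap V)=\infty, \qquad \sum_{q\geq1} h(q^{-(2+\sigma)/2})<\infty \ \Longrightarrow\ \mathcal{H}^h(L_{\sigma}\cap V)=0. \] Moreover, \[ L_{\sigma}\in\mathrm{G}^h(V) \quad\Longleftrightarrow\quad \sum_{q\geq1} h(q^{-(2+\sigma)/2})=\infty. \]
   Context: $\mathbb{N}=\{1,2,\ldots\}$. For a gauge $g$ (nondecreasing, $g(0)=\lim_{0^+}g=0$), $\mathcal{H}^g$ is the Hausdorff $g$-measure: $\mathcal{H}^g(F)=\lim_{\delta\downarrow0}\inf\{\sum_p g(\mathrm{diam}\,U_{p}) : F\subseteq\bigcup_p U_{p},\ \mathrm{diam}\,U_{p}<\delta\}$. $\mathfrak{D}_{1}$ is the set of all functions $g$ which vanish at zero, are continuous and nondecreasing on $[0,\varepsilon]$ and are such that $r\mapsto g(r)/r$ is positive and nonincreasing on $(0,\varepsilon]$, for some $\varepsilon>0$; for $g,h\in\mathfrak{D}_{1}$, $g\prec h$ means $g/h$ monotonically tends to infinity at zero. Net measures on $\mathbb{R}$: fix an integer $c\geq 2$; a $c$-adic interval is a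 set $c^{-j}(\kappa+[0,1))$, $j,\kappa\in\mathbb{Z}$. For $g\in\mathfrak{D}_{1}$, $\varepsilon_{g}$ is the supremum of the $\varepsilon\in(0,1]$ such that $g$ is nondecreasing on $[0,\varepsilon]$ and $r\mapsto g(r)/r$ is nonincreasing on $(0,\varepsilon]$; for $F\subseteq\mathbb{R}$, $\mathcal{M}^g_{\infty}(F)=\inf\sum_{p}g(\mathrm{diam}\,\lambda_{p})$ over all covers of $F$ by sequences $(\lambda_{p})$ of sets each empty or a $c$-adic interval of diameter less than $\varepsilon_{g}$. For $g\in\mathfrak{D}_{1}$ and $V\subseteq\mathbb{R}$ nonempty open, $\mathrm{G}^g(V)$ is the collection of all $G_{\delta}$-subsets $F$ of $\mathbb{R}$ such that $\mathcal{M}^{\overline{g}}_{\infty}(F\cap U)=\mathcal{M}^{\overline{g}}_{\infty}(U)$ for every $\overline{g}\in\mathfrak{D}_{1}$ with $\overline{g}\prec g$ and every open $U\subseteq V$ (independent of $c$). *)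

theory Defs
  imports "HOL-Analysis.Analysis"
begin

(* Gauges are total functions real => real of which only the germ at 0+ is constrained. *)
definition gauge_D1 :: "(real \<Rightarrow> real) set" where
  "gauge_D1 = {g. g 0 = 0 \<and>
     (\<exists>\<epsilon>>0. continuous_on {0..\<epsilon>} g \<and> mono_on {0..\<epsilon>} g \<and>
        (\<forall>r\<in>{0<..\<epsilon>}. g r / r > 0) \<and> antimono_on {0<..\<epsilon>} (\<lambda>r. g r / r))}"

definition gauge_prec :: "(real \<Rightarrow> real) \<Rightarrow> (real \<Rightarrow> real) \<Rightarrow> bool" where
  "gauge_prec g h \<longleftrightarrow>
     (\<exists>\<epsilon>>0. antimono_on {0<..\<epsilon>} (\<lambda>r. g r / h r)) \<and>
     filterlim (\<lambda>r. g r / h r) at_top (at_right 0)"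

(* Boundedness is explicit because diameter has no meaningful value on unbounded sets;
   ennreal truncates negative values, which cannot occur once \<delta> is small. *)
definition hausdorff_pre :: "(real \<Rightarrow> real) \<Rightarrow> real \<Rightarrow> real set \<Rightarrow> ennreal" where
  "hausdorff_pre g \<delta> F =
     (INF U \<in> {U :: nat \<Rightarrow> real set.
          F \<subseteq> (\<Union>p. U p) \<and> (\<forall>p. bounded (U p) \<and> diameter (U p) < \<delta>)}.
        (\<Sum>p. ennreal (g (diameter (U p)))))"

definition hausdorff_measure :: "(real \<Rightarrow> real) \<Rightarrow> real set \<Rightarrow> ennreal" where
  "hausdorff_measure g F = Lim (at_right 0) (\<lambda>\<delta>. hausdorff_pre g \<delta> F)"

lemma hausdorff_pre_antimono:
  assumes "\<delta> \<le> \<delta>'"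
  shows "hausdorff_pre g \<delta>' F \<le> hausdorff_pre g \<delta> F"
  unfolding hausdorff_pre_def
  by (rule INF_superset_mono) (use assms in \<open>auto intro: less_le_trans\<close>)

(* The limit defining the measure always exists. *)
lemma hausdorff_pre_tendsto:
  "((\<lambda>\<delta>. hausdorff_pre g \<delta> F) \<longlongrightarrow> (SUP \<delta>\<in>{0<..}. hausdorff_pre g \<delta> F)) (at_right 0)"
proof (rule order_tendstoI)
  fix a assume "a < (SUP \<delta>\<in>{0<..}. hausdorff_pre g \<delta> F)"
  then obtain d where d: "d > 0" "a < hausdorff_pre g d F"
    by (auto simp: less_SUP_iff)
  have "eventually (\<lambda>x. x < d) (at_right 0)"
    using d(1) eventually_at_right_field by blast
  then show "\<forall>\<^sub>F \<delta> in at_right 0. a < hausdorff_pre g \<delta> F"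
    by eventually_elim (use d(2) hausdorff_pre_antimono less_le_trans less_imp_le in metis)
next
  fix a assume a: "(SUP \<delta>\<in>{0<..}. hausdorff_pre g \<delta> F) < a"
  have "eventually (\<lambda>x. x \<in> {0<..}) (at_right (0::real))"
    by (simp add: eventually_at_right_less)
  then show "\<forall>\<^sub>F \<delta> in at_right 0. hausdorff_pre g \<delta> F < a"
    by eventually_elim (use a in \<open>meson SUP_upper le_less_trans\<close>)
qed

lemma hausdorff_measure_eq_SUP:
  "hausdorff_measure g F = (SUP \<delta>\<in>{0<..}. hausdorff_pre g \<delta> F)"
  unfolding hausdorff_measure_def
  by (rule tendsto_Lim[OF _ hausdorff_pre_tendsto]) simp

definition adic_interval :: "nat \<Rightarrow> int \<Rightarrow> int \<Rightarrow> real set" where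
  "adic_interval c j \<kappa> = (\<lambda>x. real c powi (- j) * (of_int \<kappa> + x)) ` {0..<1}"

definition gauge_eps :: "(real \<Rightarrow> real) \<Rightarrow> real" where
  "gauge_eps g = Sup {\<epsilon>. 0 < \<epsilon> \<and> \<epsilon> \<le> 1 \<and> mono_on {0..\<epsilon>} g \<and>
                       antimono_on {0<..\<epsilon>} (\<lambda>r. g r / r)}"

definition net_content :: "nat \<Rightarrow> (real \<Rightarrow> real) \<Rightarrow> real set \<Rightarrow> ennreal" where
  "net_content c g F =
     (INF S \<in> {S :: nat \<Rightarrow> real set.
          F \<subseteq> (\<Union>p. S p) \<and>
          (\<forall>p. S p = {} \<or> (\<exists>j \<kappa>. S p = adic_interval c j \<kappa>) \<and> diameter (S p) < gauge_eps g)}.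
        (\<Sum>p. ennreal (g (diameter (S p)))))"

definition large_intersection_class ::
    "nat \<Rightarrow> (real \<Rightarrow> real) \<Rightarrow> real set \<Rightarrow> real set set" where
  "large_intersection_class c g V =
     {F. gdelta_in euclidean F \<and>
         (\<forall>g'\<in>gauge_D1. gauge_prec g' g \<longrightarrow>
            (\<forall>U. open U \<and> U \<subseteq> V \<longrightarrow> net_content c g' (F \<inter> U) = net_content c g' U))}"

definition well_approximable :: "real \<Rightarrow> real set" where
  "well_approximable \<sigma> =
     {\<rho>. \<rho> \<notin> \<rat> \<and>
         (\<forall>K>0. \<exists>(p::int) (q::nat). q \<ge> 1 \<and>
            \<bar>\<rho> - of_int p / real q\<bar> < K / real q powr (\<sigma> + 2))}"

end

theory Submission
  imports Defs "HOL-Real_Asymp.Real_Asymp"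
begin

text \<open>
  Put \<open>s = 2 + \<sigma>\<close>. Condensation along the denominators \<open>10^k\<close> turns divergence of the series into
  divergence of \<open>\<Sum>k. 100^k * g (\<kappa> * 10^(-k s))\<close> for each \<open>\<kappa>\<close>. Every long interval contains a
  positive proportion of \<open>100^k\<close> fractions with denominator at most \<open>10^k\<close>, and distinct fractions
  with denominators at most \<open>10^j\<close> and \<open>10^k\<close> are \<open>10^(-j-k)\<close> apart. So an interval of length \<open>d\<close>
  meeting two of the balls of radius \<open>\<rho>\<^sub>k = \<kappa> * 10^(-k s)\<close> around them meets balls of total weight
  \<open>\<Sum>g \<rho>\<^sub>k\<close> at most a constant times \<open>d\<close> times the block sum, plus \<open>g d\<close>. If the intervals of a cover
  meeting a ball are short in total, then the same holds for some much smaller ball around a fraction,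
  because the block sums are unbounded. The nested balls shrink to a well approximable point outside
  the cover. Hence covers by sets of diameter below some \<open>\<delta>(A)\<close> satisfy
  \<open>\<Sum>g (diam) \<ge> A * (b - a)\<close> on every interval, which gives infinite Hausdorff measure; dividing a
  \<open>c\<close>-adic interval until its parts are shorter than \<open>\<delta>(g d / d)\<close>, where \<open>d\<close> is its length, gives the
  equality of net contents.

  If the series converges, the natural covers give measure zero. Some gauge \<open>g \<prec> h\<close> of the form
  \<open>w \<circ> h\<close> with \<open>w\<close> concave still has a convergent series, and its net content vanishes on \<open>L\<^sub>\<sigma>\<close>
  but not on \<open>V\<close>.
\<close>

section \<open>Counting fractions in an interval\<close>

text \<open>The sets of a cover live on all scales at once, so no single level of balls can be
  compared with all of them. The weights \<open>g \<rho>\<^sub>k\<close> settle this: a set meeting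
  two balls is at least comparable in size with the larger one and is charged for all the weight it
  meets, while a set meeting only one ball is charged once. The invariant of the nested construction
  is that the cover intervals meeting the current ball of radius \<open>R\<close> have total length
  at most \<open>R / 640\<close>. It controls lengths, although the cover is only known through its
  gauge sum; the monotonicity of \<open>g r / r\<close> converts one into the other. The new balls
  are sought in an interval of length \<open>l = R / 2\<close>, hence the bound
  \<open>l / 320\<close> there. The threshold \<open>\<delta>\<close> depends on \<open>A\<close>
  but not on the interval \<open>(a, b)\<close>. This uniformity lets a \<open>c\<close>-adic
  interval be cut into finitely many generations of subintervals, all treated with the same
  \<open>A\<close>. Level \<open>k\<close> uses denominators up to \<open>10^k\<close>, not
  \<open>2^k\<close>: with ratio 100 between the counts of successive levels, deleting all earlier
  fractions costs only a small share of the new ones.\<close>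

definition rats :: "nat \<Rightarrow> real set" where
  "rats N = {of_int p / real q | p q. 1 \<le> q \<and> q \<le> N}"

lemma rats_separated:
  assumes "x \<in> rats M" "y \<in> rats N" "x \<noteq> y"
  shows "1 / (real M * real N) \<le> \<bar>x - y\<bar>"
proof -
  obtain p q where x: "x = of_int p / real q" "1 \<le> q" "q \<le> M"
    using assms(1) by (auto simp: rats_def)
  obtain p' q' where y: "y = of_int p' / real q'" "1 \<le> q'" "q' \<le> N"
    using assms(2) by (auto simp: rats_def)
  have eq: "x - y = of_int (p * int q' - p' * int q) / (real q * real q')"
    using x y by (simp add: diff_frac_eq)
  have "p * int q' - p' * int q \<noteq> 0"
    using assms(3) eq by (metis div_0 eq_iff_diff_eq_0 of_int_0)
  then have "1 \<le> \<bar>p * int q' - p' * int q\<bar>" by linarith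
  then have "(1::real) \<le> \<bar>of_int (p * int q' - p' * int q)\<bar>"
    by (metis of_int_1_le_iff of_int_abs)
  then have "1 / (real q * real q') \<le> \<bar>x - y\<bar>"
    unfolding eq using x y by (simp add: abs_divide abs_mult divide_right_mono)
  moreover have "1 / (real M * real N) \<le> 1 / (real q * real q')"
    using x y by (intro divide_left_mono mult_mono) auto
  ultimately show ?thesis by linarith
qed

text \<open>Half-open slots of length \<open>t\<close> starting at \<open>a\<close> hold at most one
  point each, and at most \<open>l / t + 1\<close> of them meet the interval.\<close>

lemma card_separated_le:
  fixes A :: "real set"
  assumes sub: "A \<subseteq> {a..a + l}" and t: "t > 0"
    and sep: "\<And>x y. x \<in> A \<Longrightarrow> y \<in> A \<Longrightarrow> x \<noteq> y \<Longrightarrow> t \<le> \<bar>x - y\<bar>"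
  shows "finite A" and "0 \<le> l \<Longrightarrow> real (card A) \<le> l / t + 1"
proof -
  let ?f = "\<lambda>x. \<lfloor>(x - a) / t\<rfloor>"
  have inj: "inj_on ?f A"
  proof (rule inj_onI, rule ccontr)
    fix x y assume xy: "x \<in> A" "y \<in> A" "?f x = ?f y" "x \<noteq> y"
    then have "\<bar>(x - a) / t - (y - a) / t\<bar> < 1" by linarith
    then have "\<bar>x - y\<bar> < t" using t by (simp add: diff_divide_distrib[symmetric] abs_divide)
    with sep[OF xy(1,2,4)] show False by simp
  qed
  have im: "?f ` A \<subseteq> {0..\<lfloor>l / t\<rfloor>}"
    using sub t by (fastforce intro!: floor_mono divide_right_mono)
  then have "finite (?f ` A)" by (rule finite_subset) simp
  then show fin: "finite A" using inj by (rule finite_imageD)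
  assume l: "0 \<le> l"
  have "card A = card (?f ` A)" using inj by (simp add: card_image)
  also have "\<dots> \<le> card {0..\<lfloor>l / t\<rfloor>}" using im by (intro card_mono) auto
  also have "\<dots> = nat (\<lfloor>l / t\<rfloor> + 1)" by simp
  finally have "real (card A) \<le> real (nat (\<lfloor>l / t\<rfloor> + 1))" by linarith
  also have "\<dots> \<le> l / t + 1" using l t by (simp add: of_nat_nat)
  finally show "real (card A) \<le> l / t + 1" .
qed

lemma card_rats_le:
  assumes "N \<ge> 1"
  shows "finite (rats N \<inter> {a..a + l})"
    and "0 \<le> l \<Longrightarrow> real (card (rats N \<inter> {a..a + l})) \<le> l * real N ^ 2 + 1"
proof -
  have sep: "1 / (real N * real N) \<le> \<bar>x - y\<bar>"
    if "x \<in> rats N \<inter> {a..a + l}" "y \<in> rats N \<inter> {a..a + l}" "x \<noteq> y" for x y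
    using that by (intro rats_separated) auto
  have "1 / (real N * real N) > 0" using assms by simp
  note * = card_separated_le[OF Int_lower2 this sep]
  show "finite (rats N \<inter> {a..a + l})" by (rule *(1))
  assume "0 \<le> l"
  from *(2)[OF _ _ _ this] show "real (card (rats N \<inter> {a..a + l})) \<le> l * real N ^ 2 + 1"
    by (simp add: power2_eq_square)
qed

lemma card_int_interval:
  fixes x y :: real
  assumes "x \<le> y"
  shows "y - x - 1 \<le> real (card {p::int. x \<le> of_int p \<and> of_int p \<le> y})"
    and "real (card {p::int. x \<le> of_int p \<and> of_int p \<le> y}) \<le> y - x + 1"
    and "finite {p::int. x \<le> of_int p \<and> of_int p \<le> y}"
proof -
  have eq: "{p::int. x \<le> of_int p \<and> of_int p \<le> y} = {\<lceil>x\<rceil>..\<lfloor>y\<rfloor>}"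
    by (auto simp: ceiling_le_iff le_floor_iff)
  show "finite {p::int. x \<le> of_int p \<and> of_int p \<le> y}" unfolding eq by simp
  have "\<lceil>x\<rceil> \<le> \<lfloor>y\<rfloor> + 1" using assms by linarith
  then have "real (card {p::int. x \<le> of_int p \<and> of_int p \<le> y}) = of_int (\<lfloor>y\<rfloor> + 1 - \<lceil>x\<rceil>)"
    unfolding eq by (simp add: of_nat_nat)
  moreover have "y - x - 1 \<le> of_int (\<lfloor>y\<rfloor> + 1 - \<lceil>x\<rceil>)" "of_int (\<lfloor>y\<rfloor> + 1 - \<lceil>x\<rceil>) \<le> y - x + 1"
    by linarith+
  ultimately show "y - x - 1 \<le> real (card {p::int. x \<le> of_int p \<and> of_int p \<le> y})"
    and "real (card {p::int. x \<le> of_int p \<and> of_int p \<le> y}) \<le> y - x + 1" by simp_all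
qed

text \<open>Pairs instead of values: the count becomes a sum over denominators of numbers of
  integers in an interval. Values are recovered later from the coprime pairs.\<close>

definition frac_pairs :: "real \<Rightarrow> real \<Rightarrow> nat \<Rightarrow> (nat \<times> int) set" where
  "frac_pairs a l N = (SIGMA q:{1..N}. {p. a * real q \<le> of_int p \<and> of_int p \<le> (a + l) * real q})"

lemma card_frac_pairs:
  assumes "l \<ge> 0"
  shows "finite (frac_pairs a l N)"
    and "l * real N ^ 2 / 2 - real N \<le> real (card (frac_pairs a l N))"
    and "real (card (frac_pairs a l N)) \<le> l * real N ^ 2 / 2 + (l / 2 + 1) * real N"
proof -
  let ?P = "\<lambda>q. {p::int. a * real q \<le> of_int p \<and> of_int p \<le> (a + l) * real q}"
  have le: "a * real q \<le> (a + l) * real q" for q using assms by (simp add: mult_right_mono)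
  show "finite (frac_pairs a l N)"
    unfolding frac_pairs_def using card_int_interval(3)[OF le] by auto
  have card: "card (frac_pairs a l N) = (\<Sum>q=1..N. card (?P q))"
    unfolding frac_pairs_def using card_int_interval(3)[OF le] by (simp add: card_SigmaI)
  have gauss: "(\<Sum>q=1..N. l * real q) = l * real N * (real N + 1) / 2"
    by (induction N) (auto simp: field_simps)
  have "(\<Sum>q=1..N. l * real q - 1) \<le> (\<Sum>q=1..N. real (card (?P q)))"
    using card_int_interval(1)[OF le] by (intro sum_mono) (simp add: algebra_simps)
  then have "l * real N * (real N + 1) / 2 - real N \<le> real (card (frac_pairs a l N))"
    unfolding card sum_subtractf gauss by simp
  moreover have "l * real N ^ 2 \<le> l * real N * (real N + 1)"
    using assms by (simp add: power2_eq_square algebra_simps)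
  ultimately show "l * real N ^ 2 / 2 - real N \<le> real (card (frac_pairs a l N))" by linarith
  have "(\<Sum>q=1..N. real (card (?P q))) \<le> (\<Sum>q=1..N. l * real q + 1)"
    using card_int_interval(2)[OF le] by (intro sum_mono) (simp add: algebra_simps)
  then have "real (card (frac_pairs a l N)) \<le> l * real N * (real N + 1) / 2 + real N"
    unfolding card sum.distrib gauss by simp
  then show "real (card (frac_pairs a l N)) \<le> l * real N ^ 2 / 2 + (l / 2 + 1) * real N"
    by (simp add: power2_eq_square algebra_simps add_divide_distrib)
qed

text \<open>Compare \<open>1 / (n + 1)^2\<close> with \<open>1 / n - 1 / (n + 1)\<close> and
  telescope from the exact value 1/4 at \<open>N = 2\<close>. What matters is that 3/4 is below 1,
  so that coprime pairs keep a positive share.\<close>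

lemma sum_inverse_squares_le: "N \<ge> 2 \<Longrightarrow> (\<Sum>e=2..N. 1 / real e ^ 2) \<le> 3/4 - 1 / real N"
proof (induction N rule: dec_induct)
  case base then show ?case by simp
next
  case (step n)
  have "1 / real (Suc n) ^ 2 \<le> 1 / (real n * real (Suc n))"
    using step by (intro divide_left_mono) (auto simp: power2_eq_square)
  also have "\<dots> = 1 / real n - 1 / real (Suc n)"
    using step by (simp add: field_simps)
  finally show ?case using step by (simp add: sum.atLeastLessThan_Suc)
qed

text \<open>A crude substitute for the logarithmic bound; it suffices because
  \<open>N * sqrt N\<close> is already negligible against \<open>N^2\<close>.\<close>

lemma sum_inverse_le_sqrt: "(\<Sum>e=1..N. 1 / real e) \<le> 2 * sqrt (real N)"
proof (induction N)
  case 0 then show ?case by simp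
next
  case (Suc n)
  have 1: "(sqrt (real (Suc n)) - sqrt (real n)) * (sqrt (real (Suc n)) + sqrt (real n)) = 1"
    by (simp add: algebra_simps flip: power2_eq_square)
  have "sqrt (real (Suc n)) \<le> real (Suc n)" "sqrt (real n) \<le> real (Suc n)"
    by (intro real_le_lsqrt; simp add: power2_eq_square algebra_simps)+
  then have "1 \<le> (sqrt (real (Suc n)) - sqrt (real n)) * (2 * real (Suc n))"
    by (subst 1[symmetric], intro mult_left_mono) auto
  then have "1 / real (Suc n) \<le> 2 * (sqrt (real (Suc n)) - sqrt (real n))"
    by (simp add: field_simps)
  then show ?case using Suc by simp
qed

text \<open>Dividing such a pair by its gcd \<open>e \<ge> 2\<close> gives a pair for the same
  interval with denominator at most \<open>N div e\<close>. The main terms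
  \<open>l * (N / e)^2 / 2\<close> add up to at most 3/4 of \<open>l * N^2 / 2\<close>, and the
  linear terms produce the error with the square root.\<close>

lemma card_noncoprime_frac_pairs:
  assumes l: "l > 0"
  shows "real (card {x \<in> frac_pairs a l N. \<not> coprime (int (fst x)) (snd x)})
           \<le> 3/8 * l * real N ^ 2 + (l + 2) * real N * sqrt (real N)"
proof -
  define f where "f e = (\<lambda>x :: nat \<times> int. (e * fst x, int e * snd x))" for e :: nat
  have sub: "{x \<in> frac_pairs a l N. \<not> coprime (int (fst x)) (snd x)}
      \<subseteq> (\<Union>e\<in>{2..N}. f e ` frac_pairs a l (N div e))"
  proof safe
    fix q p assume qp: "(q, p) \<in> frac_pairs a l N" "\<not> coprime (int (fst (q, p))) (snd (q, p))"
    define e where "e = nat (gcd (int q) p)"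
    have q: "1 \<le> q" "q \<le> N" using qp by (auto simp: frac_pairs_def)
    have ie: "int e = gcd (int q) p" unfolding e_def by (simp only: int_nat_eq gcd_ge_0_int if_True)
    have "gcd (int q) p \<noteq> 1" using qp(2) by (simp add: coprime_iff_gcd_eq_1)
    moreover have "gcd (int q) p > 0" using q by (simp add: gcd_pos_int)
    ultimately have e2: "e \<ge> 2" using ie by linarith
    have "int e dvd int q" "int e dvd p" unfolding ie by (rule gcd_dvd1, rule gcd_dvd2)
    then have "e dvd q" "int e dvd p" by (simp_all only: int_dvd_int_iff)
    then obtain q' p' where q': "q = e * q'" and p': "p = int e * p'" by (auto elim!: dvdE)
    have e_pos: "real e > 0" using e2 by simp
    have "e \<le> q" using q q' by simp
    have "1 \<le> q'" using q q' by (cases q') auto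
    moreover have "q' \<le> N div e" using q q' e2
      by (metis div_le_mono nonzero_mult_div_cancel_left not_numeral_le_zero)
    moreover have "a * real q' \<le> of_int p' \<and> of_int p' \<le> (a + l) * real q'"
    proof -
      have "a * real q \<le> of_int p" "of_int p \<le> (a + l) * real q"
        using qp by (auto simp: frac_pairs_def)
      then have "real e * (a * real q') \<le> real e * of_int p'"
        "real e * of_int p' \<le> real e * ((a + l) * real q')"
        by (simp_all add: q' p' mult_ac)
      then show ?thesis using e_pos by (simp add: mult_le_cancel_left_pos)
    qed
    ultimately have "(q', p') \<in> frac_pairs a l (N div e)" by (auto simp: frac_pairs_def)
    moreover have "(q, p) = f e (q', p')" by (simp add: f_def q' p')
    moreover have "e \<in> {2..N}" using e2 \<open>e \<le> q\<close> q by simp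
    ultimately show "(q, p) \<in> (\<Union>e\<in>{2..N}. f e ` frac_pairs a l (N div e))" by blast
  qed
  have fin: "finite (frac_pairs a l M)" for M using card_frac_pairs(1) l by simp
  have "card {x \<in> frac_pairs a l N. \<not> coprime (int (fst x)) (snd x)}
      \<le> card (\<Union>e\<in>{2..N}. f e ` frac_pairs a l (N div e))"
    using sub fin by (intro card_mono) auto
  also have "\<dots> \<le> (\<Sum>e=2..N. card (f e ` frac_pairs a l (N div e)))"
    by (intro card_UN_le) simp
  also have "\<dots> \<le> (\<Sum>e=2..N. card (frac_pairs a l (N div e)))"
    using fin by (intro sum_mono card_image_le)
  finally have "real (card {x \<in> frac_pairs a l N. \<not> coprime (int (fst x)) (snd x)})
      \<le> (\<Sum>e=2..N. real (card (frac_pairs a l (N div e))))" unfolding of_nat_sum[symmetric] of_nat_le_iff .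
  also have "\<dots> \<le> (\<Sum>e=2..N. l * real N ^ 2 / 2 * (1 / real e ^ 2) + (l / 2 + 1) * real N * (1 / real e))"
  proof (rule sum_mono)
    fix e assume "e \<in> {2..N}"
    have d: "real (N div e) \<le> real N / real e" by (rule of_nat_div_le_of_nat)
    have "real (card (frac_pairs a l (N div e))) \<le> l * real (N div e) ^ 2 / 2 + (l / 2 + 1) * real (N div e)"
      using card_frac_pairs(3) l by simp
    also have "\<dots> \<le> l * (real N / real e) ^ 2 / 2 + (l / 2 + 1) * (real N / real e)"
      using d l by (intro add_mono divide_right_mono mult_left_mono power_mono) auto
    finally show "real (card (frac_pairs a l (N div e)))
      \<le> l * real N ^ 2 / 2 * (1 / real e ^ 2) + (l / 2 + 1) * real N * (1 / real e)"
      by (simp add: power_divide)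
  qed
  also have "\<dots> = l * real N ^ 2 / 2 * (\<Sum>e=2..N. 1 / real e ^ 2) + (l / 2 + 1) * real N * (\<Sum>e=2..N. 1 / real e)"
    by (simp add: sum.distrib sum_distrib_left)
  also have "\<dots> \<le> l * real N ^ 2 / 2 * (3/4) + (l / 2 + 1) * real N * (2 * sqrt (real N))"
  proof (intro add_mono mult_left_mono)
    show "(\<Sum>e=2..N. 1 / real e ^ 2) \<le> 3/4"
    proof (cases "N \<ge> 2")
      case True
      have "1 / real N \<ge> 0" by simp
      with sum_inverse_squares_le[OF True] show ?thesis by linarith
    qed simp
    have "(\<Sum>e=2..N. 1 / real e) \<le> (\<Sum>e=1..N. 1 / real e)" by (intro sum_mono2) auto
    with sum_inverse_le_sqrt[of N] show "(\<Sum>e=2..N. 1 / real e) \<le> 2 * sqrt (real N)" by linarith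
  qed (use l in auto)
  finally show ?thesis by (simp add: algebra_simps)
qed

text \<open>Coprime pairs represent distinct reals. Their number is at least
  \<open>1/2 - 3/8 = 1/8\<close> of \<open>l * N^2\<close> up to lower order terms, and for large
  \<open>N\<close> those cost at most 1/40, which leaves 1/10.\<close>

lemma card_rats_ge:
  assumes l: "l > 0"
  shows "\<forall>\<^sub>F N in sequentially. l * real N ^ 2 / 10 \<le> real (card (rats N \<inter> {a..a + l}))"
proof -
  \<comment> \<open>This is the size of \<open>N\<close> for which
    \<open>(l + 3) * N * sqrt N\<close>, an upper bound for both error terms, is at most
    \<open>l * N^2 / 40\<close>.\<close>
  have "\<forall>\<^sub>F N::nat in sequentially. (l + 3) * 40 / l \<le> sqrt (real N)"
    by real_asymp
  then show ?thesis using eventually_ge_at_top[of 1]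
  proof eventually_elim
    case (elim N)
    define A where "A = frac_pairs a l N"
    define C where "C = {x \<in> A. coprime (int (fst x)) (snd x)}"
    define D where "D = {x \<in> A. \<not> coprime (int (fst x)) (snd x)}"
    have fin: "finite A" unfolding A_def using card_frac_pairs(1) l by simp
    have "card A = card (C \<union> D)" by (rule arg_cong[of _ _ card]) (auto simp: C_def D_def)
    also have "\<dots> = card C + card D"
      using fin by (intro card_Un_disjoint) (auto simp: C_def D_def)
    finally have CD: "real (card A) = real (card C) + real (card D)" by simp
    have 1: "1 \<le> sqrt (real N)" using elim by simp
    have "(l + 3) * 40 * (sqrt (real N) * real N) \<le> sqrt (real N) * l * (sqrt (real N) * real N)"
      using elim l by (intro mult_right_mono) (auto simp: field_simps)
    also have "\<dots> = l * real N ^ 2" by (simp add: power2_eq_square)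
    finally have 2: "(l + 3) * (real N * sqrt (real N)) \<le> l * real N ^ 2 / 40" by (simp add: mult_ac)
    have "real N * 1 \<le> real N * sqrt (real N)" using 1 by (intro mult_left_mono) auto
    then have "real N + (l + 2) * real N * sqrt (real N) \<le> (l + 3) * (real N * sqrt (real N))"
      by (simp add: algebra_simps)
    moreover have "real (card D) \<le> 3/8 * l * real N ^ 2 + (l + 2) * real N * sqrt (real N)"
      unfolding D_def A_def by (rule card_noncoprime_frac_pairs[OF l])
    moreover have "l * real N ^ 2 / 2 - real N \<le> real (card A)"
      unfolding A_def using card_frac_pairs(2) l by simp
    ultimately have C: "l * real N ^ 2 / 10 \<le> real (card C)" using CD 2 by linarith
    let ?f = "\<lambda>x :: nat \<times> int. of_int (snd x) / real (fst x)"
    have "inj_on ?f C"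
    proof (rule inj_onI, safe)
      fix q p q' p'
      assume qp: "(q, p) \<in> C" "(q', p') \<in> C" and eq: "?f (q, p) = ?f (q', p')"
      have q: "q \<ge> 1" "q' \<ge> 1" using qp by (auto simp: C_def A_def frac_pairs_def)
      have "(of_int (p * int q') :: real) = of_int (p' * int q)" using eq q by (simp add: field_simps)
      then have eq': "p * int q' = p' * int q" using of_int_eq_iff by blast
      have cop: "coprime (int q) p" "coprime (int q') p'" using qp by (auto simp: C_def)
      have "int q dvd p * int q'" unfolding eq' by simp
      then have d1: "int q dvd int q'" using cop(1) by (simp add: coprime_dvd_mult_right_iff)
      have "int q' dvd p' * int q" unfolding eq'[symmetric] by simp
      then have d2: "int q' dvd int q" using cop(2) by (simp add: coprime_dvd_mult_right_iff)
      show "q = q'" using d1 d2 by (simp add: dvd_antisym)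
      then show "p = p'" using eq' q by simp
    qed
    then have "card C = card (?f ` C)" by (simp add: card_image)
    also have "\<dots> \<le> card (rats N \<inter> {a..a + l})"
    proof (intro card_mono card_rats_le(1))
      show "?f ` C \<subseteq> rats N \<inter> {a..a + l}"
      proof safe
        fix q p assume qp: "(q, p) \<in> C"
        then have q: "q \<in> {1..N}" "a * real q \<le> of_int p" "of_int p \<le> (a + l) * real q"
          by (auto simp: C_def A_def frac_pairs_def)
        show "?f (q, p) \<in> rats N" using q by (auto simp: rats_def)
        show "?f (q, p) \<in> {a..a + l}" using q by (auto simp: field_simps)
      qed
    qed (use elim in auto)
    finally show ?case using C by simp
  qed
qed

section \<open>Gauges and blocks of denominators\<close>

text \<open>A gauge whose conditions hold on the whole half-line instead of near zero; every gauge
  in \<open>gauge_D1\<close> becomes one after being frozen beyond a suitable point.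
  \<open>quot\<close> says that \<open>g r / r\<close> is nonincreasing, multiplied out. Continuity
  away from zero follows from \<open>mono\<close> and \<open>quot\<close>.\<close>

locale dim_gauge =
  fixes g :: "real \<Rightarrow> real"
  assumes zero: "g 0 = 0"
    and pos: "0 < r \<Longrightarrow> 0 < g r"
    and mono: "0 \<le> r \<Longrightarrow> r \<le> t \<Longrightarrow> g r \<le> g t"
    and quot: "0 < r \<Longrightarrow> r \<le> t \<Longrightarrow> r * g t \<le> t * g r"
    and lim: "(g \<longlongrightarrow> 0) (at_right 0)"
begin

lemma nonneg: "0 \<le> r \<Longrightarrow> 0 \<le> g r"
  using mono[of 0 r] zero by simp

lemma quot': "0 \<le> r \<Longrightarrow> r \<le> t \<Longrightarrow> r * g t \<le> t * g r"
  using quot[of r t] nonneg[of t] zero by (cases "r = 0") auto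

lemma small: "0 < \<eta> \<Longrightarrow> \<exists>r>0. \<forall>t. 0 \<le> t \<and> t \<le> r \<longrightarrow> g t < \<eta>"
proof -
  assume "0 < \<eta>"
  with lim have "\<forall>\<^sub>F r in at_right 0. g r < \<eta>" by (rule order_tendstoD)
  then obtain b where "b > 0" and b: "\<And>y. 0 < y \<Longrightarrow> y < b \<Longrightarrow> g y < \<eta>"
    by (auto simp: eventually_at_right_field)
  show ?thesis
  proof (intro exI[of _ "b / 2"] conjI allI impI)
    fix t assume "0 \<le> t \<and> t \<le> b / 2"
    then show "g t < \<eta>" using b[of t] \<open>b > 0\<close> \<open>0 < \<eta>\<close> zero by (cases "t = 0") auto
  qed (use \<open>b > 0\<close> in simp)
qed

text \<open>Condensation: for \<open>n\<close> from \<open>100^i\<close> up to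
  \<open>100^(i+1)\<close> the argument \<open>n powr (- s / 2)\<close> is at most
  \<open>(10^i) powr (- s)\<close>, since \<open>100^i\<close> is the square of
  \<open>10^i\<close>.\<close>

lemma block_sum_le:
  assumes s: "s > 0"
  shows "(\<Sum>n\<in>{100^k..<100^(k+m)}. g (real n powr (- s / 2)))
      \<le> (\<Sum>i\<in>{k..<k+m}. 100 ^ Suc i * g ((10^i) powr (- s)))"
proof (induction m)
  case (Suc m)
  have "(\<Sum>n\<in>{100^(k+m)..<100^(k+Suc m)}. g (real n powr (- s / 2)))
      \<le> real (card {100^(k+m)..<100^(k+Suc m)::nat}) * g ((10^(k+m)) powr (- s))"
  proof (rule sum_bounded_above)
    fix n :: nat assume n: "n \<in> {100^(k+m)..<100^(k+Suc m)}"
    have "(10^(k+m)) powr (- s) = ((10^(k+m)) powr 2) powr (- s / 2)"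
      unfolding powr_powr by simp
    also have "(10^(k+m)) powr 2 = (100^(k+m) :: real)"
      by (simp add: power2_eq_square flip: power_mult_distrib)
    finally have eq: "(10^(k+m)) powr (- s) = (100^(k+m) :: real) powr (- s / 2)" .
    have "100 ^ (k+m) \<le> n" using n by simp
    then have "real (100 ^ (k+m)) \<le> real n" by (simp only: of_nat_le_iff)
    then have "(100::real) ^ (k+m) \<le> real n" by simp
    then have "real n powr (- s / 2) \<le> (100^(k+m)) powr (- s / 2)"
      using s by (intro powr_mono2') auto
    then show "g (real n powr (- s / 2)) \<le> g ((10^(k+m)) powr (- s))"
      unfolding eq by (intro mono) auto
  qed
  also have "\<dots> \<le> 100 ^ Suc (k+m) * g ((10^(k+m)) powr (- s))"
    by (intro mult_right_mono nonneg) (auto simp: of_nat_diff)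
  finally have 1: "(\<Sum>n\<in>{100^(k+m)..<100^(k+Suc m)}. g (real n powr (- s / 2)))
      \<le> 100 ^ Suc (k+m) * g ((10^(k+m)) powr (- s))" .
  have "{100^k..<100^(k+Suc m)::nat} = {100^k..<100^(k+m)} \<union> {100^(k+m)..<100^(k+Suc m)}"
    by (rule ivl_disj_un_two(3)[symmetric]) (auto intro: power_increasing)
  then have "(\<Sum>n\<in>{100^k..<100^(k+Suc m)}. g (real n powr (- s / 2)))
    = (\<Sum>n\<in>{100^k..<100^(k+m)}. g (real n powr (- s / 2)))
     + (\<Sum>n\<in>{100^(k+m)..<100^(k+Suc m)}. g (real n powr (- s / 2)))"
    by (simp only:) (rule sum.union_disjoint, auto)
  then show ?case using Suc 1 by simp
qed simp

text \<open>The factor \<open>\<kappa>\<close> only costs a constant, because \<open>quot\<close>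
  gives \<open>g (\<kappa> * r) \<ge> \<kappa> * g r\<close>; starting at \<open>k1\<close> only
  drops finitely many terms of the series.\<close>

lemma block_sums_unbounded:
  assumes div: "\<not> summable (\<lambda>q. g (real (Suc q) powr (- s / 2)))"
    and s: "s > 0" and \<kappa>: "0 < \<kappa>" "\<kappa> \<le> 1"
  shows "\<exists>k2\<ge>k1. M \<le> (\<Sum>k=k1..k2. 100 ^ k * g (\<kappa> * (10^k) powr (- s)))"
proof (rule ccontr)
  assume "\<not> ?thesis"
  then have less: "(\<Sum>k=k1..k2. 100 ^ k * g (\<kappa> * (10^k) powr (- s))) < M" if "k2 \<ge> k1" for k2
    using that by auto
  define f where "f n = g (real n powr (- s / 2))" for n :: nat
  have f0: "0 \<le> f n" for n unfolding f_def by (intro nonneg) simp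
  have main: "(\<Sum>n\<in>{100^k1..<100^(k1 + Suc m)}. f n) \<le> 100 / \<kappa> * M" for m
  proof -
    have "(\<Sum>n\<in>{100^k1..<100^(k1 + Suc m)}. f n)
        \<le> (\<Sum>i\<in>{k1..<k1 + Suc m}. 100 ^ Suc i * g ((10^i) powr (- s)))"
      unfolding f_def by (rule block_sum_le[OF s])
    also have "\<dots> \<le> (\<Sum>i\<in>{k1..<k1 + Suc m}. 100 / \<kappa> * (100 ^ i * g (\<kappa> * (10^i) powr (- s))))"
    proof (rule sum_mono)
      fix i
      have "(\<kappa> * (10^i) powr (- s)) * g ((10^i) powr (- s)) \<le> (10^i) powr (- s) * g (\<kappa> * (10^i) powr (- s))"
        using \<kappa> by (intro quot) (auto simp: mult_le_cancel_right1)
      then have "\<kappa> * g ((10^i) powr (- s)) \<le> g (\<kappa> * (10^i) powr (- s))"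
        by (simp add: mult_ac)
      then have "g ((10^i) powr (- s)) \<le> g (\<kappa> * (10^i) powr (- s)) / \<kappa>"
        using \<kappa> by (simp add: field_simps)
      then have "100 ^ Suc i * g ((10^i) powr (- s)) \<le> 100 ^ Suc i * (g (\<kappa> * (10^i) powr (- s)) / \<kappa>)"
        by (intro mult_left_mono) auto
      then show "100 ^ Suc i * g ((10^i) powr (- s)) \<le> 100 / \<kappa> * (100 ^ i * g (\<kappa> * (10^i) powr (- s)))"
        by simp
    qed
    also have "\<dots> = 100 / \<kappa> * (\<Sum>k=k1..k1 + m. 100 ^ k * g (\<kappa> * (10^k) powr (- s)))"
      by (simp only: sum_distrib_left[symmetric] atLeastLessThanSuc_atLeastAtMost add_Suc_right)
    also have "\<dots> \<le> 100 / \<kappa> * M"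
      using less[of "k1 + m"] \<kappa> by (intro mult_left_mono) auto
    finally show ?thesis .
  qed
  have "summable (\<lambda>q. f (Suc q))"
  proof (rule bounded_imp_summable)
    fix n
    have lt: "Suc n < 100 ^ (k1 + Suc n)"
    proof -
      have "Suc n < 100 ^ Suc n" by (rule less_exp[THEN less_le_trans]) (rule power_mono, auto)
      also have "\<dots> \<le> 100 ^ (k1 + Suc n)" by (intro power_increasing) auto
      finally show ?thesis .
    qed
    have "(\<Sum>q\<le>n. f (Suc q)) = (\<Sum>q\<in>Suc ` {..n}. f q)" by (simp add: sum.reindex)
    also have "\<dots> \<le> (\<Sum>q\<in>{..<100^k1} \<union> {100^k1..<100^(k1 + Suc n)}. f q)"
      using lt f0 by (intro sum_mono2) (auto simp: not_less)
    also have "\<dots> = (\<Sum>q\<in>{..<100^k1}. f q) + (\<Sum>q\<in>{100^k1..<100^(k1 + Suc n)}. f q)"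
      by (rule sum.union_disjoint) auto
    finally show "(\<Sum>q\<le>n. f (Suc q)) \<le> (\<Sum>q\<in>{..<100^k1}. f q) + 100 / \<kappa> * M"
      using main[of n] by linarith
  qed (rule f0)
  with div show False by (simp add: f_def)
qed

text \<open>If \<open>g\<close> were below a linear function, the series would be dominated by that
  of \<open>q powr (- s / 2)\<close>, which converges because \<open>s > 2\<close>. By
  \<open>quot\<close> the inequality at one \<open>\<delta>\<close> passes to all smaller
  arguments.\<close>

lemma quotient_unbounded:
  assumes div: "\<not> summable (\<lambda>q. g (real (Suc q) powr (- s / 2)))" and s: "s > 2"
  shows "\<exists>\<delta>>0. A * \<delta> \<le> g \<delta>"
proof (rule ccontr)
  assume "\<not> ?thesis"
  then have less: "g \<delta> < A * \<delta>" if "\<delta> > 0" for \<delta> using that by (meson not_le)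
  have "summable (\<lambda>q. real q powr (- s / 2))" using s by (simp add: summable_real_powr_iff)
  then have "summable (\<lambda>q. real (Suc q) powr (- s / 2))" by (rule summable_Suc_iff[THEN iffD2])
  then have "summable (\<lambda>q. A * real (Suc q) powr (- s / 2))" by (rule summable_mult)
  then have "summable (\<lambda>q. g (real (Suc q) powr (- s / 2)))"
    by (rule summable_comparison_test') (use less nonneg in \<open>auto intro: less_imp_le\<close>)
  with div show False by simp
qed

end

text \<open>The distance is taken to all earlier fractions of the interval, not only to the good
  ones. In particular a fraction that reappears with a larger denominator is deleted, so different
  levels are disjoint.\<close>

definition good_points :: "(nat \<Rightarrow> real) \<Rightarrow> real \<Rightarrow> real \<Rightarrow> nat \<Rightarrow> nat \<Rightarrow> real set" where
  "good_points \<rho> a l k1 k = {y \<in> rats (10^k) \<inter> {a..a + l}.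
     \<forall>j\<in>{k1..<k}. \<forall>x\<in>rats (10^j) \<inter> {a..a + l}. 4 * \<rho> j \<le> \<bar>x - y\<bar>}"

text \<open>Number of fractions of level \<open>j\<close> per unit length times their radius, up to
  constants. For \<open>s > 2\<close> it decays geometrically, so the balls of all late levels
  together take up little room.\<close>

lemma radius_ratio: "(100::real) ^ j * ((10::real) ^ j) powr (- s) = (10 powr (2 - s)) ^ j"
proof -
  have "(100::real) ^ j = 10 powr (2 * real j)"
    by (simp add: powr_powr[symmetric] powr_realpow powr_numeral)
  moreover have "((10::real) ^ j) powr (- s) = 10 powr (- s * real j)"
    by (simp add: powr_powr powr_realpow[symmetric] mult.commute)
  ultimately have "100 ^ j * ((10::real) ^ j) powr (- s) = 10 powr (2 * real j) * 10 powr (- s * real j)" by simp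
  also have "\<dots> = 10 powr ((2 - s) * real j)"
    by (simp add: powr_add[symmetric] algebra_simps)
  also have "\<dots> = (10 powr (2 - s)) ^ j" by (simp add: powr_powr[symmetric] powr_realpow)
  finally show ?thesis .
qed

lemma sum_powers_100: "(\<Sum>j\<in>{k1..<k}. 100 ^ j) \<le> 100 ^ k / (99::real)"
proof (induction k)
  case (Suc k)
  then show ?case by (cases "k1 \<le> k") (auto simp: sum.atLeastLessThan_Suc)
qed simp

text \<open>At most \<open>2 * l * 100^j\<close> fractions of level \<open>j\<close> delete at most
  \<open>8 * \<rho> j * 100^k + 1\<close> fractions each. Relative to \<open>l * 100^k\<close>, the
  first summands cost at most \<open>16 / 1000\<close> because the series of
  \<open>radius_ratio\<close> has a small tail, and the ones cost at most \<open>2 / 99\<close>.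
  Together this is less than the 1/20 that may be lost from the initial 1/10.\<close>

lemma card_good_points_ge:
  assumes l: "l > 0" and s: "s > 2" and \<kappa>: "0 < \<kappa>" "\<kappa> \<le> 1"
  defines "\<rho> \<equiv> \<lambda>k. \<kappa> * (10^k) powr (- s)"
  shows "\<forall>\<^sub>F k1 in sequentially. \<forall>k\<ge>k1. 100 ^ k * l / 20 \<le> real (card (good_points \<rho> a l k1 k))"
proof -
  define r :: real where "r = 10 powr (2 - s)"
  have r: "0 < r" "r < 1" using s by (auto simp: r_def powr_less_one)
  have \<rho>: "0 < \<rho> j" for j using \<kappa> by (simp add: \<rho>_def)
  have \<rho>r: "100 ^ j * \<rho> j \<le> r ^ j" for j
    using \<kappa> r radius_ratio[of j s] by (simp add: \<rho>_def r_def mult.left_commute mult_le_cancel_right1)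
  have "\<forall>\<^sub>F k in sequentially. l * real (10^k) ^ 2 / 10 \<le> real (card (rats (10^k) \<inter> {a..a + l}))"
    by (rule eventually_subseq[OF _ card_rats_ge[OF l]]) (simp add: strict_mono_def)
  then have "\<forall>\<^sub>F k1 in sequentially. \<forall>k\<ge>k1. l * real (10^k) ^ 2 / 10 \<le> real (card (rats (10^k) \<inter> {a..a + l}))"
    by (rule eventually_all_ge_at_top)
  \<comment> \<open>Absorbs the summand 1 in the bound \<open>l * 100^j + 1\<close> for the number
    of fractions of level \<open>j\<close>.\<close>
  moreover have "\<forall>\<^sub>F k1 in sequentially. 1 \<le> l * 100 ^ k1"
    using l by real_asymp
  moreover have "(\<lambda>k. r ^ k / (1 - r)) \<longlonglongrightarrow> 0"
    using LIMSEQ_power_zero[of r] r by (auto intro!: tendsto_eq_intros)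
  then have "\<forall>\<^sub>F k1 in sequentially. r ^ k1 / (1 - r) < 1/1000"
    by (rule order_tendstoD) simp
  ultimately show ?thesis
  proof eventually_elim
    case (elim k1)
    show ?case
    proof (intro allI impI)
      fix k assume k: "k1 \<le> k"
      define I where "I = {a..a + l}"
      define Rem where "Rem = (\<Union>j\<in>{k1..<k}. \<Union>x\<in>rats (10^j) \<inter> I. rats (10^k) \<inter> {x - 4 * \<rho> j..(x - 4 * \<rho> j) + 8 * \<rho> j})"
      have fin: "finite (rats (10^j) \<inter> {b..b + c})" for j b c by (rule card_rats_le) simp
      have finRem: "finite Rem" unfolding Rem_def I_def using fin by blast
      have "rats (10^k) \<inter> I \<subseteq> good_points \<rho> a l k1 k \<union> Rem"
        by (force simp: good_points_def I_def Rem_def not_le abs_if split: if_splits)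
      moreover have fing: "finite (good_points \<rho> a l k1 k)"
        by (rule finite_subset[OF _ fin[of k a l]]) (auto simp: good_points_def)
      ultimately have "card (rats (10^k) \<inter> I) \<le> card (good_points \<rho> a l k1 k \<union> Rem)"
        using finRem by (intro card_mono) auto
      also have "\<dots> \<le> card (good_points \<rho> a l k1 k) + card Rem" by (rule card_Un_le)
      finally have 1: "real (card (rats (10^k) \<inter> I)) \<le> real (card (good_points \<rho> a l k1 k)) + real (card Rem)"
        by linarith
      have "card Rem \<le> (\<Sum>j\<in>{k1..<k}. \<Sum>x\<in>rats (10^j) \<inter> I. card (rats (10^k) \<inter> {x - 4 * \<rho> j..(x - 4 * \<rho> j) + 8 * \<rho> j}))"
        unfolding Rem_def using fin I_def
        by (intro order_trans[OF card_UN_le] sum_mono) auto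
      then have "real (card Rem) \<le> (\<Sum>j\<in>{k1..<k}. \<Sum>x\<in>rats (10^j) \<inter> I. real (card (rats (10^k) \<inter> {x - 4 * \<rho> j..(x - 4 * \<rho> j) + 8 * \<rho> j})))"
        unfolding of_nat_sum[symmetric] of_nat_le_iff .
      also have "\<dots> \<le> (\<Sum>j\<in>{k1..<k}. 2 * l * 100^j * (8 * \<rho> j * 100^k + 1))"
      proof (rule sum_mono)
        fix j assume j: "j \<in> {k1..<k}"
        have sq: "real (10^i) ^ 2 = 100 ^ i" for i by (simp add: power2_eq_square flip: power_mult_distrib)
        have "real (card (rats (10^k) \<inter> {x - 4 * \<rho> j..(x - 4 * \<rho> j) + 8 * \<rho> j})) \<le> 8 * \<rho> j * 100^k + 1" for x
          using card_rats_le(2)[of "10^k" "8 * \<rho> j" "x - 4 * \<rho> j"] \<rho>[of j] unfolding sq by simp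
        then have "(\<Sum>x\<in>rats (10^j) \<inter> I. real (card (rats (10^k) \<inter> {x - 4 * \<rho> j..(x - 4 * \<rho> j) + 8 * \<rho> j})))
          \<le> real (card (rats (10^j) \<inter> I)) * (8 * \<rho> j * 100^k + 1)"
          by (intro sum_bounded_above) auto
        also have "\<dots> \<le> 2 * l * 100^j * (8 * \<rho> j * 100^k + 1)"
        proof (rule mult_right_mono)
          have "l * 100 ^ k1 \<le> l * 100 ^ j" using j l by (intro mult_left_mono power_increasing) auto
          moreover have "real (card (rats (10^j) \<inter> I)) \<le> l * 100 ^ j + 1"
            using card_rats_le(2)[of "10^j" l a] l unfolding sq I_def by simp
          ultimately show "real (card (rats (10^j) \<inter> I)) \<le> 2 * l * 100^j" using elim by linarith
        qed (use \<rho>[of j] in simp)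
        finally show "(\<Sum>x\<in>rats (10^j) \<inter> I. real (card (rats (10^k) \<inter> {x - 4 * \<rho> j..(x - 4 * \<rho> j) + 8 * \<rho> j})))
           \<le> 2 * l * 100^j * (8 * \<rho> j * 100^k + 1)" .
      qed
      also have "\<dots> = 16 * l * 100^k * (\<Sum>j\<in>{k1..<k}. 100 ^ j * \<rho> j) + 2 * l * (\<Sum>j\<in>{k1..<k}. 100 ^ j)"
        by (simp add: sum_distrib_left sum.distrib algebra_simps)
      also have "\<dots> \<le> 16 * l * 100^k * (1/1000) + 2 * l * (100 ^ k / 99)"
      proof (intro add_mono mult_left_mono sum_powers_100)
        have "(\<Sum>j\<in>{k1..<k}. 100 ^ j * \<rho> j) \<le> (\<Sum>j\<in>{k1..<k}. r ^ j)"
          by (intro sum_mono \<rho>r)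
        also have "\<dots> = (r ^ k1 - r ^ k) / (1 - r)"
        proof -
          have "(\<Sum>j\<in>{k1..<k}. r ^ j) * (1 - r) = r ^ k1 - r ^ k"
            using k
          proof (induction k rule: dec_induct)
            case (step n)
            have "(\<Sum>j\<in>{k1..<Suc n}. r ^ j) * (1 - r) = (\<Sum>j\<in>{k1..<n}. r ^ j) * (1 - r) + r ^ n * (1 - r)"
              using step by (simp add: distrib_right)
            then show ?case unfolding step.IH by (simp add: algebra_simps)
          qed simp
          then show ?thesis using r by (simp add: field_simps)
        qed
        also have "\<dots> \<le> r ^ k1 / (1 - r)" using r by (intro divide_right_mono) auto
        finally show "(\<Sum>j\<in>{k1..<k}. 100 ^ j * \<rho> j) \<le> 1/1000" using elim by linarith
      qed (use l in auto)
      also have "\<dots> = 448 / 12375 * (100 ^ k * l)" by simp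
      finally have 2: "real (card Rem) \<le> 448 / 12375 * (100 ^ k * l)" .
      have "l * real (10^k) ^ 2 / 10 \<le> real (card (rats (10^k) \<inter> I))"
        using elim k unfolding I_def by blast
      moreover have "real (10^k) ^ 2 = 100 ^ k" by (simp add: power2_eq_square flip: power_mult_distrib)
      then have "l * real (10^k) ^ 2 / 10 = 100 ^ k * l / 10" by simp
      moreover have "0 < 100 ^ k * l" using l by simp
      ultimately show "100 ^ k * l / 20 \<le> real (card (good_points \<rho> a l k1 k))"
        using 1 2 by linarith
    qed
  qed
qed

section \<open>Selecting a smaller ball\<close>

context dim_gauge
begin

text \<open>\<open>M\<close> indexes the balls met by the interval with centre \<open>m\<close> and
  half-length \<open>e\<close>. Centres of two such balls of levels \<open>j \<le> k\<close> are at
  distance at most \<open>2 * \<rho> j + 2 * e\<close> and at least \<open>4 * \<rho> j\<close>.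
  Hence they are within \<open>4 * e\<close>, and \<open>\<rho> j\<close> and
  \<open>1 / 100^k\<close> are at most constants times \<open>e\<close>. Separation by
  \<open>1 / 100^k\<close> then bounds the number of balls of each level.\<close>

lemma weight_two_balls:
  fixes X :: "nat \<Rightarrow> real set" and \<rho> :: "nat \<Rightarrow> real" and m e :: real
  assumes K: "finite K" and X: "\<And>k. k \<in> K \<Longrightarrow> finite (X k)"
    and \<rho>: "\<And>k. k \<in> K \<Longrightarrow> 0 < \<rho> k"
    and anti: "\<And>j k. j \<in> K \<Longrightarrow> k \<in> K \<Longrightarrow> j \<le> k \<Longrightarrow> \<rho> k \<le> \<rho> j"
    and sep: "\<And>j k x y. j \<in> K \<Longrightarrow> k \<in> K \<Longrightarrow> j \<le> k \<Longrightarrow> x \<in> X j \<Longrightarrow> y \<in> X k \<Longrightarrow> (j, x) \<noteq> (k, y) \<Longrightarrow>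
         4 * \<rho> j \<le> \<bar>x - y\<bar> \<and> 1 / 100 ^ k \<le> \<bar>x - y\<bar>"
    and e: "e \<ge> 0"
  defines "M \<equiv> SIGMA k:K. {x \<in> X k. \<bar>x - m\<bar> \<le> \<rho> k + e}"
  assumes two: "u \<in> M" "v \<in> M" "u \<noteq> v"
  shows "(\<Sum>u\<in>M. g (\<rho> (fst u))) \<le> 8 * e * (\<Sum>k\<in>K. 100 ^ k * g (\<rho> k)) + g (2 * e)"
proof -
  define N where "N k = {x \<in> X k. \<bar>x - m\<bar> \<le> \<rho> k + e}" for k
  have finN: "finite (N k)" if "k \<in> K" for k using X[OF that] by (simp add: N_def)
  have M: "M = (SIGMA k:K. N k)" by (simp add: M_def N_def)
  have finM: "finite M" unfolding M using K finN by auto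
  have close: "\<bar>x - y\<bar> \<le> 4 * e \<and> \<rho> j \<le> 2 * e \<and> 1 / 100 ^ k \<le> 4 * e"
    if "j \<in> K" "k \<in> K" "j \<le> k" "x \<in> N j" "y \<in> N k" "(j, x) \<noteq> (k, y)" for j k x y
  proof -
    have "4 * \<rho> j \<le> \<bar>x - y\<bar>" "1 / 100 ^ k \<le> \<bar>x - y\<bar>"
      using sep[OF that(1-3) _ _ that(6)] that by (auto simp: N_def)
    moreover have "\<bar>x - m\<bar> \<le> \<rho> j + e" "\<bar>y - m\<bar> \<le> \<rho> k + e" using that by (auto simp: N_def)
    moreover have "\<rho> k \<le> \<rho> j" using anti that by simp
    ultimately show ?thesis using e by linarith
  qed
  have cardN: "real (card (N k)) \<le> 4 * e * 100 ^ k + 1" if k: "k \<in> K" for k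
  proof (cases "N k = {}")
    case False
    have sub: "N k \<subseteq> {Min (N k)..Min (N k) + 4 * e}"
    proof
      fix x assume x: "x \<in> N k"
      have "Min (N k) \<in> N k" using False finN[OF k] by simp
      then have "x = Min (N k) \<or> \<bar>x - Min (N k)\<bar> \<le> 4 * e" using close[OF k k order_refl x] by auto
      moreover have "Min (N k) \<le> x" using finN[OF k] x by simp
      ultimately show "x \<in> {Min (N k)..Min (N k) + 4 * e}" using e by auto
    qed
    have "real (card (N k)) \<le> 4 * e / (1 / 100 ^ k) + 1"
      using sep[OF k k order_refl] e
      by (intro card_separated_le(2)[OF sub]) (auto simp: N_def)
    then show ?thesis by simp
  qed (use e in simp)
  \<comment> \<open>The count \<open>4 * e * 100^k + 1\<close> has an extra 1. On every occupied
    level but the lowest, comparison with the ball at \<open>x0\<close> gives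
    \<open>1 \<le> 4 * e * 100^k\<close>, which absorbs it. On the lowest level the extra ball costs
    \<open>g (\<rho> k0) \<le> g (2 * e)\<close>.\<close>
  define k0 where "k0 = Min (fst ` M)"
  have k0: "k0 \<in> fst ` M" unfolding k0_def using finM two by (intro Min_in) auto
  have k0_le: "k0 \<le> fst w" if "w \<in> M" for w unfolding k0_def using finM that by simp
  obtain x0 where x0: "(k0, x0) \<in> M" using k0 by auto
  have k0K: "k0 \<in> K" "x0 \<in> N k0" using x0 by (auto simp: M)
  obtain w where w: "w \<in> M" "w \<noteq> (k0, x0)" using two by metis
  have "\<rho> k0 \<le> 2 * e"
    using close[of k0 "fst w" x0 "snd w"] w k0K k0_le[OF w(1)] by (auto simp: M)
  then have gk0: "g (\<rho> k0) \<le> g (2 * e)" using \<rho>[OF k0K(1)] by (intro mono) auto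
  have cardN': "real (card (N k)) \<le> 8 * e * 100 ^ k" if k: "k \<in> K" "k \<noteq> k0" for k
  proof (cases "N k = {}")
    case False
    then obtain y where y: "y \<in> N k" by auto
    then have "(k, y) \<in> M" using k by (simp add: M)
    then have "k0 \<le> k" using k0_le by fastforce
    then have "1 / 100 ^ k \<le> 4 * e" using close[of k0 k x0 y] k0K k y by simp
    then have "1 \<le> 4 * e * 100 ^ k" by (simp add: field_simps)
    with cardN[OF k(1)] show ?thesis by linarith
  qed (use e in simp)
  have "(\<Sum>u\<in>M. g (\<rho> (fst u))) = (\<Sum>k\<in>K. \<Sum>x\<in>N k. g (\<rho> k))"
    unfolding M using K finN by (subst sum.Sigma) (auto simp: case_prod_unfold)
  also have "\<dots> = (\<Sum>k\<in>K. real (card (N k)) * g (\<rho> k))" by simp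
  also have "\<dots> \<le> (\<Sum>k\<in>K. 8 * e * (100 ^ k * g (\<rho> k)) + (if k = k0 then g (2 * e) else 0))"
  proof (rule sum_mono)
    fix k assume k: "k \<in> K"
    have g0: "0 \<le> g (\<rho> k)" using nonneg \<rho>[OF k] by simp
    show "real (card (N k)) * g (\<rho> k) \<le> 8 * e * (100 ^ k * g (\<rho> k)) + (if k = k0 then g (2 * e) else 0)"
    proof (cases "k = k0")
      case True
      have "real (card (N k)) * g (\<rho> k) \<le> (4 * e * 100 ^ k + 1) * g (\<rho> k)"
        using cardN[OF k] g0 by (rule mult_right_mono)
      also have "\<dots> \<le> (8 * e * 100 ^ k) * g (\<rho> k) + g (\<rho> k)"
        using g0 e by (simp add: algebra_simps)
      finally show ?thesis using True gk0 by simp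
    next
      case False
      with mult_right_mono[OF cardN'[OF k] g0] show ?thesis by simp
    qed
  qed
  also have "\<dots> = 8 * e * (\<Sum>k\<in>K. 100 ^ k * g (\<rho> k)) + g (2 * e)"
    using K k0K by (simp add: sum.distrib sum_distrib_left)
  finally show ?thesis .
qed

text \<open>A pigeonhole argument with weights \<open>w\<close>. With \<open>S\<close> the block
  sum, all balls weigh at least \<open>l * S / 20\<close>. Those met by a \<open>big\<close>
  interval, one meeting two balls, weigh at most
  \<open>4 * S * (l / 320) + T = l * S / 80 + T\<close>, so the rest \<open>Z\<close> keeps at least
  \<open>l * S / 40\<close>.\<close>

lemma finite_selection:
  fixes X :: "nat \<Rightarrow> real set" and \<rho> :: "nat \<Rightarrow> real" and m e :: "'i \<Rightarrow> real"
  assumes K: "finite K" and X: "\<And>k. k \<in> K \<Longrightarrow> finite (X k)"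
    and \<rho>: "\<And>k. k \<in> K \<Longrightarrow> 0 < \<rho> k"
    and anti: "\<And>j k. j \<in> K \<Longrightarrow> k \<in> K \<Longrightarrow> j \<le> k \<Longrightarrow> \<rho> k \<le> \<rho> j"
    and sep: "\<And>j k x y. j \<in> K \<Longrightarrow> k \<in> K \<Longrightarrow> j \<le> k \<Longrightarrow> x \<in> X j \<Longrightarrow> y \<in> X k \<Longrightarrow> (j, x) \<noteq> (k, y) \<Longrightarrow>
         4 * \<rho> j \<le> \<bar>x - y\<bar> \<and> 1 / 100 ^ k \<le> \<bar>x - y\<bar>"
    and card: "\<And>k. k \<in> K \<Longrightarrow> 100 ^ k * l / 20 \<le> real (card (X k))"
    and F: "finite F" and e: "\<And>p. p \<in> F \<Longrightarrow> 0 \<le> e p"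
    and Fsum: "(\<Sum>p\<in>F. 2 * e p) \<le> l / 320" and Fg: "(\<Sum>p\<in>F. g (2 * e p)) \<le> T"
    and T: "T < l * (\<Sum>k\<in>K. 100 ^ k * g (\<rho> k)) / 25600"
  shows "\<exists>k\<in>K. \<exists>x\<in>X k. (\<Sum>p\<in>{p\<in>F. \<bar>x - m p\<bar> \<le> \<rho> k + e p}. 2 * e p) \<le> \<rho> k / 640"
proof -
  define S where "S = (\<Sum>k\<in>K. 100 ^ k * g (\<rho> k))"
  define Y where "Y = (SIGMA k:K. X k)"
  define w where "w u = g (\<rho> (fst u))" for u :: "nat \<times> real"
  define M where "M p = {u \<in> Y. \<bar>snd u - m p\<bar> \<le> \<rho> (fst u) + e p}" for p
  define big where "big = {p \<in> F. \<exists>u\<in>M p. \<exists>v\<in>M p. u \<noteq> v}"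
  have finY: "finite Y" unfolding Y_def using K X by auto
  have finM: "finite (M p)" for p using finY by (simp add: M_def)
  have w: "0 < w u" if "u \<in> Y" for u using that pos \<rho> by (auto simp: w_def Y_def)
  have S0: "S \<ge> 0" unfolding S_def using nonneg \<rho> by (intro sum_nonneg mult_nonneg_nonneg) (auto intro: less_imp_le)
  have T0: "0 \<le> T" using Fg nonneg e by (intro order_trans[OF sum_nonneg Fg]) auto
  have W: "l * S / 20 \<le> sum w Y"
  proof -
    have "l * S / 20 = (\<Sum>k\<in>K. (100 ^ k * l / 20) * g (\<rho> k))"
      by (simp add: S_def sum_distrib_left sum_divide_distrib mult_ac)
    also have "\<dots> \<le> (\<Sum>k\<in>K. real (card (X k)) * g (\<rho> k))"
      using card nonneg \<rho> by (intro sum_mono mult_right_mono) (auto intro: less_imp_le)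
    also have "\<dots> = (\<Sum>k\<in>K. \<Sum>x\<in>X k. g (\<rho> k))" by simp
    also have "\<dots> = sum w Y"
      unfolding Y_def w_def using K X by (subst sum.Sigma) (auto simp: case_prod_unfold)
    finally show ?thesis .
  qed
  have Wbig: "sum w (\<Union>p\<in>big. M p) \<le> l * S / 80 + T"
  proof -
    have "sum w (\<Union>p\<in>big. M p) \<le> (\<Sum>p\<in>big. sum w (M p))"
    proof -
      have "sum w (\<Union>p\<in>B. M p) \<le> (\<Sum>p\<in>B. sum w (M p))" if "finite B" for B
        using that
      proof induction
        case (insert p B)
        have "sum w (M p \<union> (\<Union>q\<in>B. M q)) \<le> sum w (M p) + sum w (\<Union>q\<in>B. M q)"
        proof -
          have "0 \<le> sum w (M p \<inter> (\<Union>q\<in>B. M q))"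
            by (intro sum_nonneg less_imp_le w) (auto simp: M_def)
          then show ?thesis using finM insert(1) by (subst sum_Un) auto
        qed
        then show ?case using insert by simp
      qed simp
      then show ?thesis using F by (simp add: big_def)
    qed
    also have "\<dots> \<le> (\<Sum>p\<in>big. 4 * S * (2 * e p) + g (2 * e p))"
    proof (rule sum_mono)
      fix p assume p: "p \<in> big"
      have Meq: "M p = (SIGMA k:K. {x \<in> X k. \<bar>x - m p\<bar> \<le> \<rho> k + e p})"
        by (auto simp: M_def Y_def)
      obtain u v where uv: "u \<in> M p" "v \<in> M p" "u \<noteq> v" using p by (auto simp: big_def)
      have "0 \<le> e p" using p e by (auto simp: big_def)
      from weight_two_balls[OF K X \<rho> anti sep this uv[unfolded Meq]]
      show "sum w (M p) \<le> 4 * S * (2 * e p) + g (2 * e p)"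
        by (simp add: Meq w_def[abs_def] S_def mult_ac)
    qed
    also have "\<dots> \<le> (\<Sum>p\<in>F. 4 * S * (2 * e p) + g (2 * e p))"
      using F S0 e nonneg by (intro sum_mono2 add_nonneg_nonneg mult_nonneg_nonneg) (auto simp: big_def)
    also have "\<dots> = 4 * S * (\<Sum>p\<in>F. 2 * e p) + (\<Sum>p\<in>F. g (2 * e p))"
      by (simp add: sum.distrib sum_distrib_left)
    also have "\<dots> \<le> 4 * S * (l / 320) + T"
      using Fsum Fg S0 by (intro add_mono mult_left_mono) auto
    finally show ?thesis by (simp add: mult_ac)
  qed
  define Z where "Z = Y - (\<Union>p\<in>big. M p)"
  have finZ: "finite Z" using finY by (simp add: Z_def)
  have "sum w Z = sum w Y - sum w (\<Union>p\<in>big. M p)"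
    unfolding Z_def by (rule sum_diff[OF finY]) (auto simp: M_def)
  moreover have TS: "T < l * S / 25600" using T by (simp add: S_def)
  ultimately have WZ: "l * S / 40 \<le> sum w Z" using W Wbig T0 by linarith
  define FM where "FM u = {p \<in> F. u \<in> M p}" for u
  \<comment> \<open>An interval meeting a ball of \<open>Z\<close> is not \<open>big\<close>, so the
    families \<open>FM u\<close> are disjoint and their gauge sums add up to at most
    \<open>T\<close>. As \<open>25600 = 40 * 640\<close>, they cannot all reach
    \<open>w u / 640\<close>.\<close>
  have "\<exists>u\<in>Z. (\<Sum>p\<in>FM u. g (2 * e p)) < w u / 640"
  proof (rule ccontr)
    assume "\<not> ?thesis"
    then have "sum w Z / 640 \<le> (\<Sum>u\<in>Z. \<Sum>p\<in>FM u. g (2 * e p))"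
      unfolding sum_divide_distrib by (intro sum_mono) (auto simp: not_less)
    also have "\<dots> = (\<Sum>p\<in>\<Union>(FM ` Z). g (2 * e p))"
    proof (rule sum.UNION_disjoint[symmetric, OF finZ])
      show "\<forall>u\<in>Z. finite (FM u)" using F by (simp add: FM_def)
      show "\<forall>u\<in>Z. \<forall>v\<in>Z. u \<noteq> v \<longrightarrow> FM u \<inter> FM v = {}"
        by (fastforce simp: FM_def Z_def big_def)
    qed
    also have "\<dots> \<le> (\<Sum>p\<in>F. g (2 * e p))"
      using F e nonneg by (intro sum_mono2) (auto simp: FM_def)
    also have "\<dots> \<le> T" by (rule Fg)
    finally show False using WZ TS by linarith
  qed
  then obtain u where u: "u \<in> Z" "(\<Sum>p\<in>FM u. g (2 * e p)) < w u / 640" by auto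
  obtain k x where kx: "u = (k, x)" by (cases u)
  have k: "k \<in> K" "x \<in> X k" using u kx by (auto simp: Z_def Y_def)
  have FM: "FM u = {p\<in>F. \<bar>x - m p\<bar> \<le> \<rho> k + e p}" using k by (auto simp: FM_def M_def Y_def kx)
  have wu: "w u = g (\<rho> k)" by (simp add: w_def kx)
  have gk: "0 < g (\<rho> k)" using pos \<rho> k by simp
  \<comment> \<open>From gauge sums back to lengths: every interval left is shorter than
    \<open>\<rho> k\<close>, and on such lengths \<open>g t / t\<close> is at least
    \<open>g (\<rho> k) / \<rho> k\<close>.\<close>
  have "(\<Sum>p\<in>FM u. 2 * e p) * g (\<rho> k) = (\<Sum>p\<in>FM u. 2 * e p * g (\<rho> k))" by (simp add: sum_distrib_right)
  also have "\<dots> \<le> (\<Sum>p\<in>FM u. \<rho> k * g (2 * e p))"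
  proof (rule sum_mono)
    fix p assume p: "p \<in> FM u"
    have e0: "0 \<le> e q" if "q \<in> FM u" for q using that e by (simp add: FM_def)
    have "g (2 * e p) \<le> (\<Sum>p\<in>FM u. g (2 * e p))"
      using p F e0 nonneg by (intro member_le_sum) (auto simp: FM_def)
    with u(2) wu gk have "g (2 * e p) < g (\<rho> k)" by linarith
    then have "2 * e p \<le> \<rho> k" using mono[of "\<rho> k" "2 * e p"] \<rho>[OF k(1)] by linarith
    then show "2 * e p * g (\<rho> k) \<le> \<rho> k * g (2 * e p)" using e0[OF p] by (intro quot') auto
  qed
  also have "\<dots> = \<rho> k * (\<Sum>p\<in>FM u. g (2 * e p))" by (simp add: sum_distrib_left)
  also have "\<dots> \<le> \<rho> k * (w u / 640)" using u(2) \<rho>[OF k(1)] by (intro mult_left_mono) auto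
  finally have "(\<Sum>p\<in>FM u. 2 * e p) * g (\<rho> k) \<le> \<rho> k / 640 * g (\<rho> k)" by (simp add: wu)
  then have "(\<Sum>p\<in>FM u. 2 * e p) \<le> \<rho> k / 640" using gk by (simp add: mult_le_cancel_right)
  with k FM show ?thesis by auto
qed

text \<open>The hypothesis and conclusion on lengths have the same shape, so that the step can be
  iterated. The cover may be infinite and enters only through finite subfamilies. New centres lie
  strictly to the right of \<open>z\<close>, with room for the whole new ball to the left of
  \<open>z + R\<close>.\<close>

lemma selection_step:
  fixes m e :: "'i \<Rightarrow> real"
  assumes div: "\<not> summable (\<lambda>q. g (real (Suc q) powr (- s / 2)))"
    and s: "s > 2" and \<kappa>: "0 < \<kappa>" "\<kappa> \<le> 1" and R: "R > 0" and e: "\<And>p. 0 \<le> e p"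
    and Fsum: "\<And>F. finite F \<Longrightarrow> F \<subseteq> {p. \<bar>z - m p\<bar> \<le> R + e p} \<Longrightarrow> (\<Sum>p\<in>F. 2 * e p) \<le> R / 640"
    and Fg: "\<And>F. finite F \<Longrightarrow> (\<Sum>p\<in>F. g (2 * e p)) \<le> T"
  shows "\<exists>k x. x \<in> rats (10^k) \<and> z + R / 4 \<le> x \<and> x \<le> z + 3 * R / 4 \<and> \<kappa> * (10^k) powr (- s) \<le> R / 5 \<and>
    (\<forall>F. finite F \<longrightarrow> F \<subseteq> {p. \<bar>x - m p\<bar> \<le> \<kappa> * (10^k) powr (- s) + e p}
       \<longrightarrow> (\<Sum>p\<in>F. 2 * e p) \<le> \<kappa> * (10^k) powr (- s) / 640)"
proof -
  define \<rho> where "\<rho> k = \<kappa> * (10^k) powr (- s)" for k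
  define a where "a = z + R / 4"
  define l where "l = R / 2"
  have l: "l > 0" using R by (simp add: l_def)
  have \<rho>0: "0 < \<rho> k" for k using \<kappa> by (simp add: \<rho>_def)
  have \<rho>_anti: "\<rho> k \<le> \<rho> j" if "j \<le> k" for j k
    unfolding \<rho>_def using \<kappa> s that by (intro mult_left_mono powr_mono2') (auto intro: power_increasing)
  have "\<forall>\<^sub>F k1 in sequentially. \<forall>k\<ge>k1. 100 ^ k * l / 20 \<le> real (card (good_points \<rho> a l k1 k))"
    using card_good_points_ge[OF l s \<kappa>] by (simp add: \<rho>_def[abs_def])
  moreover have "\<forall>\<^sub>F k1 in sequentially. \<forall>k\<ge>k1. \<rho> k \<le> R / 5"
  proof (rule eventually_all_ge_at_top)
    have "(\<lambda>k. \<kappa> * (10^k) powr (- s)) \<longlonglongrightarrow> 0" using s by real_asymp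
    then have "\<forall>\<^sub>F k in sequentially. \<rho> k < R / 5" unfolding \<rho>_def using R by (intro order_tendstoD) auto
    then show "\<forall>\<^sub>F k in sequentially. \<rho> k \<le> R / 5" by eventually_elim simp
  qed
  \<comment> \<open>Gives the separation by \<open>4 * \<rho> k\<close> within one level, where
    fractions are only known to be \<open>1 / 100^k\<close> apart; between levels it is built into
    \<open>good_points\<close>.\<close>
  moreover have "\<forall>\<^sub>F k1 in sequentially. \<forall>k\<ge>k1. 4 * \<rho> k \<le> 1 / 100 ^ k"
  proof (rule eventually_all_ge_at_top)
    have "(\<lambda>k. 4 * \<kappa> * (10 powr (2 - s)) ^ k) \<longlonglongrightarrow> 4 * \<kappa> * 0"
      using s by (intro tendsto_mult tendsto_const LIMSEQ_power_zero) (auto simp: powr_less_one)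
    then have "\<forall>\<^sub>F k in sequentially. 4 * \<kappa> * (10 powr (2 - s)) ^ k < 1"
      by (rule order_tendstoD) simp
    then show "\<forall>\<^sub>F k in sequentially. 4 * \<rho> k \<le> 1 / 100 ^ k"
      by eventually_elim (simp add: \<rho>_def field_simps flip: radius_ratio)
  qed
  ultimately have "\<forall>\<^sub>F k1 in sequentially. (\<forall>k\<ge>k1. 100 ^ k * l / 20 \<le> real (card (good_points \<rho> a l k1 k))) \<and>
      (\<forall>k\<ge>k1. \<rho> k \<le> R / 5) \<and> (\<forall>k\<ge>k1. 4 * \<rho> k \<le> 1 / 100 ^ k)"
    by eventually_elim auto
  from eventually_happens'[OF sequentially_bot this]
  obtain k1 where k1: "\<And>k. k \<ge> k1 \<Longrightarrow> 100 ^ k * l / 20 \<le> real (card (good_points \<rho> a l k1 k))"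
      "\<And>k. k \<ge> k1 \<Longrightarrow> \<rho> k \<le> R / 5" "\<And>k. k \<ge> k1 \<Longrightarrow> 4 * \<rho> k \<le> 1 / 100 ^ k"
    by blast
  obtain k2 where k2: "k2 \<ge> k1" "T * 25600 / l + 1 \<le> (\<Sum>k=k1..k2. 100 ^ k * g (\<rho> k))"
    using block_sums_unbounded[OF div _ \<kappa>, of k1] s unfolding \<rho>_def by auto
  define X where "X = good_points \<rho> a l k1"
  define K where "K = {k1..k2}"
  have XI: "X k \<subseteq> rats (10^k) \<inter> {a..a + l}" for k by (auto simp: X_def good_points_def)
  have finX: "finite (X k)" for k
    using finite_subset[OF XI card_rats_le(1)] by simp
  have cardX: "100 ^ k * l / 20 \<le> real (card (X k))" if "k \<in> K" for k
    using k1(1) that by (simp add: X_def K_def)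
  have sep: "4 * \<rho> j \<le> \<bar>x - y\<bar> \<and> 1 / 100 ^ k \<le> \<bar>x - y\<bar>"
    if jk: "j \<in> K" "k \<in> K" "j \<le> k" and xy: "x \<in> X j" "y \<in> X k" "(j, x) \<noteq> (k, y)" for j k x y
  proof -
    have h: "(100::real) ^ k = 10 ^ k * 10 ^ k" by (simp flip: power_mult_distrib)
    have "x \<noteq> y \<Longrightarrow> 1 / (real (10^j) * real (10^k)) \<le> \<bar>x - y\<bar>"
      using XI xy by (intro rats_separated) auto
    moreover have "1 / (100::real) ^ k \<le> 1 / (real (10^j) * real (10^k))"
      unfolding h using jk by (intro divide_left_mono mult_mono) (auto intro: power_increasing)
    ultimately have r: "x \<noteq> y \<Longrightarrow> 1 / 100 ^ k \<le> \<bar>x - y\<bar>" by linarith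
    show ?thesis
    proof (cases "j = k")
      case True
      then show ?thesis using r xy k1(3)[of k] jk by (auto simp: K_def)
    next
      case False
      then have "j \<in> {k1..<k}" using jk by (auto simp: K_def)
      then have 1: "4 * \<rho> j \<le> \<bar>x - y\<bar>" using xy(2) XI[of j] xy(1) unfolding X_def good_points_def by blast
      then have "x \<noteq> y" using \<rho>0[of j] by auto
      with 1 r show ?thesis by simp
    qed
  qed
  have T: "T < l * (\<Sum>k\<in>K. 100 ^ k * g (\<rho> k)) / 25600"
  proof -
    have "T * 25600 / l < (\<Sum>k\<in>K. 100 ^ k * g (\<rho> k))" using k2(2) by (simp add: K_def)
    then show ?thesis using l by (simp add: field_simps)
  qed
  \<comment> \<open>A finiteness argument reduces to \<open>finite_selection\<close>: there are only
    finitely many candidate balls, so if each had a finite subfamily violating the bound, the union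
    of these subfamilies would be a finite family that defeats every ball.\<close>
  have "\<exists>k\<in>K. \<exists>x\<in>X k. \<forall>F. finite F \<longrightarrow> F \<subseteq> {p. \<bar>x - m p\<bar> \<le> \<rho> k + e p} \<longrightarrow> (\<Sum>p\<in>F. 2 * e p) \<le> \<rho> k / 640"
  proof (rule ccontr)
    assume "\<not> ?thesis"
    then have ex: "\<exists>F. finite F \<and> F \<subseteq> {p. \<bar>x - m p\<bar> \<le> \<rho> k + e p} \<and> \<rho> k / 640 < (\<Sum>p\<in>F. 2 * e p)"
      if "k \<in> K" "x \<in> X k" for k x using that by (meson not_le)
    define \<Phi> where "\<Phi> k x = (SOME F. finite F \<and> F \<subseteq> {p. \<bar>x - m p\<bar> \<le> \<rho> k + e p} \<and> \<rho> k / 640 < (\<Sum>p\<in>F. 2 * e p))" for k x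
    have \<Phi>: "finite (\<Phi> k x)" "\<Phi> k x \<subseteq> {p. \<bar>x - m p\<bar> \<le> \<rho> k + e p}" "\<rho> k / 640 < (\<Sum>p\<in>\<Phi> k x. 2 * e p)"
      if "k \<in> K" "x \<in> X k" for k x
      using someI_ex[OF ex[OF that]] unfolding \<Phi>_def by blast+
    define F where "F = (\<Union>k\<in>K. \<Union>x\<in>X k. \<Phi> k x)"
    have finF: "finite F" unfolding F_def using finX \<Phi>(1) by (auto simp: K_def)
    have "F \<subseteq> {p. \<bar>z - m p\<bar> \<le> R + e p}"
    proof
      fix p assume "p \<in> F"
      then obtain k x where kx: "k \<in> K" "x \<in> X k" "p \<in> \<Phi> k x" by (auto simp: F_def)
      then have "\<bar>x - m p\<bar> \<le> \<rho> k + e p" using \<Phi>(2) by auto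
      moreover have "\<rho> k \<le> R / 5" using k1(2) kx by (simp add: K_def)
      moreover have "\<bar>z - x\<bar> \<le> 3 * R / 4" using XI kx R by (fastforce simp: a_def l_def)
      ultimately have "\<bar>z - m p\<bar> \<le> R + e p" by linarith
      then show "p \<in> {p. \<bar>z - m p\<bar> \<le> R + e p}" by simp
    qed
    then have "(\<Sum>p\<in>F. 2 * e p) \<le> l / 320" using Fsum[OF finF] by (simp add: l_def)
    from finite_selection[where m = m, OF _ finX \<rho>0 \<rho>_anti sep cardX finF e this Fg[OF finF] T]
    obtain k x where kx: "k \<in> K" "x \<in> X k" and le: "(\<Sum>p\<in>{p\<in>F. \<bar>x - m p\<bar> \<le> \<rho> k + e p}. 2 * e p) \<le> \<rho> k / 640"
      by (auto simp: K_def)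
    have "(\<Sum>p\<in>\<Phi> k x. 2 * e p) \<le> (\<Sum>p\<in>{p\<in>F. \<bar>x - m p\<bar> \<le> \<rho> k + e p}. 2 * e p)"
    proof (rule sum_mono2)
      show "\<Phi> k x \<subseteq> {p \<in> F. \<bar>x - m p\<bar> \<le> \<rho> k + e p}"
        using \<Phi>(2)[OF kx] kx by (auto simp: F_def)
    qed (use finF e in auto)
    with \<Phi>(3)[OF kx] le show False by linarith
  qed
  then obtain k x where kx: "k \<in> K" "x \<in> X k"
      "\<forall>F. finite F \<longrightarrow> F \<subseteq> {p. \<bar>x - m p\<bar> \<le> \<rho> k + e p} \<longrightarrow> (\<Sum>p\<in>F. 2 * e p) \<le> \<rho> k / 640" by blast
  have "x \<in> rats (10^k)" "z + R / 4 \<le> x" "x \<le> z + 3 * R / 4" using XI[of k] kx(2) by (auto simp: a_def l_def)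
  moreover have "\<rho> k \<le> R / 5" using k1(2) kx by (simp add: K_def)
  ultimately show ?thesis using kx(3) unfolding \<rho>_def by blast
qed

section \<open>Covers of the well approximable numbers\<close>

text \<open>Iterating \<open>selection_step\<close> with \<open>\<kappa> = 1 / (n + 1)\<close>
  produces fractions whose limit is approximated with every constant \<open>K\<close>. The intervals
  of the cover have centre \<open>m p\<close> and positive half-length \<open>e p\<close>.\<close>

lemma uncovered_point:
  assumes div: "\<not> summable (\<lambda>q. g (real (Suc q) powr (- (2 + \<sigma>) / 2)))"
    and \<sigma>: "\<sigma> > 0" and A: "A > 0"
  shows "\<exists>\<delta>>0. \<forall>a b T (m :: 'i \<Rightarrow> real) e. a < b \<longrightarrow> T \<le> A * (b - a) \<longrightarrow>
    (\<forall>p. 0 < e p \<and> 2 * e p \<le> \<delta>) \<longrightarrow> (\<forall>F. finite F \<longrightarrow> (\<Sum>p\<in>F. g (2 * e p)) \<le> T) \<longrightarrow>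
    (\<exists>x\<in>well_approximable \<sigma>. a < x \<and> x < b \<and> (\<forall>p. e p < \<bar>x - m p\<bar>))"
proof -
  define s where "s = 2 + \<sigma>"
  have s: "s > 2" using \<sigma> by (simp add: s_def)
  have div': "\<not> summable (\<lambda>q. g (real (Suc q) powr (- s / 2)))" using div unfolding s_def .
  \<comment> \<open>The first radius is \<open>(b - a) / 2\<close>, so the invariant requires total
    length at most \<open>(b - a) / 1280\<close>. Since \<open>g t \<ge> 1280 * A * t\<close> for
    \<open>t \<le> \<delta>\<close>, a gauge sum of at most \<open>A * (b - a)\<close> guarantees
    it.\<close>
  obtain \<delta> where \<delta>: "\<delta> > 0" "(1280 * A) * \<delta> \<le> g \<delta>"
    using quotient_unbounded[OF div' s] by metis
  show ?thesis
  proof (intro exI[of _ \<delta>] conjI allI impI \<delta>(1))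
    fix a b T :: real and m e :: "'i \<Rightarrow> real"
    assume ab: "a < b" and T: "T \<le> A * (b - a)" and e: "\<forall>p. 0 < e p \<and> 2 * e p \<le> \<delta>"
      and Fg: "\<forall>F. finite F \<longrightarrow> (\<Sum>p\<in>F. g (2 * e p)) \<le> T"
    have e0: "0 \<le> e p" for p using e by (simp add: less_imp_le)
    define P where "P u \<longleftrightarrow> snd u > 0 \<and> a \<le> fst u \<and> fst u + snd u \<le> b \<and> (\<forall>F. finite F \<longrightarrow> F \<subseteq> {p. \<bar>fst u - m p\<bar> \<le> snd u + e p}
        \<longrightarrow> (\<Sum>p\<in>F. 2 * e p) \<le> snd u / 640)" for u
    define Q where "Q n u v \<longleftrightarrow> (\<exists>k. fst v \<in> rats (10^k) \<and> snd v = 1 / real (Suc n) * (10^k) powr (- s)) \<and>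
        fst u + snd u / 4 \<le> fst v \<and> fst v \<le> fst u + 3 * snd u / 4 \<and> snd v \<le> snd u / 5" for n u v
    have "\<exists>w. \<forall>n. P (w n) \<and> Q n (w n) (w (Suc n))"
    proof (rule dependent_nat_choice)
      have "(\<Sum>p\<in>F. 2 * e p) \<le> (b - a) / 2 / 640" if "finite F" for F
      proof -
        have "1280 * A * (\<Sum>p\<in>F. 2 * e p) = (\<Sum>p\<in>F. 1280 * A * (2 * e p))" by (simp add: sum_distrib_left)
        also have "\<dots> \<le> (\<Sum>p\<in>F. g (2 * e p))"
        proof (rule sum_mono)
          fix p
          have "(2 * e p) * (1280 * A * \<delta>) \<le> (2 * e p) * g \<delta>" using \<delta> e0[of p] by (intro mult_left_mono) auto
          also have "\<dots> \<le> \<delta> * g (2 * e p)" using e by (intro quot) auto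
          finally show "1280 * A * (2 * e p) \<le> g (2 * e p)"
            using \<delta>(1) by (simp add: mult_ac mult_le_cancel_left_pos)
        qed
        also have "\<dots> \<le> A * (b - a)" using Fg that T by fastforce
        finally have "A * (1280 * (\<Sum>p\<in>F. 2 * e p)) \<le> A * (b - a)" by (simp add: mult_ac)
        then show ?thesis using A by (simp add: mult_le_cancel_left_pos)
      qed
      then show "\<exists>u. P u" using ab
        by (intro exI[of _ "((a + b) / 2, (b - a) / 2)"]) (simp add: P_def field_simps)
    next
      fix u :: "real \<times> real" and n :: nat
      assume u: "P u"
      have "0 < 1 / real (Suc n)" "1 / real (Suc n) \<le> 1" by auto
      from selection_step[OF div' s this, of "snd u" e "fst u" m T] u e0 Fg
      obtain k x where x: "x \<in> rats (10^k)" "fst u + snd u / 4 \<le> x" "x \<le> fst u + 3 * snd u / 4"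
          "1 / real (Suc n) * (10^k) powr (- s) \<le> snd u / 5"
        and F: "\<forall>F. finite F \<longrightarrow> F \<subseteq> {p. \<bar>x - m p\<bar> \<le> 1 / real (Suc n) * (10^k) powr (- s) + e p}
           \<longrightarrow> (\<Sum>p\<in>F. 2 * e p) \<le> 1 / real (Suc n) * (10^k) powr (- s) / 640"
        unfolding P_def by blast
      show "\<exists>v. P v \<and> Q n u v"
      proof (intro exI conjI)
        show "P (x, 1 / real (Suc n) * (10^k) powr (- s))" using F x u by (simp add: P_def)
        show "Q n u (x, 1 / real (Suc n) * (10^k) powr (- s))" using x unfolding Q_def fst_conv snd_conv by blast
      qed
    qed
    then obtain w where w: "\<And>n. P (w n)" "\<And>n. Q n (w n) (w (Suc n))" by blast
    define z where "z n = fst (w n)" for n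
    define R where "R n = snd (w n)" for n
    have R0: "0 < R n" for n using w(1)[of n] by (simp add: P_def R_def)
    have step: "z n + R n / 4 \<le> z (Suc n)" "z (Suc n) \<le> z n + 3 * R n / 4" "R (Suc n) \<le> R n / 5" for n
      using w(2)[of n] by (auto simp: Q_def z_def R_def)
    have inv: "2 * e p \<le> R n / 640" if "\<bar>z n - m p\<bar> \<le> R n + e p" for n p
    proof -
      have "(\<Sum>q\<in>{p}. 2 * e q) \<le> R n / 640"
        using w(1)[of n] that unfolding P_def z_def R_def by blast
      then show ?thesis by simp
    qed
    have "incseq z" 
    proof (rule incseq_SucI)
      show "z n \<le> z (Suc n)" for n using step(1)[of n] R0[of n] by linarith
    qed
    have "decseq (\<lambda>n. z n + R n)"
    proof (rule decseq_SucI)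
      show "z (Suc n) + R (Suc n) \<le> z n + R n" for n using step[of n] R0[of n] by linarith
    qed
    have zz: "z i \<le> z n + R n" for i n
    proof (cases "i \<le> n")
      case True
      then have "z i \<le> z n" using \<open>incseq z\<close> by (simp add: incseqD)
      then show ?thesis using R0[of n] by linarith
    next
      case False
      then have "z i + R i \<le> z n + R n" using decseqD[OF \<open>decseq (\<lambda>n. z n + R n)\<close>, of n i] by simp
      then show ?thesis using R0[of i] by linarith
    qed
    define x where "x = Sup (range z)"
    have bdd: "bdd_above (range z)" using zz[of _ 0] by (intro bdd_aboveI2)
    have z_le: "z n \<le> x" for n unfolding x_def by (rule cSUP_upper[OF _ bdd]) simp
    have x_le: "x \<le> z n + R n" for n unfolding x_def by (rule cSUP_least) (use zz in auto)
    have x_close: "\<bar>x - z n\<bar> \<le> R n" for n using z_le[of n] x_le[of n] by linarith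
    \<comment> \<open>Strictness comes from moving to the right in each step. It keeps the limit
      away from the centres, which the separation of fractions below requires.\<close>
    have z_less: "z n < x" for n using step(1)[of n] R0[of n] z_le[of "Suc n"] by linarith
    have k: "\<exists>k. z (Suc n) \<in> rats (10^k) \<and> R (Suc n) = 1 / real (Suc n) * (10^k) powr (- s)" for n
      using w(2)[of n] by (simp add: Q_def z_def R_def)
    have "R n \<le> R 0 * (1/5) ^ n" for n
    proof (induction n)
      case (Suc n)
      then show ?case using step(3)[of n] by simp
    qed simp
    moreover have "(\<lambda>n. R 0 * (1/5) ^ n) \<longlonglongrightarrow> 0"
      using tendsto_mult[OF tendsto_const LIMSEQ_power_zero[of "1/5::real"]] by simp
    ultimately have R_lim: "R \<longlonglongrightarrow> 0"
      by (intro tendsto_sandwich[of "\<lambda>_. 0" R]) (auto intro!: always_eventually less_imp_le[OF R0])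
    \<comment> \<open>A denominator \<open>N\<close> of \<open>x\<close> is played against the step
      whose factor is \<open>1 / (N + 1)\<close>: distinct fractions with denominators at most
      \<open>N\<close> and \<open>10^k\<close> are \<open>1 / (N * 10^k)\<close> apart, but the
      limit is within \<open>1 / ((N + 1) * 10^k)\<close> of the centre.\<close>
    have "x \<notin> \<rat>"
    proof
      assume "x \<in> \<rat>"
      then obtain i N where N: "N \<noteq> 0" "x = of_int i / real N"
        unfolding Rats_eq_int_div_nat by blast
      then have "x \<in> rats N" unfolding rats_def by (auto intro!: exI[of _ i] exI[of _ N])
      obtain k where k: "z (Suc N) \<in> rats (10^k)" "R (Suc N) = 1 / real (Suc N) * (10^k) powr (- s)"
        using k[of N] by blast
      have "1 / (real N * real (10^k)) \<le> \<bar>x - z (Suc N)\<bar>"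
        using \<open>x \<in> rats N\<close> k(1) z_less[of "Suc N"] by (intro rats_separated) auto
      also have "\<dots> \<le> 1 / real (Suc N) * (10^k) powr (- s)" using x_close[of "Suc N"] k(2) by simp
      also have "\<dots> \<le> 1 / real (Suc N) * (10^k) powr (- 1)"
        using s by (intro mult_left_mono powr_mono) auto
      also have "\<dots> = 1 / (real (Suc N) * real (10^k))" by (simp add: powr_minus_divide)
      also have "\<dots> < 1 / (real N * real (10^k))"
        using N by (intro divide_strict_left_mono mult_strict_right_mono) auto
      finally show False by simp
    qed
    moreover have "\<exists>(p::int) (q::nat). q \<ge> 1 \<and> \<bar>x - of_int p / real q\<bar> < K / real q powr (\<sigma> + 2)"
      if K: "K > 0" for K
    proof -
      obtain n where n: "1 / real (Suc n) < K" using K nat_approx_posE by blast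
      obtain k where k: "z (Suc n) \<in> rats (10^k)" "R (Suc n) = 1 / real (Suc n) * (10^k) powr (- s)"
        using k[of n] by blast
      obtain p q where pq: "z (Suc n) = of_int p / real q" "1 \<le> q" "q \<le> 10^k"
        using k(1) by (auto simp: rats_def)
      have "real q \<le> real (10^k)" using pq(3) by (simp only: of_nat_le_iff)
      then have q: "real q \<le> 10^k" by simp
      have "\<bar>x - of_int p / real q\<bar> \<le> 1 / real (Suc n) * (10^k) powr (- s)"
        using x_close[of "Suc n"] k(2) pq(1) by simp
      also have "\<dots> \<le> 1 / real (Suc n) * real q powr (- s)"
        using pq q s by (intro mult_left_mono powr_mono2') auto
      also have "\<dots> < K * real q powr (- s)" using n pq by (intro mult_strict_right_mono) auto
      also have "\<dots> = K / real q powr (\<sigma> + 2)" 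
      proof -
        have "- s = - (\<sigma> + 2)" by (simp add: s_def)
        then show ?thesis by (simp only: powr_minus_divide) simp
      qed
      finally show ?thesis using pq by blast
    qed
    ultimately have "x \<in> well_approximable \<sigma>" by (simp add: well_approximable_def)
    moreover have "a < x" using z_less[of 0] w(1)[of 0] by (simp add: P_def z_def)
    moreover have "x < b"
      using x_le[of 1] step[of 0] R0[of 0] w(1)[of 0] by (simp add: P_def z_def R_def)
    \<comment> \<open>An interval containing the limit meets every ball, so its length is at most
      \<open>R n / 640\<close> for all \<open>n\<close> and hence zero. This is where
      \<open>e p > 0\<close> is essential.\<close>
    moreover have "e p < \<bar>x - m p\<bar>" for p
    proof (rule ccontr)
      assume "\<not> ?thesis"
      then have "\<bar>z n - m p\<bar> \<le> R n + e p" for n using x_close[of n] by linarith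
      then have "2 * e p \<le> R n / 640" for n by (rule inv)
      moreover have "(\<lambda>n. R n / 640) \<longlonglongrightarrow> 0" using tendsto_divide[OF R_lim tendsto_const, of 640] by simp
      ultimately have "2 * e p \<le> 0" using LIMSEQ_le_const[of "\<lambda>n. R n / 640" 0 "2 * e p"] by blast
      then show False using e[rule_format, of p] by linarith
    qed
    ultimately show "\<exists>x\<in>well_approximable \<sigma>. a < x \<and> x < b \<and> (\<forall>p. e p < \<bar>x - m p\<bar>)" by blast
  qed
qed

text \<open>Lets degenerate sets of a cover be replaced by intervals of positive length. For
  \<open>t > 0\<close>, enlarging by a factor multiplies \<open>g\<close> by at most that factor, by
  \<open>quot\<close>.\<close>

lemma enlarge:
  assumes "0 \<le> t" "t < \<delta>" "0 < \<eta>"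
  shows "\<exists>t'>t. t' \<le> \<delta> \<and> g t' \<le> g t + \<eta>"
proof (cases "t = 0")
  case True
  obtain r where r: "r > 0" "\<And>t. 0 \<le> t \<Longrightarrow> t \<le> r \<Longrightarrow> g t < \<eta>" using small[OF assms(3)] by blast
  show ?thesis
    using r assms True zero by (intro exI[of _ "min \<delta> r"]) (auto intro!: less_imp_le)
next
  case False
  then have t: "t > 0" "g t > 0" using assms pos by auto
  define t' where "t' = min \<delta> (t * (1 + \<eta> / g t))"
  have "t < t * (1 + \<eta> / g t)" using t assms by simp
  then have 1: "t < t'" using assms by (simp add: t'_def)
  have "t * g t' \<le> t' * g t" using quot t 1 by simp
  also have "\<dots> \<le> t * (1 + \<eta> / g t) * g t" using t by (intro mult_right_mono) (auto simp: t'_def)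
  also have "\<dots> = t * (g t + \<eta>)" using t by (simp add: field_simps)
  finally have "g t' \<le> g t + \<eta>" using t by (simp add: mult_le_cancel_left_pos)
  moreover have "t' \<le> \<delta>" by (simp add: t'_def)
  ultimately show ?thesis using 1 by blast
qed

lemma cover_sum_ge:
  assumes div: "\<not> summable (\<lambda>q. g (real (Suc q) powr (- (2 + \<sigma>) / 2)))"
    and \<sigma>: "\<sigma> > 0" and A: "A > 0"
  shows "\<exists>\<delta>>0. \<forall>a b (U :: nat \<Rightarrow> real set). a < b \<longrightarrow> (\<forall>p. bounded (U p) \<and> diameter (U p) < \<delta>) \<longrightarrow>
     well_approximable \<sigma> \<inter> {a<..<b} \<subseteq> (\<Union>p. U p) \<longrightarrow> ennreal (A * (b - a)) \<le> (\<Sum>p. ennreal (g (diameter (U p))))"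
proof -
  obtain \<delta> where \<delta>: "\<delta> > 0" and *: "\<And>a b T (m :: nat \<Rightarrow> real) e. a < b \<Longrightarrow> T \<le> A * (b - a) \<Longrightarrow>
    (\<And>p. 0 < e p \<and> 2 * e p \<le> \<delta>) \<Longrightarrow> (\<And>F. finite F \<Longrightarrow> (\<Sum>p\<in>F. g (2 * e p)) \<le> T) \<Longrightarrow>
    (\<exists>x\<in>well_approximable \<sigma>. a < x \<and> x < b \<and> (\<forall>p. e p < \<bar>x - m p\<bar>))"
    using uncovered_point[OF assms] by blast
  show ?thesis
  proof (intro exI[of _ \<delta>] conjI allI impI \<delta>, rule ccontr)
    fix a b and U :: "nat \<Rightarrow> real set"
    assume ab: "a < b" and U: "\<forall>p. bounded (U p) \<and> diameter (U p) < \<delta>"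
      and cover: "well_approximable \<sigma> \<inter> {a<..<b} \<subseteq> (\<Union>p. U p)"
      and "\<not> ennreal (A * (b - a)) \<le> (\<Sum>p. ennreal (g (diameter (U p))))"
    then have less: "(\<Sum>p. ennreal (g (diameter (U p)))) < ennreal (A * (b - a))" by simp
    have d0: "0 \<le> diameter (U p)" for p using U by (simp add: diameter_ge_0)
    obtain T where T: "0 \<le> T" "(\<Sum>p. ennreal (g (diameter (U p)))) = ennreal T"
      using less by (cases "\<Sum>p. ennreal (g (diameter (U p)))") auto
    then have TA: "T < A * (b - a)" using less by (simp add: ennreal_less_iff)
    \<comment> \<open>The gap between the gauge sum and \<open>A * (b - a)\<close> is spent on
      enlarging the diameters, \<open>\<eta> / 2^(p+1)\<close> on the set with index
      \<open>p\<close>.\<close>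
    define \<eta> where "\<eta> = A * (b - a) - T"
    have \<eta>: "\<eta> > 0" using TA by (simp add: \<eta>_def)
    have "\<exists>t'>diameter (U p). t' \<le> \<delta> \<and> g t' \<le> g (diameter (U p)) + \<eta> * (1/2) ^ Suc p" for p
      using enlarge[of "diameter (U p)" \<delta> "\<eta> * (1/2) ^ Suc p"] d0 U \<eta> by simp
    then obtain t where t: "\<And>p. diameter (U p) < t p" "\<And>p. t p \<le> \<delta>"
       "\<And>p. g (t p) \<le> g (diameter (U p)) + \<eta> * (1/2) ^ Suc p" by metis
    define e where "e p = t p / 2" for p
    define m where "m p = Inf (U p) + e p" for p
    have "\<exists>x\<in>well_approximable \<sigma>. a < x \<and> x < b \<and> (\<forall>p. e p < \<bar>x - m p\<bar>)"
    proof (rule *[OF ab order_refl])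
      show "0 < e p \<and> 2 * e p \<le> \<delta>" for p using t(1,2)[of p] d0[of p] by (simp add: e_def)
      fix F :: "nat set" assume F: "finite F"
      have "(\<Sum>p\<in>F. g (2 * e p)) \<le> (\<Sum>p\<in>F. g (diameter (U p)) + \<eta> * (1/2) ^ Suc p)"
        unfolding e_def using t(3) by (intro sum_mono) simp
      also have "\<dots> = (\<Sum>p\<in>F. g (diameter (U p))) + \<eta> * (\<Sum>p\<in>F. (1/2) ^ Suc p)"
        by (simp add: sum.distrib sum_distrib_left)
      also have "\<dots> \<le> T + \<eta> * 1"
      proof (intro add_mono mult_left_mono)
        have "ennreal (\<Sum>p\<in>F. g (diameter (U p))) = (\<Sum>p\<in>F. ennreal (g (diameter (U p))))"
          using nonneg d0 by (intro sum_ennreal[symmetric]) auto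
        also have "\<dots> \<le> ennreal T" unfolding T(2)[symmetric] by (intro sum_le_suminf F) auto
        finally show "(\<Sum>p\<in>F. g (diameter (U p))) \<le> T" using T(1) by (simp add: ennreal_le_iff)
        have "(\<Sum>p\<in>F. (1/2::real) ^ Suc p) \<le> (\<Sum>p. (1/2) ^ Suc p)"
          using power_half_series by (intro sum_le_suminf F) (auto simp: sums_iff)
        then show "(\<Sum>p\<in>F. (1/2::real) ^ Suc p) \<le> 1" using power_half_series by (simp add: sums_iff)
      qed (use \<eta> in auto)
      finally show "(\<Sum>p\<in>F. g (2 * e p)) \<le> A * (b - a)" by (simp add: \<eta>_def)
    qed
    then obtain x where x: "x \<in> well_approximable \<sigma>" "a < x" "x < b" "\<And>p. e p < \<bar>x - m p\<bar>" by blast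
    then obtain p where p: "x \<in> U p" using cover by auto
    have Up: "bounded (U p)" using U by simp
    have lo: "Inf (U p) \<le> x" using p bounded_imp_bdd_below[OF Up] by (rule cInf_lower)
    have "x - diameter (U p) \<le> Inf (U p)"
    proof (rule cInf_greatest)
      fix y assume "y \<in> U p"
      then have "dist x y \<le> diameter (U p)" using diameter_bounded_bound[OF Up p] by simp
      then show "x - diameter (U p) \<le> y" by (simp add: dist_real_def)
    qed (use p in auto)
    with lo have "\<bar>x - m p\<bar> \<le> e p" using t(1)[of p] unfolding m_def e_def by linarith
    then show False using x(4)[of p] by linarith
  qed
qed

end

section \<open>Nested cells and net covers\<close>

lemma inverse_power_tendsto_0:
  assumes "c \<ge> 2"
  shows "(\<lambda>m. 1 / real c ^ m) \<longlonglongrightarrow> 0"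
  using LIMSEQ_power_zero[of "1 / real c"] assms by (simp add: power_one_over)

text \<open>The \<open>c\<close>-adic intervals of generation \<open>n\<close>, described by a
  floor: disjointness within a generation is then immediate, and nesting becomes integer
  division.\<close>

definition radix_cell :: "nat \<Rightarrow> nat \<Rightarrow> int \<Rightarrow> real set" where
  "radix_cell c n \<kappa> = {x. \<lfloor>x * real c ^ n\<rfloor> = \<kappa>}"

lemma radix_cell_eq:
  assumes "c \<ge> 2"
  shows "radix_cell c n \<kappa> = {of_int \<kappa> / real c ^ n..<(of_int \<kappa> + 1) / real c ^ n}"
  using assms by (auto simp: radix_cell_def floor_eq_iff field_simps)

lemma adic_interval_eq_radix_cell:
  assumes "c \<ge> 2"
  shows "adic_interval c (int n) \<kappa> = radix_cell c n \<kappa>"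
proof -
  have c: "real c ^ n > 0" using assms by simp
  have "adic_interval c (int n) \<kappa> = (\<lambda>x. (of_int \<kappa> + x) / real c ^ n) ` {0..<1}"
    by (simp add: adic_interval_def power_int_minus field_simps)
  also have "\<dots> = {of_int \<kappa> / real c ^ n..<(of_int \<kappa> + 1) / real c ^ n}"
  proof (intro equalityI subsetI)
    fix y assume y: "y \<in> {of_int \<kappa> / real c ^ n..<(of_int \<kappa> + 1) / real c ^ n}"
    then show "y \<in> (\<lambda>x. (of_int \<kappa> + x) / real c ^ n) ` {0..<1}"
      using c by (intro image_eqI[of _ _ "y * real c ^ n - of_int \<kappa>"]) (auto simp: field_simps)
  qed (use c in \<open>auto simp: field_simps\<close>)
  finally show ?thesis using radix_cell_eq[OF assms] by simp
qed

lemma diameter_atLeastLessThan: "a < b \<Longrightarrow> diameter {a..<b::real} = b - a"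
  using diameter_closure[of "{a..<b}"] by simp

lemma diameter_radix_cell:
  assumes "c \<ge> 2"
  shows "diameter (radix_cell c n \<kappa>) = 1 / real c ^ n" "bounded (radix_cell c n \<kappa>)"
proof -
  have lt: "of_int \<kappa> / real c ^ n < (of_int \<kappa> + 1) / real c ^ n"
    using assms by (intro divide_strict_right_mono) auto
  show "diameter (radix_cell c n \<kappa>) = 1 / real c ^ n"
    unfolding radix_cell_eq[OF assms] diameter_atLeastLessThan[OF lt] by (simp add: add_divide_distrib)
  show "bounded (radix_cell c n \<kappa>)" unfolding radix_cell_eq[OF assms] by simp
qed

lemma diameter_adic_interval:
  assumes "c \<ge> 2"
  shows "diameter (adic_interval c j \<kappa>) = real c powi (- j)"
proof -
  let ?s = "real c powi (- j)"
  have s: "?s > 0" using assms by simp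
  have "adic_interval c j \<kappa> = {?s * of_int \<kappa>..<?s * of_int \<kappa> + ?s}"
  proof (intro equalityI subsetI)
    fix y assume "y \<in> {?s * of_int \<kappa>..<?s * of_int \<kappa> + ?s}"
    then show "y \<in> adic_interval c j \<kappa>"
      unfolding adic_interval_def using s
      by (intro image_eqI[of _ _ "y / ?s - of_int \<kappa>"]) (auto simp: field_simps)
  qed (use s in \<open>auto simp: adic_interval_def algebra_simps\<close>)
  then show ?thesis using s by (simp add: diameter_atLeastLessThan)
qed

lemma radix_cell_parent:
  assumes c: "c \<ge> 2" and nm: "n \<le> m" and meet: "radix_cell c m \<mu> \<inter> radix_cell c n \<kappa> \<noteq> {}"
  shows "radix_cell c m \<mu> \<subseteq> radix_cell c n \<kappa>"
proof -
  have fl: "\<lfloor>x * real c ^ n\<rfloor> = \<lfloor>x * real c ^ m\<rfloor> div int (c ^ (m - n))" for x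
  proof -
    have "\<lfloor>x * real c ^ m\<rfloor> div int (c ^ (m - n)) = \<lfloor>(x * real c ^ m) / real_of_int (int (c ^ (m - n)))\<rfloor>"
      by (rule floor_divide_real_eq_div[symmetric]) simp
    also have "(x * real c ^ m) / real_of_int (int (c ^ (m - n))) = x * real c ^ n"
    proof -
      have "real c ^ m = real c ^ n * real c ^ (m - n)" using nm by (simp flip: power_add)
      then show ?thesis using c by simp
    qed
    finally show ?thesis by simp
  qed
  then show ?thesis using meet by (auto simp: radix_cell_def)
qed

lemma radix_cell_children:
  assumes c: "c \<ge> 2"
  shows "i < c \<Longrightarrow> radix_cell c (Suc n) (\<kappa> * int c + int i) \<subseteq> radix_cell c n \<kappa>"
    and "i < c \<Longrightarrow> i' < c \<Longrightarrow> i \<noteq> i' \<Longrightarrow>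
      radix_cell c (Suc n) (\<kappa> * int c + int i) \<inter> radix_cell c (Suc n) (\<kappa> * int c + int i') = {}"
proof -
  show "radix_cell c (Suc n) (\<kappa> * int c + int i) \<subseteq> radix_cell c n \<kappa>" if "i < c"
  proof
    fix x assume "x \<in> radix_cell c (Suc n) (\<kappa> * int c + int i)"
    then have "\<lfloor>x * real c ^ n * real c\<rfloor> = \<kappa> * int c + int i" by (simp add: radix_cell_def mult_ac)
    moreover have "\<lfloor>x * real c ^ n * real c / real_of_int (int c)\<rfloor> = \<lfloor>x * real c ^ n * real c\<rfloor> div int c"
      by (rule floor_divide_real_eq_div) simp
    ultimately show "x \<in> radix_cell c n \<kappa>" using c that by (simp add: radix_cell_def)
  qed
qed (auto simp: radix_cell_def)

text \<open>Used to show that no set of a cover is charged twice.\<close>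

lemma sum_le_single:
  fixes f :: "'i \<Rightarrow> ennreal"
  assumes "finite A" "\<And>p. p \<in> A \<Longrightarrow> f p \<le> w"
    and "\<And>p q. p \<in> A \<Longrightarrow> q \<in> A \<Longrightarrow> f p \<noteq> 0 \<Longrightarrow> f q \<noteq> 0 \<Longrightarrow> p = q"
  shows "sum f A \<le> w"
proof (cases "\<exists>p\<in>A. f p \<noteq> 0")
  case True
  then obtain p where p: "p \<in> A" "f p \<noteq> 0" by blast
  have "sum f A = f p"
    using assms(1,3) p by (subst sum.remove[OF _ p(1)]) (auto intro!: sum.neutral)
  then show ?thesis using assms(2) p by simp
qed auto

section \<open>Replacing covers of the well approximable points by covers of an open set\<close>

context dim_gauge
begin

definition net_mass :: "(nat \<Rightarrow> real set) \<Rightarrow> real set \<Rightarrow> ennreal" where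
  "net_mass S B = (\<Sum>p. if S p \<subseteq> B then ennreal (g (diameter (S p))) else 0)"

text \<open>With \<open>A = g d / d\<close> for the cell of length \<open>d\<close>, the claim is
  mass at least \<open>A\<close> times length. It is proved for subcells by going up from a
  generation so fine that its cells are shorter than the \<open>\<delta>\<close> of
  \<open>cover_sum_ge\<close>; in the induction \<open>d\<close> counts the generations still to be
  refined.\<close>

lemma net_mass_ge:
  fixes S :: "nat \<Rightarrow> real set"
  assumes c: "c \<ge> 2" and div: "\<not> summable (\<lambda>q. g (real (Suc q) powr (- (2 + \<sigma>) / 2)))"
    and \<sigma>: "\<sigma> > 0"
    and S: "\<And>p. S p = {} \<or> (\<exists>n \<kappa>. S p = radix_cell c n \<kappa>)"
    and cover: "well_approximable \<sigma> \<inter> radix_cell c n \<kappa> \<subseteq> (\<Union>p. S p)"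
    and no: "\<And>p. \<not> radix_cell c n \<kappa> \<subseteq> S p"
  shows "ennreal (g (diameter (radix_cell c n \<kappa>))) \<le> net_mass S (radix_cell c n \<kappa>)"
proof -
  have cn: "real c ^ n > 0" for n using c by simp
  define A where "A = g (1 / real c ^ n) * real c ^ n"
  have A: "A > 0" using pos cn by (simp add: A_def)
  obtain \<delta> where \<delta>: "\<delta> > 0" and *: "\<And>a b (U :: nat \<Rightarrow> real set). a < b \<Longrightarrow>
      (\<And>p. bounded (U p) \<and> diameter (U p) < \<delta>) \<Longrightarrow> well_approximable \<sigma> \<inter> {a<..<b} \<subseteq> (\<Union>p. U p) \<Longrightarrow>
      ennreal (A * (b - a)) \<le> (\<Sum>p. ennreal (g (diameter (U p))))"
    using cover_sum_ge[OF div \<sigma> A] by blast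
  have "\<forall>\<^sub>F m in sequentially. 1 / real c ^ m < \<delta>"
  by (rule order_tendstoD(2)[OF inverse_power_tendsto_0[OF c] \<delta>])
  then obtain m0 where "\<And>m. m \<ge> m0 \<Longrightarrow> 1 / real c ^ m < \<delta>" by (auto simp: eventually_sequentially)
  then have d: "1 / real c ^ (n + m0) < \<delta>" by simp
  have ind: "ennreal (A / real c ^ i) \<le> net_mass S (radix_cell c i \<kappa>)"
    if "i + d = n + m0" "n \<le> i" "well_approximable \<sigma> \<inter> radix_cell c i \<kappa> \<subseteq> (\<Union>p. S p)"
       "\<forall>p. \<not> radix_cell c i \<kappa> \<subseteq> S p" for d i \<kappa>
    using that
  proof (induction d arbitrary: i \<kappa>)
    \<comment> \<open>By nesting, a set of the cover that meets the cell either contains it, which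
      is excluded, or lies inside it. So the sets inside the cell alone cover its well approximable
      points.\<close>
    case 0
    define U where "U p = (if S p \<subseteq> radix_cell c i \<kappa> then S p else {})" for p
    have "ennreal (A * ((of_int \<kappa> + 1) / real c ^ i - of_int \<kappa> / real c ^ i)) \<le> (\<Sum>p. ennreal (g (diameter (U p))))"
    proof (rule *)
      show "of_int \<kappa> / real c ^ i < (of_int \<kappa> + 1) / real c ^ i"
        using cn by (intro divide_strict_right_mono) auto
      show "bounded (U p) \<and> diameter (U p) < \<delta>" for p
      proof (cases "S p \<subseteq> radix_cell c i \<kappa>")
        case True
        then have "diameter (S p) \<le> 1 / real c ^ i" "bounded (S p)"
          using diameter_subset[OF True] diameter_radix_cell[OF c, of i \<kappa>] bounded_subset by auto
        then show ?thesis using True d 0 by (simp add: U_def)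
      qed (use \<delta> in \<open>simp add: U_def\<close>)
      show "well_approximable \<sigma> \<inter> {of_int \<kappa> / real c ^ i<..<(of_int \<kappa> + 1) / real c ^ i} \<subseteq> (\<Union>p. U p)"
      proof
        fix x assume "x \<in> well_approximable \<sigma> \<inter> {of_int \<kappa> / real c ^ i<..<(of_int \<kappa> + 1) / real c ^ i}"
        then have x: "x \<in> well_approximable \<sigma>" "x \<in> radix_cell c i \<kappa>"
          unfolding radix_cell_eq[OF c] by auto
        then obtain p where p: "x \<in> S p" using 0 by blast
        then obtain n' \<kappa>' where S': "S p = radix_cell c n' \<kappa>'" using S by blast
        have "S p \<subseteq> radix_cell c i \<kappa>"
        proof (cases "i \<le> n'")
          case True
          then show ?thesis unfolding S' using p x S' by (intro radix_cell_parent[OF c]) auto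
        next
          case False
          then have "radix_cell c i \<kappa> \<subseteq> S p"
            unfolding S' using p x S' by (intro radix_cell_parent[OF c]) auto
          then show ?thesis using 0 by blast
        qed
        then show "x \<in> (\<Union>p. U p)" using p by (auto simp: U_def)
      qed
    qed
    also have "(\<Sum>p. ennreal (g (diameter (U p)))) = net_mass S (radix_cell c i \<kappa>)"
      unfolding net_mass_def by (intro suminf_cong) (auto simp: U_def zero)
    finally show ?case by (simp add: add_divide_distrib)
  next
    case (Suc d)
    define D where "D j = radix_cell c (Suc i) (\<kappa> * int c + int j)" for j
    have Dsub: "D j \<subseteq> radix_cell c i \<kappa>" if "j < c" for j
      unfolding D_def by (rule radix_cell_children(1)[OF c that])
    have child: "ennreal (A / real c ^ Suc i) \<le> net_mass S (D j)" if j: "j < c" for j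
    proof (cases "\<exists>p. D j \<subseteq> S p")
      case False
      then show ?thesis
        using Suc.prems Dsub[OF j] unfolding D_def by (intro Suc.IH) auto
    next
      case True
      then obtain p where p: "D j \<subseteq> S p" by blast
      have "D j \<noteq> {}" unfolding D_def radix_cell_eq[OF c] using cn[of "Suc i"] by (simp add: divide_strict_right_mono)
      then obtain x where x: "x \<in> D j" by blast
      then obtain n' \<kappa>' where S': "S p = radix_cell c n' \<kappa>'" using S[of p] p by blast
      have "\<not> n' \<le> i"
      proof
        assume "n' \<le> i"
        then have "radix_cell c i \<kappa> \<subseteq> S p"
          unfolding S' using p x S' Dsub[OF j] by (intro radix_cell_parent[OF c]) auto
        then show False using Suc.prems by blast
      qed
      then have "S p \<subseteq> D j"
        unfolding S' D_def using p x S' unfolding D_def by (intro radix_cell_parent[OF c]) auto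
      with p have eq: "S p = D j" by blast
      \<comment> \<open>The child is itself a set of the cover. Its own weight suffices, because
        \<open>g t / t\<close> is at least \<open>A\<close> for all \<open>t\<close> up to the
        length of the original cell.\<close>
      have "A / real c ^ Suc i \<le> g (1 / real c ^ Suc i)"
      proof -
        have "1 / real c ^ Suc i * g (1 / real c ^ n) \<le> 1 / real c ^ n * g (1 / real c ^ Suc i)"
          using c \<open>n \<le> i\<close> by (intro quot divide_left_mono power_increasing) auto
        then show ?thesis using cn[of n] by (simp add: A_def field_simps)
      qed
      then have "ennreal (A / real c ^ Suc i) \<le> ennreal (g (diameter (S p)))"
        unfolding eq D_def diameter_radix_cell[OF c] by (rule ennreal_leI)
      also have "\<dots> \<le> net_mass S (D j)"
        unfolding net_mass_def
        using sum_le_suminf[of "\<lambda>p. if S p \<subseteq> D j then ennreal (g (diameter (S p))) else 0" "{p}"] eq by simp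
      finally show ?thesis .
    qed
    have "ennreal (A / real c ^ i) = (\<Sum>j<c. ennreal (A / real c ^ Suc i))"
      using c A by (subst sum_ennreal) (auto simp: less_imp_le)
    also have "\<dots> \<le> (\<Sum>j<c. net_mass S (D j))" using child by (intro sum_mono) auto
    also have "\<dots> = (\<Sum>p. \<Sum>j<c. if S p \<subseteq> D j then ennreal (g (diameter (S p))) else 0)"
      unfolding net_mass_def by (rule suminf_sum[symmetric]) simp
    also have "\<dots> \<le> net_mass S (radix_cell c i \<kappa>)"
      unfolding net_mass_def
    proof (intro suminf_le)
      fix p
      show "(\<Sum>j<c. if S p \<subseteq> D j then ennreal (g (diameter (S p))) else 0)
         \<le> (if S p \<subseteq> radix_cell c i \<kappa> then ennreal (g (diameter (S p))) else 0)"
      proof (rule sum_le_single)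
        fix j j' assume jj: "j \<in> {..<c}" "j' \<in> {..<c}"
          "(if S p \<subseteq> D j then ennreal (g (diameter (S p))) else 0) \<noteq> 0"
          "(if S p \<subseteq> D j' then ennreal (g (diameter (S p))) else 0) \<noteq> 0"
        then have "S p \<subseteq> D j \<inter> D j'" "S p \<noteq> {}" using zero by (auto split: if_splits)
        then show "j = j'" using radix_cell_children(2)[OF c, of j j'] jj unfolding D_def by fastforce
      qed (use Dsub in fastforce)+
    qed auto
    finally show ?case .
  qed
  have "ennreal (A / real c ^ n) \<le> net_mass S (radix_cell c n \<kappa>)"
    using ind[of n m0 \<kappa>] cover no by simp
  then show ?thesis using c cn[of n] by (simp add: A_def diameter_radix_cell[OF c])
qed

text \<open>Around each point of \<open>U\<close> missed by the cover take the maximal cell of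
  generation at least \<open>J\<close> inside \<open>U\<close>. Such cells are equal or disjoint,
  and by \<open>net_mass_ge\<close> the sets of the cover inside one cost at least as much as the
  cell itself. Replacing them by the cell covers \<open>U\<close> at no greater cost.\<close>

lemma net_cover_extend:
  fixes S :: "nat \<Rightarrow> real set"
  assumes c: "c \<ge> 2" and div: "\<not> summable (\<lambda>q. g (real (Suc q) powr (- (2 + \<sigma>) / 2)))"
    and \<sigma>: "\<sigma> > 0" and U: "open U"
    and S: "\<And>p. S p = {} \<or> (\<exists>n\<ge>J. \<exists>\<kappa>. S p = radix_cell c n \<kappa>)"
    and cover: "well_approximable \<sigma> \<inter> U \<subseteq> (\<Union>p. S p)"
  shows "\<exists>S' :: nat \<Rightarrow> real set. (\<forall>p. S' p = {} \<or> (\<exists>n\<ge>J. \<exists>\<kappa>. S' p = radix_cell c n \<kappa>)) \<and> U \<subseteq> (\<Union>p. S' p) \<and>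
     (\<Sum>p. ennreal (g (diameter (S' p)))) \<le> (\<Sum>p. ennreal (g (diameter (S p))))"
proof -
  define cell where "cell n x = radix_cell c n \<lfloor>x * real c ^ n\<rfloor>" for n x
  have mem_cell: "x \<in> cell n x" for n x by (simp add: cell_def radix_cell_def)
  have small_cell: "\<exists>n\<ge>J. cell n x \<subseteq> U" if xU: "x \<in> U" for x
  proof -
    obtain r where r: "r > 0" "ball x r \<subseteq> U" using U xU by (meson open_contains_ball)
    have "\<forall>\<^sub>F m in sequentially. 1 / real c ^ m < r"
    by (rule order_tendstoD(2)[OF inverse_power_tendsto_0[OF c] r(1)])
    then have "\<forall>\<^sub>F m in sequentially. J \<le> m \<and> 1 / real c ^ m < r"
      using eventually_ge_at_top[of J] by eventually_elim simp
    from eventually_happens'[OF sequentially_bot this]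
    obtain n where n: "n \<ge> J" "1 / real c ^ n < r" by blast
    have "cell n x \<subseteq> ball x r"
    proof
      fix y assume "y \<in> cell n x"
      then have "dist x y \<le> diameter (cell n x)"
        using mem_cell diameter_radix_cell(2)[OF c] unfolding cell_def
        by (intro diameter_bounded_bound) auto
      then show "y \<in> ball x r" using n by (simp add: cell_def diameter_radix_cell[OF c])
    qed
    with n r show ?thesis by blast
  qed
  define gen where "gen x = (LEAST n. n \<ge> J \<and> cell n x \<subseteq> U)" for x
  have gen: "gen x \<ge> J" "cell (gen x) x \<subseteq> U" if "x \<in> U" for x
    using LeastI_ex[of "\<lambda>n. n \<ge> J \<and> cell n x \<subseteq> U"] small_cell[OF that] by (auto simp: gen_def)
  have gen_le: "gen x \<le> n" if "n \<ge> J" "cell n x \<subseteq> U" for n x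
    unfolding gen_def using that by (intro Least_le) auto
  have cell_eq: "cell n x = cell n y" if "y \<in> cell n x" for n x y
    using that by (simp add: cell_def radix_cell_def)
  define Bad where "Bad = (\<lambda>x. cell (gen x) x) ` (U - (\<Union>p. S p))"
  have Bad_disj: "D = D'" if DD: "D \<in> Bad" "D' \<in> Bad" "D \<inter> D' \<noteq> {}" for D D'
  proof -
    obtain x y where x: "x \<in> U" "D = cell (gen x) x" and y: "y \<in> U" "D' = cell (gen y) y"
      using DD by (auto simp: Bad_def)
    obtain t where t: "t \<in> D" "t \<in> D'" using DD by blast
    have D: "D = cell (gen x) t" "D' = cell (gen y) t" using cell_eq t x y by auto
    have "gen y \<le> gen x" if "gen x \<le> gen y"
    proof (rule gen_le)
      have "D' \<subseteq> D" unfolding D using that mem_cell[of t] unfolding cell_def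
        by (intro radix_cell_parent[OF c]) auto
      then have "cell (gen x) y = D" using mem_cell[of y "gen y"] cell_eq x y by blast
      then show "cell (gen x) y \<subseteq> U" using gen x by simp
    qed (use gen x in auto)
    moreover have "gen x \<le> gen y" if "gen y \<le> gen x"
    proof (rule gen_le)
      have "D \<subseteq> D'" unfolding D using that mem_cell[of t] unfolding cell_def
        by (intro radix_cell_parent[OF c]) auto
      then have "cell (gen y) x = D'" using mem_cell[of x "gen x"] cell_eq x y by blast
      then show "cell (gen y) x \<subseteq> U" using gen y by simp
    qed (use gen y in auto)
    ultimately have "gen x = gen y" by linarith
    then show "D = D'" using D by simp
  qed
  have Bad_mass: "ennreal (g (diameter D)) \<le> net_mass S D" if D: "D \<in> Bad" for D
  proof -
    obtain x where x: "x \<in> U" "x \<notin> (\<Union>p. S p)" "D = cell (gen x) x" using D by (auto simp: Bad_def)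
    show ?thesis
      unfolding x(3) cell_def
    proof (rule net_mass_ge[OF c div \<sigma>])
      show "S p = {} \<or> (\<exists>n \<kappa>. S p = radix_cell c n \<kappa>)" for p using S[of p] by blast
      show "well_approximable \<sigma> \<inter> radix_cell c (gen x) \<lfloor>x * real c ^ gen x\<rfloor> \<subseteq> (\<Union>p. S p)"
        using gen(2)[OF x(1)] cover unfolding cell_def by blast
      show "\<not> radix_cell c (gen x) \<lfloor>x * real c ^ gen x\<rfloor> \<subseteq> S p" for p
        using mem_cell[of x "gen x"] x(2) unfolding cell_def by blast
    qed
  qed
  have Bad_cell: "\<exists>n\<ge>J. \<exists>\<kappa>. D = radix_cell c n \<kappa>" if "D \<in> Bad" for D
    using that gen by (auto simp: Bad_def cell_def)
  define P where "P D = {p. S p \<noteq> {} \<and> S p \<subseteq> D}" for D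
  have P_ne: "P D \<noteq> {}" if D: "D \<in> Bad" for D
  proof
    assume "P D = {}"
    then have "(if S p \<subseteq> D then ennreal (g (diameter (S p))) else 0) = 0" for p
      by (cases "S p = {}") (auto simp: P_def zero)
    then have "net_mass S D = 0" by (simp only: net_mass_def suminf_zero)
    with Bad_mass[OF D] have "g (diameter D) \<le> 0" by (simp add: ennreal_eq_0_iff)
    moreover obtain n \<kappa> where "D = radix_cell c n \<kappa>" using Bad_cell[OF D] by blast
    ultimately show False using pos[of "1 / real c ^ n"] c by (simp add: diameter_radix_cell not_le)
  qed
  have P_uniq: "D = D'" if "D \<in> Bad" "D' \<in> Bad" "p \<in> P D" "p \<in> P D'" for D D' p
    using that Bad_disj[of D D'] by (auto simp: P_def)
  \<comment> \<open>The new cell takes over the least index of the sets it replaces and the other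
    indices receive the empty set, so the sequence need not be renumbered. Such an index exists
    because the replaced sets have positive mass.\<close>
  define lead where "lead D = (LEAST p. p \<in> P D)" for D
  have lead: "lead D \<in> P D" if "D \<in> Bad" for D
    unfolding lead_def using P_ne[OF that] by (meson LeastI ex_in_conv)
  define S' where "S' p = (if \<exists>D\<in>Bad. p = lead D then (THE D. D \<in> Bad \<and> p = lead D)
     else if \<exists>D\<in>Bad. p \<in> P D then {} else S p)" for p
  have lead_inj: "D = D'" if "D \<in> Bad" "D' \<in> Bad" "lead D = lead D'" for D D'
    using that P_uniq lead by metis
  have S'_lead: "S' (lead D) = D" if D: "D \<in> Bad" for D
  proof -
    have "(THE D'. D' \<in> Bad \<and> lead D = lead D') = D" using D lead_inj by (intro the_equality) auto
    then show ?thesis using D by (auto simp: S'_def)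
  qed
  have S'_other: "S' p = (if \<exists>D\<in>Bad. p \<in> P D then {} else S p)" if "\<not> (\<exists>D\<in>Bad. p = lead D)" for p
    using that by (simp add: S'_def)
  have "S' p = {} \<or> (\<exists>n\<ge>J. \<exists>\<kappa>. S' p = radix_cell c n \<kappa>)" for p
  proof (cases "\<exists>D\<in>Bad. p = lead D")
    case True
    then show ?thesis using S'_lead Bad_cell by auto
  next
    case False
    then show ?thesis using S'_other[OF False] S[of p] by simp
  qed
  moreover have "U \<subseteq> (\<Union>p. S' p)"
  proof
    fix x assume x: "x \<in> U"
    show "x \<in> (\<Union>p. S' p)"
    proof (cases "\<exists>D\<in>Bad. x \<in> D")
      case True
      then obtain D where "D \<in> Bad" "x \<in> D" by blast
      then show ?thesis using S'_lead[of D] by blast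
    next
      case False
      then have "x \<in> (\<Union>p. S p)" using x mem_cell[of x "gen x"] unfolding Bad_def by blast
      then obtain p where p: "x \<in> S p" by blast
      have "\<not> (\<exists>D\<in>Bad. p \<in> P D)" using p False by (auto simp: P_def)
      then have "S' p = S p" using S'_other[of p] lead by auto
      then show ?thesis using p by blast
    qed
  qed
  moreover have "(\<Sum>p. ennreal (g (diameter (S' p)))) \<le> (\<Sum>p. ennreal (g (diameter (S p))))"
  proof (rule suminf_le_const)
    fix N
    define w where "w q = ennreal (g (diameter (S q)))" for q
    \<comment> \<open>\<open>\<phi> p q\<close> is the part of the weight of the old set
      \<open>q\<close> charged to the new set \<open>p\<close>. For fixed \<open>q\<close> at most
      one \<open>p\<close> is charged, since the \<open>Bad\<close> cells are disjoint;
      interchanging the sums compares the two covers.\<close>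
    define \<phi> where "\<phi> p q = (if \<exists>D\<in>Bad. p = lead D then (if S q \<subseteq> S' p then w q else 0)
      else if (\<exists>D\<in>Bad. p \<in> P D) then 0 else if q = p then w q else 0)" for p q
    have 1: "ennreal (g (diameter (S' p))) \<le> (\<Sum>q. \<phi> p q)" for p
    proof (cases "\<exists>D\<in>Bad. p = lead D")
      case True
      then obtain D where D: "D \<in> Bad" "p = lead D" by blast
      have "(\<Sum>q. \<phi> p q) = net_mass S D"
        unfolding net_mass_def using True S'_lead[OF D(1)] D(2) by (intro suminf_cong) (auto simp: \<phi>_def w_def)
      then show ?thesis using Bad_mass[OF D(1)] S'_lead[OF D(1)] D(2) by simp
    next
      case False
      show ?thesis
      proof (cases "\<exists>D\<in>Bad. p \<in> P D")
        case True
        then show ?thesis using S'_other[OF False] zero by simp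
      next
        case noP: False
        have "ennreal (g (diameter (S' p))) = \<phi> p p"
          using S'_other[OF False] False noP by (auto simp: \<phi>_def w_def)
        also have "\<phi> p p = sum (\<phi> p) {p}" by simp
        also have "\<dots> \<le> (\<Sum>q. \<phi> p q)" by (rule sum_le_suminf) auto
        finally show ?thesis .
      qed
    qed
    have "(\<Sum>p<N. ennreal (g (diameter (S' p)))) \<le> (\<Sum>p<N. \<Sum>q. \<phi> p q)"
      by (intro sum_mono 1)
    also have "\<dots> = (\<Sum>q. \<Sum>p<N. \<phi> p q)" by (rule suminf_sum[symmetric]) simp
    also have "\<dots> \<le> (\<Sum>q. w q)"
    proof (intro suminf_le)
      fix q
      show "(\<Sum>p<N. \<phi> p q) \<le> w q"
      proof (rule sum_le_single)
        fix p p' assume pp: "\<phi> p q \<noteq> 0" "\<phi> p' q \<noteq> 0"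
        then have "w q \<noteq> 0" by (auto simp: \<phi>_def split: if_splits)
        then have ne: "S q \<noteq> {}" using zero by (auto simp: w_def)
        have cases: "(\<exists>D\<in>Bad. r = lead D \<and> q \<in> P D) \<or> (r = q \<and> \<not> (\<exists>D\<in>Bad. q \<in> P D))"
          if "\<phi> r q \<noteq> 0" for r
        proof (cases "\<exists>D\<in>Bad. r = lead D")
          case True
          then obtain D where D: "D \<in> Bad" "r = lead D" by blast
          then have "q \<in> P D" using that ne S'_lead[OF D(1)] True by (auto simp: \<phi>_def P_def split: if_splits)
          then show ?thesis using D by blast
        next
          case False
          then show ?thesis using that by (auto simp: \<phi>_def split: if_splits)
        qed
        show "p = p'" using cases[OF pp(1)] cases[OF pp(2)] P_uniq by metis
      qed (auto simp: \<phi>_def)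
    qed auto
    finally show "(\<Sum>p<N. ennreal (g (diameter (S' p)))) \<le> (\<Sum>p. ennreal (g (diameter (S p))))"
      by (simp add: w_def)
  qed simp
  ultimately show ?thesis by blast
qed

end

section \<open>Normalising a gauge\<close>

text \<open>Keeps the germ at zero and continues by a constant. A constant continuation preserves
  both the monotonicity of \<open>h\<close> and that of \<open>h r / r\<close>, which makes the
  result a \<open>dim_gauge\<close>.\<close>

definition cut_gauge :: "real \<Rightarrow> (real \<Rightarrow> real) \<Rightarrow> real \<Rightarrow> real" where
  "cut_gauge \<epsilon> h r = h (min r \<epsilon>)"

lemma cut_gauge_eq: "r \<le> \<epsilon> \<Longrightarrow> cut_gauge \<epsilon> h r = h r"
  by (simp add: cut_gauge_def min_def)

lemma dim_gauge_cut_gauge: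
  assumes h: "h \<in> gauge_D1" and \<epsilon>: "\<epsilon> > 0" and mon: "mono_on {0..\<epsilon>} h"
    and anti: "antimono_on {0<..\<epsilon>} (\<lambda>r. h r / r)"
  shows "dim_gauge (cut_gauge \<epsilon> h)"
proof -
  obtain \<epsilon>' where h0: "h 0 = 0" and \<epsilon>': "\<epsilon>' > 0" "continuous_on {0..\<epsilon>'} h"
    and ratio: "\<forall>r\<in>{0<..\<epsilon>'}. h r / r > 0"
    using h by (auto simp: gauge_D1_def)
  have h_mono: "h r \<le> h t" if "0 \<le> r" "r \<le> t" "t \<le> \<epsilon>" for r t
    using mono_onD[OF mon] that by simp
  have h_pos: "0 < h r" if "0 < r" "r \<le> \<epsilon>" for r
  proof -
    have "0 < h (min r \<epsilon>') / min r \<epsilon>'" using ratio[rule_format, of "min r \<epsilon>'"] that \<epsilon>' by auto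
    then have "0 < h (min r \<epsilon>')" using that \<epsilon>' by (auto simp: zero_less_divide_iff)
    also have "\<dots> \<le> h r" using that \<epsilon>' by (intro h_mono) auto
    finally show ?thesis .
  qed
  have h_quot: "r * h t \<le> t * h r" if "0 < r" "r \<le> t" "t \<le> \<epsilon>" for r t
    using monotone_onD[OF anti, of r t] that by (simp add: field_simps)
  show ?thesis
  proof
    show "cut_gauge \<epsilon> h 0 = 0" using \<epsilon> h0 by (simp add: cut_gauge_def)
    show "0 < cut_gauge \<epsilon> h r" if "0 < r" for r using that \<epsilon> h_pos by (simp add: cut_gauge_def)
    show "cut_gauge \<epsilon> h r \<le> cut_gauge \<epsilon> h t" if "0 \<le> r" "r \<le> t" for r t
      unfolding cut_gauge_def using that \<epsilon> by (intro h_mono) auto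
    show "r * cut_gauge \<epsilon> h t \<le> t * cut_gauge \<epsilon> h r" if r: "0 < r" "r \<le> t" for r t
    proof (cases "r \<le> \<epsilon>")
      case True
      have "r * h (min t \<epsilon>) \<le> min t \<epsilon> * h r" using r True by (intro h_quot) auto
      also have "\<dots> \<le> t * h r" using h_pos[OF r(1) True] by (intro mult_right_mono) auto
      finally show ?thesis using True by (simp add: cut_gauge_def)
    next
      case False
      then show ?thesis using r h_pos[OF \<epsilon>] by (simp add: cut_gauge_def min_def mult_right_mono)
    qed
    have "(h \<longlongrightarrow> 0) (at_right 0)" using continuous_on_Icc_at_rightD[OF \<epsilon>'(2,1)] h0 by simp
    moreover have "\<forall>\<^sub>F r in at_right 0. r < \<epsilon>" using \<epsilon> eventually_at_right_field by blast
    then have "\<forall>\<^sub>F r in at_right 0. h r = cut_gauge \<epsilon> h r" by eventually_elim (simp add: cut_gauge_def)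
    ultimately show "(cut_gauge \<epsilon> h \<longlongrightarrow> 0) (at_right 0)" by (rule Lim_transform_eventually)
  qed
qed

lemma gauge_D1_cut:
  assumes "h \<in> gauge_D1"
  obtains \<epsilon> where "\<epsilon> > 0" "dim_gauge (cut_gauge \<epsilon> h)"
proof -
  obtain \<epsilon> where "\<epsilon> > 0" "mono_on {0..\<epsilon>} h" "antimono_on {0<..\<epsilon>} (\<lambda>r. h r / r)"
    using assms by (auto simp: gauge_D1_def)
  then show thesis using that dim_gauge_cut_gauge[OF assms] by blast
qed

lemma gauge_D1_radix_cut:
  assumes h: "h \<in> gauge_D1" and c: "c \<ge> 2"
  obtains J where "dim_gauge (cut_gauge (1 / real c ^ J) h)"
    "\<And>j \<kappa>. diameter (adic_interval c j \<kappa>) < gauge_eps h \<longleftrightarrow> (\<exists>n\<ge>J. j = int n)"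
proof -
  define E where "E = {\<epsilon>. 0 < \<epsilon> \<and> \<epsilon> \<le> 1 \<and> mono_on {0..\<epsilon>} h \<and> antimono_on {0<..\<epsilon>} (\<lambda>r. h r / r)}"
  have eps: "gauge_eps h = Sup E" by (simp add: gauge_eps_def E_def)
  obtain \<epsilon>0 where \<epsilon>0: "\<epsilon>0 > 0" "mono_on {0..\<epsilon>0} h" "antimono_on {0<..\<epsilon>0} (\<lambda>r. h r / r)"
    using h by (auto simp: gauge_D1_def)
  have "mono_on {0..min \<epsilon>0 1} h" by (rule mono_on_subset[OF \<epsilon>0(2)]) auto
  moreover have "antimono_on {0<..min \<epsilon>0 1} (\<lambda>r. h r / r)" by (rule monotone_on_subset[OF \<epsilon>0(3)]) auto
  ultimately have E: "min \<epsilon>0 1 \<in> E" using \<epsilon>0(1) by (simp add: E_def)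
  have bdd: "bdd_above E" by (rule bdd_aboveI[of _ 1]) (simp add: E_def)
  have pos: "gauge_eps h > 0" unfolding eps using cSup_upper[OF E bdd] \<epsilon>0(1) by (simp add: min_def split: if_splits)
  have le1: "gauge_eps h \<le> 1" unfolding eps using E by (intro cSup_least) (auto simp: E_def)
  have "\<forall>\<^sub>F m in sequentially. 1 / real c ^ m < gauge_eps h"
  by (rule order_tendstoD(2)[OF inverse_power_tendsto_0[OF c] pos])
  then have ex: "\<exists>n. 1 / real c ^ n < gauge_eps h" by (auto simp: eventually_sequentially)
  define J where "J = (LEAST n. 1 / real c ^ n < gauge_eps h)"
  have J: "1 / real c ^ J < gauge_eps h" unfolding J_def by (rule LeastI_ex[OF ex])
  have iff: "1 / real c ^ n < gauge_eps h \<longleftrightarrow> n \<ge> J" for n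
  proof
    show "J \<le> n" if "1 / real c ^ n < gauge_eps h" unfolding J_def using that by (rule Least_le)
    assume "J \<le> n"
    then have "1 / real c ^ n \<le> 1 / real c ^ J" using c by (intro divide_left_mono power_increasing) auto
    with J show "1 / real c ^ n < gauge_eps h" by linarith
  qed
  obtain \<epsilon> where \<epsilon>: "\<epsilon> \<in> E" "1 / real c ^ J < \<epsilon>"
    using J less_cSup_iff[of E "1 / real c ^ J"] E bdd unfolding eps by blast
  show thesis
  proof (rule that)
    show "dim_gauge (cut_gauge (1 / real c ^ J) h)"
    proof (rule dim_gauge_cut_gauge[OF h])
      show "0 < 1 / real c ^ J" using c by simp
      show "mono_on {0..1 / real c ^ J} h" 
      proof (rule mono_on_subset)
        show "mono_on {0..\<epsilon>} h" using \<epsilon>(1) unfolding E_def by blast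
        show "{0..1 / real c ^ J} \<subseteq> {0..\<epsilon>}" using \<epsilon>(2) by auto
      qed
      show "antimono_on {0<..1 / real c ^ J} (\<lambda>r. h r / r)"
      proof (rule monotone_on_subset)
        show "antimono_on {0<..\<epsilon>} (\<lambda>r. h r / r)" using \<epsilon>(1) unfolding E_def by blast
        show "{0<..1 / real c ^ J} \<subseteq> {0<..\<epsilon>}" using \<epsilon>(2) by auto
      qed
    qed
    show "diameter (adic_interval c j \<kappa>) < gauge_eps h \<longleftrightarrow> (\<exists>n\<ge>J. j = int n)" for j \<kappa>
    proof (cases "j \<ge> 0")
      case True
      then obtain n where j: "j = int n" using nonneg_int_cases by blast
      have "diameter (adic_interval c j \<kappa>) = 1 / real c ^ n"
        unfolding diameter_adic_interval[OF c] j by (simp add: power_int_minus divide_inverse)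
      then show ?thesis using iff j by simp
    next
      case False
      then have "1 \<le> real c powi (- j)" using c by (intro one_le_power_int) auto
      then show ?thesis unfolding diameter_adic_interval[OF c] using le1 False by auto
    qed
  qed
qed

definition radix_covers :: "nat \<Rightarrow> nat \<Rightarrow> real set \<Rightarrow> (nat \<Rightarrow> real set) set" where
  "radix_covers c J F = {S. F \<subseteq> (\<Union>p. S p) \<and> (\<forall>p. S p = {} \<or> (\<exists>n\<ge>J. \<exists>\<kappa>. S p = radix_cell c n \<kappa>))}"

lemma net_content_eq:
  assumes c: "c \<ge> 2" and h0: "h 0 = 0"
    and J: "\<And>j \<kappa>. diameter (adic_interval c j \<kappa>) < gauge_eps h \<longleftrightarrow> (\<exists>n\<ge>J. j = int n)"
  shows "net_content c h F = (INF S\<in>radix_covers c J F. \<Sum>p. ennreal (cut_gauge (1 / real c ^ J) h (diameter (S p))))"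
proof -
  have iff: "(\<exists>j \<kappa>. B = adic_interval c j \<kappa>) \<and> diameter B < gauge_eps h \<longleftrightarrow> (\<exists>n\<ge>J. \<exists>\<kappa>. B = radix_cell c n \<kappa>)" for B
  proof
    assume "(\<exists>j \<kappa>. B = adic_interval c j \<kappa>) \<and> diameter B < gauge_eps h"
    then obtain j \<kappa> where B: "B = adic_interval c j \<kappa>" "diameter (adic_interval c j \<kappa>) < gauge_eps h" by blast
    then obtain n where "n \<ge> J" "j = int n" using J by blast
    then show "\<exists>n\<ge>J. \<exists>\<kappa>. B = radix_cell c n \<kappa>" using B adic_interval_eq_radix_cell[OF c] by blast
  next
    assume "\<exists>n\<ge>J. \<exists>\<kappa>. B = radix_cell c n \<kappa>"
    then obtain n \<kappa> where n: "n \<ge> J" "B = adic_interval c (int n) \<kappa>"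
      using adic_interval_eq_radix_cell[OF c] by blast
    then show "(\<exists>j \<kappa>. B = adic_interval c j \<kappa>) \<and> diameter B < gauge_eps h" using J by blast
  qed
  show ?thesis
    unfolding net_content_def radix_covers_def iff
  proof (intro INF_cong refl suminf_cong)
    fix S :: "nat \<Rightarrow> real set" and p
    assume "S \<in> {S. F \<subseteq> (\<Union>p. S p) \<and> (\<forall>p. S p = {} \<or> (\<exists>n\<ge>J. \<exists>\<kappa>. S p = radix_cell c n \<kappa>))}"
    then consider "S p = {}" | n \<kappa> where "n \<ge> J" "S p = radix_cell c n \<kappa>" by blast
    then show "ennreal (h (diameter (S p))) = ennreal (cut_gauge (1 / real c ^ J) h (diameter (S p)))"
    proof cases
      case 1
      then show ?thesis by (simp add: cut_gauge_def min_def h0)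
    next
      case 2
      have "1 / real c ^ n \<le> 1 / real c ^ J" using c 2 by (intro divide_left_mono power_increasing) auto
      then show ?thesis unfolding 2 diameter_radix_cell[OF c] by (simp add: cut_gauge_eq)
    qed
  qed
qed

lemma suminf_ennreal_eq_top_iff:
  fixes k :: "nat \<Rightarrow> real"
  assumes k: "\<And>q. 0 \<le> k q"
  shows "(\<Sum>q. ennreal (k q)) = \<infinity> \<longleftrightarrow> \<not> summable k"
proof
  assume top: "(\<Sum>q. ennreal (k q)) = \<infinity>"
  show "\<not> summable k"
  proof
    assume "summable k"
    from ennreal_suminf_neq_top[OF this k] top show False by (simp only: infinity_ennreal_def)
  qed
next
  assume "\<not> summable k"
  then show "(\<Sum>q. ennreal (k q)) = \<infinity>"
    using summable_suminf_not_top[of k, OF k] unfolding infinity_ennreal_def by (rule contrapos_np)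
qed

text \<open>\<open>ennreal\<close> turns negative values of \<open>h\<close> into zero, and the
  terms outside the range of the cut are finitely many; neither affects divergence.\<close>

lemma suminf_eq_top_iff_cut:
  assumes g: "dim_gauge (cut_gauge \<epsilon> h)" and \<epsilon>: "\<epsilon> > 0" and \<sigma>: "\<sigma> > 0"
  shows "(\<Sum>q. ennreal (h (real (Suc q) powr (- (2 + \<sigma>) / 2)))) = \<infinity> \<longleftrightarrow>
     \<not> summable (\<lambda>q. cut_gauge \<epsilon> h (real (Suc q) powr (- (2 + \<sigma>) / 2)))"
proof -
  interpret dim_gauge "cut_gauge \<epsilon> h" by (rule g)
  define t where "t q = real (Suc q) powr (- (2 + \<sigma>) / 2)" for q
  have "t \<longlonglongrightarrow> 0" unfolding t_def using \<sigma> by real_asymp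
  then have ev: "\<forall>\<^sub>F q in sequentially. t q < \<epsilon>" using \<epsilon> by (rule order_tendstoD)
  have "\<forall>\<^sub>F q in sequentially. max 0 (h (t q)) = cut_gauge \<epsilon> h (t q)"
    using ev
  proof eventually_elim
    case (elim q)
    have "0 \<le> cut_gauge \<epsilon> h (t q)" by (rule nonneg) (simp add: t_def)
    then show ?case using elim by (simp add: cut_gauge_eq)
  qed
  then have "summable (\<lambda>q. max 0 (h (t q))) \<longleftrightarrow> summable (\<lambda>q. cut_gauge \<epsilon> h (t q))" by (rule summable_cong)
  moreover have "(\<Sum>q. ennreal (h (t q))) = (\<Sum>q. ennreal (max 0 (h (t q))))"
    by (intro suminf_cong) (simp add: max_def ennreal_neg)
  moreover have "(\<Sum>q. ennreal (max 0 (h (t q)))) = \<infinity> \<longleftrightarrow> \<not> summable (\<lambda>q. max 0 (h (t q)))"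
    by (rule suminf_ennreal_eq_top_iff) (rule max.cobounded1)
  ultimately show ?thesis unfolding t_def by (simp only: not_not)
qed

text \<open>It is enough to test the constants \<open>K = 1 / (n + 1)\<close>, and the rationals are
  a countable set of points to be removed.\<close>

lemma gdelta_well_approximable: "gdelta_in euclidean (well_approximable \<sigma>)"
proof -
  define W where "W n = (\<Union>p::int. \<Union>q\<in>{1..}. ball (of_int p / real q) (1 / real (Suc n) / real q powr (\<sigma> + 2)))" for n
  have "well_approximable \<sigma> = (\<Inter>n. W n) \<inter> (\<Inter>r\<in>\<rat>. - {r})"
  proof (intro equalityI subsetI IntI)
    fix x assume x: "x \<in> well_approximable \<sigma>"
    show "x \<in> (\<Inter>r\<in>\<rat>. - {r})" using x by (auto simp: well_approximable_def)
    show "x \<in> (\<Inter>n. W n)"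
    proof
      fix n
      have "1 / real (Suc n) > 0" by simp
      then obtain p q where "q \<ge> (1::nat)" "\<bar>x - of_int (p::int) / real q\<bar> < 1 / real (Suc n) / real q powr (\<sigma> + 2)"
        using x unfolding well_approximable_def by blast
      then show "x \<in> W n" unfolding W_def by (force simp: dist_real_def abs_minus_commute)
    qed
  next
    fix x assume x: "x \<in> (\<Inter>n. W n) \<inter> (\<Inter>r\<in>\<rat>. - {r})"
    then have "x \<notin> \<rat>" by auto
    moreover have "\<exists>(p::int) (q::nat). q \<ge> 1 \<and> \<bar>x - of_int p / real q\<bar> < K / real q powr (\<sigma> + 2)" if K: "K > 0" for K
    proof -
      obtain n where n: "1 / real (Suc n) < K" using K nat_approx_posE by blast
      have "x \<in> W n" using x by auto
      then obtain p q where pq: "q \<ge> (1::nat)" "\<bar>x - of_int (p::int) / real q\<bar> < 1 / real (Suc n) / real q powr (\<sigma> + 2)"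
        unfolding W_def by (auto simp: dist_real_def abs_minus_commute)
      moreover have "1 / real (Suc n) / real q powr (\<sigma> + 2) \<le> K / real q powr (\<sigma> + 2)"
        using n by (intro divide_right_mono) auto
      ultimately show ?thesis by (meson less_le_trans)
    qed
    ultimately show "x \<in> well_approximable \<sigma>" by (simp add: well_approximable_def)
  qed
  moreover have "gdelta_in euclidean ((\<Inter>n. W n) \<inter> (\<Inter>r\<in>\<rat>. - {r}))"
  proof (intro gdelta_in_Int)
    show "gdelta_in euclidean (\<Inter>n. W n)"
      by (intro gdelta_in_Inter) (auto simp: W_def intro!: open_imp_gdelta_in open_UN)
    show "gdelta_in euclidean (\<Inter>r\<in>\<rat>. - {r::real})"
      by (intro gdelta_in_Inter) (auto simp: countable_rat Rats_0 intro!: open_imp_gdelta_in exI[of _ "0::real"])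
  qed
  ultimately show ?thesis by simp
qed

section \<open>Hausdorff measure\<close>

context dim_gauge
begin

lemma hausdorff_measure_infinite:
  assumes div: "\<not> summable (\<lambda>q. g (real (Suc q) powr (- (2 + \<sigma>) / 2)))"
    and \<sigma>: "\<sigma> > 0" and \<epsilon>: "\<epsilon> > 0" and h: "\<And>r. 0 \<le> r \<Longrightarrow> r \<le> \<epsilon> \<Longrightarrow> h r = g r"
    and V: "open V" "V \<noteq> {}"
  shows "hausdorff_measure h (well_approximable \<sigma> \<inter> V) = \<infinity>"
proof (rule ccontr)
  assume "hausdorff_measure h (well_approximable \<sigma> \<inter> V) \<noteq> \<infinity>"
  then obtain M where M: "0 \<le> M" "hausdorff_measure h (well_approximable \<sigma> \<inter> V) = ennreal M"
    by (cases "hausdorff_measure h (well_approximable \<sigma> \<inter> V)") auto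
  obtain v where "v \<in> V" using V by blast
  then obtain r where r: "r > 0" "ball v r \<subseteq> V" using V(1) by (meson open_contains_ball)
  \<comment> \<open>Chosen so that an interval of length \<open>2 * r\<close> inside
    \<open>V\<close> forces gauge sums of at least \<open>M + 1\<close>.\<close>
  define A where "A = (M + 1) / (2 * r)"
  have A: "A > 0" using M r by (simp add: A_def)
  obtain \<delta> where \<delta>: "\<delta> > 0" and *: "\<And>a b (U :: nat \<Rightarrow> real set). a < b \<Longrightarrow>
      (\<And>p. bounded (U p) \<and> diameter (U p) < \<delta>) \<Longrightarrow> well_approximable \<sigma> \<inter> {a<..<b} \<subseteq> (\<Union>p. U p) \<Longrightarrow>
      ennreal (A * (b - a)) \<le> (\<Sum>p. ennreal (g (diameter (U p))))"
    using cover_sum_ge[OF div \<sigma> A] by blast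
  have "ennreal (M + 1) \<le> hausdorff_pre h (min \<delta> \<epsilon>) (well_approximable \<sigma> \<inter> V)"
    unfolding hausdorff_pre_def
  proof (rule INF_greatest, clarify)
    fix U :: "nat \<Rightarrow> real set"
    assume cover: "well_approximable \<sigma> \<inter> V \<subseteq> (\<Union>p. U p)"
      and U: "\<forall>p. bounded (U p) \<and> diameter (U p) < min \<delta> \<epsilon>"
    have "{v - r<..<v + r} \<subseteq> V" using r by (simp add: ball_eq_greaterThanLessThan)
    then have "ennreal (A * ((v + r) - (v - r))) \<le> (\<Sum>p. ennreal (g (diameter (U p))))"
      using r U cover by (intro *) auto
    also have "\<dots> = (\<Sum>p. ennreal (h (diameter (U p))))"
      using U by (intro suminf_cong) (auto simp: h diameter_ge_0 less_imp_le)
    also have "A * ((v + r) - (v - r)) = M + 1" using r by (simp add: A_def)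
    finally show "ennreal (M + 1) \<le> (\<Sum>p. ennreal (h (diameter (U p))))" .
  qed
  also have "\<dots> \<le> hausdorff_measure h (well_approximable \<sigma> \<inter> V)"
    unfolding hausdorff_measure_eq_SUP using \<delta> \<epsilon> by (intro SUP_upper) auto
  finally show False using M by (simp add: ennreal_le_iff)
qed

lemma net_content_eq_open:
  assumes c: "c \<ge> 2" and div: "\<not> summable (\<lambda>q. g (real (Suc q) powr (- (2 + \<sigma>) / 2)))"
    and \<sigma>: "\<sigma> > 0" and U: "open U"
  shows "(INF S\<in>radix_covers c J (well_approximable \<sigma> \<inter> U). \<Sum>p. ennreal (g (diameter (S p))))
    = (INF S\<in>radix_covers c J U. \<Sum>p. ennreal (g (diameter (S p))))"
proof (rule antisym)
  show "(INF S\<in>radix_covers c J (well_approximable \<sigma> \<inter> U). \<Sum>p. ennreal (g (diameter (S p))))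
    \<le> (INF S\<in>radix_covers c J U. \<Sum>p. ennreal (g (diameter (S p))))"
    by (rule INF_superset_mono) (auto simp: radix_covers_def)
  show "(INF S\<in>radix_covers c J U. \<Sum>p. ennreal (g (diameter (S p))))
    \<le> (INF S\<in>radix_covers c J (well_approximable \<sigma> \<inter> U). \<Sum>p. ennreal (g (diameter (S p))))"
  proof (rule INF_greatest)
    fix S assume "S \<in> radix_covers c J (well_approximable \<sigma> \<inter> U)"
    then have S: "well_approximable \<sigma> \<inter> U \<subseteq> (\<Union>p. S p)" "\<And>p. S p = {} \<or> (\<exists>n\<ge>J. \<exists>\<kappa>. S p = radix_cell c n \<kappa>)"
      by (auto simp: radix_covers_def)
    from net_cover_extend[OF c div \<sigma> U S(2,1)] obtain S' :: "nat \<Rightarrow> real set"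
      where S': "\<forall>p. S' p = {} \<or> (\<exists>n\<ge>J. \<exists>\<kappa>. S' p = radix_cell c n \<kappa>)" "U \<subseteq> (\<Union>p. S' p)"
        "(\<Sum>p. ennreal (g (diameter (S' p)))) \<le> (\<Sum>p. ennreal (g (diameter (S p))))" by blast
    then have "S' \<in> radix_covers c J U" by (simp add: radix_covers_def)
    then show "(INF S\<in>radix_covers c J U. \<Sum>p. ennreal (g (diameter (S p)))) \<le> (\<Sum>p. ennreal (g (diameter (S p))))"
      using S'(3) INF_lower2[of S' "radix_covers c J U" "\<lambda>S. \<Sum>p. ennreal (g (diameter (S p)))"] by simp
  qed
qed

text \<open>A common source for vanishing Hausdorff measure and vanishing net content. Balls of
  radius zero are empty and weigh nothing, so they pad finite families to sequences.\<close>

definition null_covered :: "real set \<Rightarrow> bool" where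
  "null_covered F \<longleftrightarrow> (\<forall>\<eta>>0. \<forall>\<delta>>0. \<exists>x r :: nat \<Rightarrow> real. (\<forall>n. 0 \<le> r n \<and> r n < \<delta>) \<and>
     F \<subseteq> (\<Union>n. ball (x n) (r n)) \<and> (\<Sum>n. ennreal (g (r n))) \<le> ennreal \<eta>)"

lemma null_covered_UN:
  assumes "\<And>i :: nat. null_covered (F i)"
  shows "null_covered (\<Union>i. F i)"
  unfolding null_covered_def
proof (intro allI impI)
  fix \<eta> \<delta> :: real assume \<eta>: "\<eta> > 0" and \<delta>: "\<delta> > 0"
  have "\<exists>x r :: nat \<Rightarrow> real. (\<forall>n. 0 \<le> r n \<and> r n < \<delta>) \<and>
     F i \<subseteq> (\<Union>n. ball (x n) (r n)) \<and> (\<Sum>n. ennreal (g (r n))) \<le> ennreal (\<eta> * (1/2) ^ Suc i)" for i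
    using assms[of i, unfolded null_covered_def, rule_format, of "\<eta> * (1/2) ^ Suc i" \<delta>] \<eta> \<delta> by simp
  then obtain x r :: "nat \<Rightarrow> nat \<Rightarrow> real" where xr: "\<And>i n. 0 \<le> r i n \<and> r i n < \<delta>"
     "\<And>i. F i \<subseteq> (\<Union>n. ball (x i n) (r i n))"
     "\<And>i. (\<Sum>n. ennreal (g (r i n))) \<le> ennreal (\<eta> * (1/2) ^ Suc i)" by metis
  define x' where "x' n = (case prod_decode n of (i, j) \<Rightarrow> x i j)" for n
  define r' where "r' n = (case prod_decode n of (i, j) \<Rightarrow> r i j)" for n
  have "(\<Union>i. F i) \<subseteq> (\<Union>n. ball (x' n) (r' n))"
  proof
    fix y assume "y \<in> (\<Union>i. F i)"
    then obtain i j where "y \<in> ball (x i j) (r i j)" using xr(2) by blast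
    then have "y \<in> ball (x' (prod_encode (i, j))) (r' (prod_encode (i, j)))" by (simp add: x'_def r'_def)
    then show "y \<in> (\<Union>n. ball (x' n) (r' n))" by blast
  qed
  moreover have "(\<Sum>n. ennreal (g (r' n))) \<le> ennreal \<eta>"
  proof -
    have "(\<Sum>n. ennreal (g (r' n))) = (\<Sum>n. (\<lambda>(i, j). ennreal (g (r i j))) (prod_decode n))"
      by (intro suminf_cong) (simp add: r'_def split: prod.splits)
    also have "\<dots> = (\<Sum>i. \<Sum>j. ennreal (g (r i j)))" by (rule suminf_ennreal_2dimen) simp
    also have "\<dots> \<le> (\<Sum>i. ennreal (\<eta> * (1/2) ^ Suc i))" by (intro suminf_le xr) auto
    also have "\<dots> = ennreal \<eta>"
      using sums_mult[OF power_half_series, of \<eta>] \<eta> by (intro suminf_ennreal_eq) auto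
    finally show ?thesis .
  qed
  moreover have "0 \<le> r' n \<and> r' n < \<delta>" for n using xr(1) by (simp add: r'_def split: prod.splits)
  ultimately show "\<exists>x r :: nat \<Rightarrow> real. (\<forall>n. 0 \<le> r n \<and> r n < \<delta>) \<and>
     (\<Union>i. F i) \<subseteq> (\<Union>n. ball (x n) (r n)) \<and> (\<Sum>n. ennreal (g (r n))) \<le> ennreal \<eta>" by blast
qed

lemma null_covered_subset: "null_covered F \<Longrightarrow> E \<subseteq> F \<Longrightarrow> null_covered E"
  unfolding null_covered_def by (meson subset_trans)

text \<open>Condensation along squares: the \<open>2 * N + 1\<close> terms with
  \<open>N^2 \<le> n < (N + 1)^2\<close> each dominate \<open>g ((N + 1) powr (- s))\<close>. The
  weight \<open>q\<close> reflects that about \<open>q\<close> fractions of denominator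
  \<open>q\<close> lie in a unit interval.\<close>

lemma summable_weighted:
  assumes conv: "summable (\<lambda>q. g (real (Suc q) powr (- s / 2)))" and s: "s > 0"
  shows "summable (\<lambda>q. real (Suc q) * g (real (Suc q) powr (- s)))"
proof -
  define f where "f n = g (real (Suc n) powr (- s / 2))" for n
  have f0: "0 \<le> f n" for n unfolding f_def by (intro nonneg) simp
  have le: "(\<Sum>q<N. real (Suc q) * g (real (Suc q) powr (- s))) \<le> (\<Sum>n<N\<^sup>2. f n)" for N
  proof (induction N)
    case (Suc N)
    have "real (Suc N) * g (real (Suc N) powr (- s)) \<le> real (2 * N + 1) * g (real (Suc N) powr (- s))"
      by (intro mult_right_mono nonneg) auto
    also have "real (2 * N + 1) = real (card {N\<^sup>2..<(Suc N)\<^sup>2})"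
      by (simp add: power2_eq_square)
    also have "\<dots> * g (real (Suc N) powr (- s)) \<le> (\<Sum>n\<in>{N\<^sup>2..<(Suc N)\<^sup>2}. f n)"
    proof (rule sum_bounded_below)
      fix n assume n: "n \<in> {N\<^sup>2..<(Suc N)\<^sup>2}"
      have "real (Suc N) powr (- s) = (real (Suc N) powr 2) powr (- s / 2)" unfolding powr_powr by simp
      also have "real (Suc N) powr 2 = real ((Suc N)\<^sup>2)" by simp
      also have "real ((Suc N)\<^sup>2) powr (- s / 2) \<le> real (Suc n) powr (- s / 2)"
        using n s by (intro powr_mono2') (simp_all only: of_nat_le_iff, auto)
      finally show "g (real (Suc N) powr (- s)) \<le> f n" unfolding f_def by (intro mono) auto
    qed
    finally have "real (Suc N) * g (real (Suc N) powr (- s)) \<le> (\<Sum>n\<in>{N\<^sup>2..<(Suc N)\<^sup>2}. f n)" .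
    moreover have "(\<Sum>n<(Suc N)\<^sup>2. f n) = (\<Sum>n<N\<^sup>2. f n) + (\<Sum>n\<in>{N\<^sup>2..<(Suc N)\<^sup>2}. f n)"
      unfolding lessThan_atLeast0
      by (rule sum.atLeastLessThan_concat[symmetric]) (rule le0, rule power_mono, rule le_SucI, rule order_refl, rule le0)
    ultimately show ?case unfolding sum.lessThan_Suc using Suc.IH by linarith
  qed simp
  show ?thesis
  proof (rule bounded_imp_summable)
    show "0 \<le> real (Suc q) * g (real (Suc q) powr (- s))" for q by (intro mult_nonneg_nonneg nonneg) auto
    fix N
    have "(\<Sum>q\<le>N. real (Suc q) * g (real (Suc q) powr (- s))) \<le> (\<Sum>n<(Suc N)\<^sup>2. f n)"
      using le[of "Suc N"] by (simp only: lessThan_Suc_atMost)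
    also have "\<dots> \<le> (\<Sum>n. f n)" using conv f0 by (intro sum_le_suminf) (auto simp: f_def)
    finally show "(\<Sum>q\<le>N. real (Suc q) * g (real (Suc q) powr (- s))) \<le> (\<Sum>n. f n)" .
  qed
qed

end

section \<open>Covers of the well approximable numbers by balls around fractions\<close>

lemma irrational_gap:
  fixes x :: real
  assumes "x \<notin> \<rat>"
  shows "\<exists>K>0. \<forall>p::int. \<forall>q\<in>{1..Q}. K \<le> \<bar>x - of_int p / real q\<bar>"
proof (induction Q)
  case 0 then show ?case by (intro exI[of _ 1]) simp
next
  case (Suc Q)
  then obtain K where K: "K > 0" "\<And>p q. q \<in> {1..Q} \<Longrightarrow> K \<le> \<bar>x - of_int (p::int) / real q\<bar>" by blast
  define y where "y = x * real (Suc Q)"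
  have "y \<noteq> of_int p" for p :: int
  proof
    assume "y = of_int p"
    then have "x = of_int p / real (Suc Q)" by (simp add: y_def field_simps)
    then show False using assms by (metis Rats_divide Rats_of_int Rats_of_nat)
  qed
  then have y: "of_int \<lfloor>y\<rfloor> \<noteq> y" by metis
  define L where "L = min (y - of_int \<lfloor>y\<rfloor>) (of_int \<lfloor>y\<rfloor> + 1 - y)"
  have "of_int \<lfloor>y\<rfloor> < y" using y of_int_floor_le[of y] by linarith
  then have L: "L > 0" unfolding L_def by linarith
  have Lp: "L \<le> \<bar>y - of_int p\<bar>" for p
  proof (cases "p \<le> \<lfloor>y\<rfloor>")
    case True
    then have "real_of_int p \<le> of_int \<lfloor>y\<rfloor>" by simp
    then show ?thesis unfolding L_def by linarith
  next
    case False
    then have "\<lfloor>y\<rfloor> + 1 \<le> p" by simp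
    then have "real_of_int (\<lfloor>y\<rfloor> + 1) \<le> of_int p" by (simp only: of_int_le_iff)
    then show ?thesis unfolding L_def by simp
  qed
  have "L / real (Suc Q) \<le> \<bar>x - of_int p / real (Suc Q)\<bar>" for p
  proof -
    have "x - of_int p / real (Suc Q) = (y - of_int p) / real (Suc Q)" by (simp add: y_def field_simps)
    then show ?thesis using Lp[of p] by (simp add: abs_divide divide_right_mono)
  qed
  then have "\<forall>p::int. \<forall>q\<in>{1..Suc Q}. min K (L / real (Suc Q)) \<le> \<bar>x - of_int p / real q\<bar>"
    using K(2) by (auto simp: atLeastAtMostSuc_conv min_le_iff_disj)
  moreover have "min K (L / real (Suc Q)) > 0" using K L by simp
  ultimately show ?case by blast
qed

context dim_gauge
begin

lemma null_covered_well_approximable_unit: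
  assumes conv: "summable (\<lambda>q. g (real (Suc q) powr (- (2 + \<sigma>) / 2)))" and \<sigma>: "\<sigma> > 0"
  shows "null_covered (well_approximable \<sigma> \<inter> {of_int a..of_int a + 1})"
  unfolding null_covered_def
proof (intro allI impI)
  fix \<eta> \<delta> :: real assume \<eta>: "\<eta> > 0" and \<delta>: "\<delta> > 0"
  define s where "s = 2 + \<sigma>"
  have s: "s > 0" using \<sigma> by (simp add: s_def)
  define \<rho> where "\<rho> q = real q powr (- s)" for q :: nat
  define f where "f q = real (Suc q) * g (\<rho> (Suc q))" for q
  have f0: "0 \<le> f q" for q unfolding f_def \<rho>_def by (intro mult_nonneg_nonneg nonneg) auto
  have sum_f: "summable f"
    unfolding f_def \<rho>_def using summable_weighted[of s] conv s by (simp add: s_def)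
  have "\<forall>\<^sub>F Q in sequentially. (\<Sum>q. f (q + Q)) < \<eta> / 4"
    using suminf_exist_split2[OF sum_f] \<eta> by (intro order_tendstoD) auto
  moreover have "\<forall>\<^sub>F Q in sequentially. real Q powr (- s) < \<delta>"
  proof (rule order_tendstoD[OF _ \<delta>])
    show "(\<lambda>Q. real Q powr (- s)) \<longlonglongrightarrow> 0" using s by real_asymp
  qed
  ultimately have "\<forall>\<^sub>F Q in sequentially. (\<Sum>q. f (q + Q)) < \<eta> / 4 \<and> real Q powr (- s) < \<delta> \<and> 1 \<le> Q"
    using eventually_ge_at_top[of 1] by eventually_elim simp
  from eventually_happens'[OF sequentially_bot this]
  obtain Q where Q: "(\<Sum>q. f (q + Q)) < \<eta> / 4" "real Q powr (- s) < \<delta>" "1 \<le> Q" by blast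
  \<comment> \<open>For the denominator \<open>q = i + Q + 1\<close>, the numerators
    \<open>(a - 1) * q + j\<close> with \<open>j \<le> 3 * q\<close> give all fractions in
    \<open>[a - 1, a + 2]\<close>. These are \<open>3 * q + 1 \<le> 4 * q\<close> fractions, so each
    denominator costs at most \<open>4 * f (i + Q)\<close>.\<close>
  define X where "X i j = of_int ((a - 1) * int (Suc (i + Q)) + int j) / real (Suc (i + Q))" for i j
  define R where "R i j = (if j \<in> {..3 * Suc (i + Q)} then \<rho> (Suc (i + Q)) else 0)" for i j
  define x where "x n = (case prod_decode n of (i, j) \<Rightarrow> X i j)" for n
  define r where "r n = (case prod_decode n of (i, j) \<Rightarrow> R i j)" for n
  have "0 \<le> R i j \<and> R i j < \<delta>" for i j
  proof -
    have "\<rho> (Suc (i + Q)) \<le> real Q powr (- s)" unfolding \<rho>_def using Q s by (intro powr_mono2') auto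
    then show ?thesis using Q(2) \<delta> by (simp add: R_def \<rho>_def)
  qed
  then have "0 \<le> r n \<and> r n < \<delta>" for n by (simp add: r_def split: prod.splits)
  moreover have "well_approximable \<sigma> \<inter> {of_int a..of_int a + 1} \<subseteq> (\<Union>n. ball (x n) (r n))"
  proof
    fix y assume y: "y \<in> well_approximable \<sigma> \<inter> {of_int a..of_int a + 1}"
    \<comment> \<open>With a constant below this gap every approximating fraction has denominator
      above \<open>Q\<close>, so only the tail of the series is needed.\<close>
    obtain K where K: "K > 0" "\<And>p q. q \<in> {1..Q} \<Longrightarrow> K \<le> \<bar>y - of_int (p::int) / real q\<bar>"
      using irrational_gap[of y Q] y by (auto simp: well_approximable_def)
    \<comment> \<open>The bound by 1 serves twice: it places the fraction within distance 1 of
      \<open>y\<close>, and it makes the distance smaller than \<open>\<rho> q\<close>.\<close>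
    then have "min K 1 > 0" by simp
    then obtain p q where pq: "q \<ge> (1::nat)" "\<bar>y - of_int (p::int) / real q\<bar> < min K 1 / real q powr (\<sigma> + 2)"
      using y unfolding well_approximable_def by blast
    have q1: "1 \<le> real q powr (\<sigma> + 2)" using pq \<sigma> by (intro ge_one_powr_ge_zero) auto
    have "min K 1 / real q powr (\<sigma> + 2) \<le> min K 1 / 1" using q1 K pq(1) by (intro divide_left_mono) auto
    then have lt: "\<bar>y - of_int p / real q\<bar> < min K 1" using pq by linarith
    have "\<not> q \<in> {1..Q}" using K(2)[of q p] lt by auto
    then obtain i where i: "q = Suc (i + Q)" using pq(1) by (metis add.commute add_Suc_right atLeastAtMost_iff less_iff_Suc_add not_le)
    have "\<bar>y - of_int p / real q\<bar> < \<rho> q"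
    proof -
      have "min K 1 / real q powr (\<sigma> + 2) \<le> 1 / real q powr (\<sigma> + 2)" by (intro divide_right_mono) auto
      also have "\<dots> = \<rho> q" by (simp only: \<rho>_def s_def powr_minus_divide add.commute)
      finally show ?thesis using pq(2) by linarith
    qed
    moreover have p_bounds: "(a - 1) * int q \<le> p" "p \<le> (a + 2) * int q"
    proof -
      have q0: "real q > 0" using pq by simp
      have "of_int a - 1 \<le> of_int p / real q" "of_int p / real q \<le> of_int a + 2" using lt y by auto
      then have "real_of_int ((a - 1) * int q) \<le> of_int p" "real_of_int p \<le> of_int ((a + 2) * int q)"
        using q0 by (simp_all add: field_simps)
      then show "(a - 1) * int q \<le> p" "p \<le> (a + 2) * int q" by (simp_all only: of_int_le_iff)
    qed
    define j where "j = nat (p - (a - 1) * int q)"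
    have j: "int j = p - (a - 1) * int q" using p_bounds by (simp add: j_def)
    have "int j \<le> int (3 * q)" unfolding j using p_bounds(2) by (simp add: algebra_simps)
    then have "j \<le> 3 * q" by (simp only: of_nat_le_iff)
    then have "R i j = \<rho> q" unfolding R_def i by simp
    moreover have "X i j = of_int p / real q" unfolding X_def i[symmetric] j by simp
    ultimately have "y \<in> ball (X i j) (R i j)" by (simp add: dist_real_def abs_minus_commute)
    then have "y \<in> ball (x (prod_encode (i, j))) (r (prod_encode (i, j)))" by (simp add: x_def r_def)
    then show "y \<in> (\<Union>n. ball (x n) (r n))" by blast
  qed
  moreover have "(\<Sum>n. ennreal (g (r n))) \<le> ennreal \<eta>"
  proof -
    have "(\<Sum>n. ennreal (g (r n))) = (\<Sum>n. (\<lambda>(i, j). ennreal (g (R i j))) (prod_decode n))"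
      by (intro suminf_cong) (simp add: r_def split: prod.splits)
    also have "\<dots> = (\<Sum>i. \<Sum>j. ennreal (g (R i j)))" by (rule suminf_ennreal_2dimen) simp
    also have "\<dots> \<le> (\<Sum>i. ennreal (4 * f (i + Q)))"
    proof (intro suminf_le)
      fix i
      have g0: "0 \<le> g (\<rho> (Suc (i + Q)))" unfolding \<rho>_def by (intro nonneg) simp
      have "(\<Sum>j. ennreal (g (R i j))) = (\<Sum>j\<in>{..3 * Suc (i + Q)}. ennreal (g (R i j)))"
        by (rule suminf_finite) (auto simp: R_def zero)
      also have "\<dots> = (\<Sum>j\<in>{..3 * Suc (i + Q)}. ennreal (g (\<rho> (Suc (i + Q)))))"
        by (intro sum.cong) (auto simp: R_def)
      also have "\<dots> = ennreal (real (3 * Suc (i + Q) + 1) * g (\<rho> (Suc (i + Q))))"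
        using g0 by (subst sum_ennreal) (auto simp: distrib_right)
      also have "\<dots> \<le> ennreal (4 * f (i + Q))"
        unfolding f_def mult.assoc[symmetric] using g0 by (intro ennreal_leI mult_right_mono) auto
      finally show "(\<Sum>j. ennreal (g (R i j))) \<le> ennreal (4 * f (i + Q))" .
    qed auto
    also have "\<dots> = ennreal (\<Sum>i. 4 * f (i + Q))"
      using f0 sum_f by (intro suminf_ennreal2 summable_mult) auto
    also have "\<dots> \<le> ennreal \<eta>"
      using Q(1) sum_f by (intro ennreal_leI) (simp add: suminf_mult)
    finally show ?thesis .
  qed
  ultimately show "\<exists>x r :: nat \<Rightarrow> real. (\<forall>n. 0 \<le> r n \<and> r n < \<delta>) \<and>
     well_approximable \<sigma> \<inter> {of_int a..of_int a + 1} \<subseteq> (\<Union>n. ball (x n) (r n)) \<and> (\<Sum>n. ennreal (g (r n))) \<le> ennreal \<eta>"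
    by blast
qed

lemma null_covered_well_approximable:
  assumes "summable (\<lambda>q. g (real (Suc q) powr (- (2 + \<sigma>) / 2)))" "\<sigma> > 0"
  shows "null_covered (well_approximable \<sigma>)"
proof -
  have "null_covered (\<Union>i. well_approximable \<sigma> \<inter> {of_int (int_decode i)..of_int (int_decode i) + 1})"
    using null_covered_well_approximable_unit[OF assms] by (rule null_covered_UN)
  then show ?thesis
  proof (rule null_covered_subset, intro subsetI)
    fix y assume y: "y \<in> well_approximable \<sigma>"
    have "of_int \<lfloor>y\<rfloor> \<le> y" "y \<le> of_int \<lfloor>y\<rfloor> + 1" by linarith+
    with y show "y \<in> (\<Union>i. well_approximable \<sigma> \<inter> {of_int (int_decode i)..of_int (int_decode i) + 1})"
      by (auto intro!: exI[of _ "int_encode \<lfloor>y\<rfloor>"])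
  qed
qed

lemma hausdorff_measure_null:
  assumes F: "null_covered F" and \<epsilon>: "\<epsilon> > 0" and h: "\<And>r. 0 \<le> r \<Longrightarrow> r \<le> \<epsilon> \<Longrightarrow> h r = g r"
  shows "hausdorff_measure h F = 0"
proof -
  have pre: "hausdorff_pre h \<delta> F \<le> ennreal e" if \<delta>: "\<delta> > 0" and e: "e > 0" for \<delta> e
  proof -
    obtain x r :: "nat \<Rightarrow> real" where xr: "\<And>n. 0 \<le> r n \<and> r n < min \<delta> \<epsilon> / 2"
       "F \<subseteq> (\<Union>n. ball (x n) (r n))" "(\<Sum>n. ennreal (g (r n))) \<le> ennreal (e / 2)"
      using F[unfolded null_covered_def, rule_format, of "e / 2" "min \<delta> \<epsilon> / 2"] \<delta> e \<epsilon> by auto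
    have r0: "0 \<le> r n" "2 * r n < \<delta>" "2 * r n \<le> \<epsilon>" for n using xr(1)[of n] by auto
    have diam: "diameter (ball (x n) (r n)) = 2 * r n" for n using r0(1)[of n] by simp
    have "hausdorff_pre h \<delta> F \<le> (\<Sum>n. ennreal (h (diameter (ball (x n) (r n)))))"
      unfolding hausdorff_pre_def using xr(2) r0 diam by (intro INF_lower) simp
    also have "\<dots> \<le> (\<Sum>n. 2 * ennreal (g (r n)))"
    proof (intro suminf_le)
      fix n
      \<comment> \<open>Balls are weighed by radius, Hausdorff covers by diameter;
        \<open>quot'\<close> limits the loss to a factor 2.\<close>
      have "r n * g (2 * r n) \<le> 2 * r n * g (r n)" using r0(1)[of n] by (intro quot') auto
      then have "g (2 * r n) \<le> 2 * g (r n)"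
        using r0(1)[of n] zero by (cases "r n = 0") (auto simp: mult_ac)
      then have "ennreal (g (2 * r n)) \<le> ennreal (2 * g (r n))" by (rule ennreal_leI)
      also have "\<dots> = 2 * ennreal (g (r n))" using nonneg r0(1) by (simp add: ennreal_mult)
      finally show "ennreal (h (diameter (ball (x n) (r n)))) \<le> 2 * ennreal (g (r n))"
        using r0[of n] h[of "2 * r n"] by simp
    qed auto
    also have "\<dots> = 2 * (\<Sum>n. ennreal (g (r n)))" by simp
    also have "\<dots> \<le> 2 * ennreal (e / 2)" by (intro mult_left_mono xr(3)) auto
    also have "\<dots> = ennreal e" using e by (simp add: ennreal_mult[symmetric] flip: ennreal_numeral)
    finally show ?thesis .
  qed
  have "hausdorff_pre h \<delta> F = 0" if "\<delta> > 0" for \<delta>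
  proof -
    have "hausdorff_pre h \<delta> F \<le> 0"
      by (rule ennreal_le_epsilon) (use pre[OF that] in simp)
    then show ?thesis by simp
  qed
  then show ?thesis unfolding hausdorff_measure_eq_SUP
    by (intro antisym SUP_least) auto
qed

end

section \<open>Net content\<close>

lemma radix_scale:
  assumes c: "c \<ge> 2" and t: "0 < t" "t < 1"
  shows "\<exists>n. t \<le> 1 / real c ^ n \<and> 1 / real c ^ n \<le> real c * t"
proof -
  have "\<forall>\<^sub>F m in sequentially. 1 / real c ^ m < t"
    by (rule order_tendstoD(2)[OF inverse_power_tendsto_0[OF c] t(1)])
  from eventually_happens'[OF sequentially_bot this] have ex: "\<exists>m. 1 / real c ^ m < t" .
  define m where "m = (LEAST m. 1 / real c ^ m < t)"
  have m: "1 / real c ^ m < t" unfolding m_def by (rule LeastI_ex[OF ex])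
  then obtain n where n: "m = Suc n" using t by (cases m) auto
  have "\<not> 1 / real c ^ n < t" using not_less_Least[of n "\<lambda>m. 1 / real c ^ m < t"] n m_def by simp
  moreover have "1 / real c ^ n \<le> real c * t" using m c unfolding n by (simp add: field_simps)
  ultimately show ?thesis by (intro exI[of _ n]) (simp add: not_less)
qed

context dim_gauge
begin

text \<open>A ball of radius \<open>r\<close> fits into two adjacent cells whose length lies between
  \<open>2 * r\<close> and \<open>2 * c * r\<close>, namely those containing its end points. They
  cost at most \<open>4 * c * g r\<close>, which explains \<open>\<eta>\<close>;
  \<open>\<delta>\<close> is small enough to force generation at least \<open>J\<close>.\<close>

lemma radix_content_null:
  assumes c: "c \<ge> 2" and F: "null_covered F"
  shows "(INF S\<in>radix_covers c J F. \<Sum>p. ennreal (g (diameter (S p)))) = 0"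
proof -
  have le: "(INF S\<in>radix_covers c J F. \<Sum>p. ennreal (g (diameter (S p)))) \<le> 0 + ennreal e" if e: "e > 0" for e
  proof -
    define \<eta> where "\<eta> = e / (4 * real c)"
    define \<delta> where "\<delta> = 1 / (2 * real c * real c ^ J)"
    have \<eta>: "\<eta> > 0" and \<delta>: "\<delta> > 0" using e c by (auto simp: \<eta>_def \<delta>_def)
    obtain x r :: "nat \<Rightarrow> real" where xr: "\<And>n. 0 \<le> r n \<and> r n < \<delta>"
       "F \<subseteq> (\<Union>n. ball (x n) (r n))" "(\<Sum>n. ennreal (g (r n))) \<le> ennreal \<eta>"
      using F[unfolded null_covered_def, rule_format, OF \<eta> \<delta>] by auto
    have cJ: "1 \<le> real c ^ J" using c by simp
    have "\<exists>n. 2 * r i \<le> 1 / real c ^ n \<and> 1 / real c ^ n \<le> real c * (2 * r i)" if "r i > 0" for i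
    proof (rule radix_scale[OF c])
      have "2 * \<delta> \<le> 1" unfolding \<delta>_def using c cJ mult_mono[of 1 "real c" 1 "real c ^ J"] by (simp add: field_simps)
      then show "2 * r i < 1" using xr(1)[of i] by linarith
    qed (use that in simp)
    then obtain n where n: "\<And>i. r i > 0 \<Longrightarrow> 2 * r i \<le> 1 / real c ^ n i \<and> 1 / real c ^ n i \<le> real c * (2 * r i)"
      by metis
    have nJ: "J \<le> n i" if "r i > 0" for i
    proof (rule ccontr)
      assume "\<not> J \<le> n i"
      then have "1 / real c ^ J \<le> 1 / real c ^ n i" using c by (intro divide_left_mono power_increasing) auto
      also have "\<dots> \<le> real c * (2 * r i)" using n[OF that] by simp
      also have "\<dots> < real c * (2 * \<delta>)" using xr(1)[of i] c by (intro mult_strict_left_mono) auto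
      also have "\<dots> = 1 / real c ^ J" using c by (simp add: \<delta>_def)
      finally show False by simp
    qed
    define C where "C i j = (if r i > 0 \<and> j < (2::nat) then
        radix_cell c (n i) \<lfloor>(if j = 0 then x i - r i else x i + r i) * real c ^ n i\<rfloor> else {})" for i j
    define S where "S p = (case prod_decode p of (i, j) \<Rightarrow> C i j)" for p
    have "S \<in> radix_covers c J F"
      unfolding radix_covers_def
    proof (intro CollectI conjI allI)
      show "S p = {} \<or> (\<exists>n\<ge>J. \<exists>\<kappa>. S p = radix_cell c n \<kappa>)" for p
        using nJ by (auto simp: S_def C_def split: prod.splits)
      show "F \<subseteq> (\<Union>p. S p)"
      proof
        fix y assume "y \<in> F"
        then obtain i where y: "y \<in> ball (x i) (r i)" using xr(2) by blast
        then have ri: "r i > 0" using dist_not_less_zero[of "x i" y] xr(1)[of i] by (auto simp: less_le)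
        define k where "k = real c ^ n i"
        have k: "k > 0" using c by (simp add: k_def)
        have "2 * r i * k \<le> 1" using n[OF ri] k by (simp add: k_def field_simps)
        moreover have "x i - r i < y" "y < x i + r i" using y by (auto simp: dist_real_def abs_less_iff)
        then have "(x i - r i) * k \<le> y * k" "y * k \<le> (x i + r i) * k" using k by (auto intro: mult_right_mono)
        ultimately have "\<lfloor>(x i - r i) * k\<rfloor> \<le> \<lfloor>y * k\<rfloor>" "\<lfloor>y * k\<rfloor> \<le> \<lfloor>(x i + r i) * k\<rfloor>"
           "\<lfloor>(x i + r i) * k\<rfloor> \<le> \<lfloor>(x i - r i) * k + 1\<rfloor>"
          by (auto intro!: floor_mono simp: algebra_simps)
        then have "\<lfloor>y * k\<rfloor> = \<lfloor>(x i - r i) * k\<rfloor> \<or> \<lfloor>y * k\<rfloor> = \<lfloor>(x i + r i) * k\<rfloor>" by linarith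
        then have "y \<in> C i 0 \<or> y \<in> C i 1" using ri by (simp add: C_def radix_cell_def k_def)
        then have "y \<in> S (prod_encode (i, 0)) \<or> y \<in> S (prod_encode (i, 1))" by (simp add: S_def)
        then show "y \<in> (\<Union>p. S p)" by blast
      qed
    qed
    then have "(INF S\<in>radix_covers c J F. \<Sum>p. ennreal (g (diameter (S p)))) \<le> (\<Sum>p. ennreal (g (diameter (S p))))"
      by (rule INF_lower)
    also have "\<dots> = (\<Sum>p. (\<lambda>(i, j). ennreal (g (diameter (C i j)))) (prod_decode p))"
      by (intro suminf_cong) (simp add: S_def split: prod.splits)
    also have "\<dots> = (\<Sum>i. \<Sum>j. ennreal (g (diameter (C i j))))" by (rule suminf_ennreal_2dimen) simp
    also have "\<dots> \<le> (\<Sum>i. ennreal (4 * real c) * ennreal (g (r i)))"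
    proof (intro suminf_le)
      fix i
      have le: "ennreal (g (diameter (C i j))) \<le> ennreal (2 * real c * g (r i))" for j
      proof (rule ennreal_leI, cases "r i > 0 \<and> j < 2")
        case True
        then have "g (diameter (C i j)) = g (1 / real c ^ n i)" by (simp add: C_def diameter_radix_cell[OF c])
        also have "\<dots> \<le> g (2 * real c * r i)" using n[of i] True by (intro mono) (auto simp: mult_ac)
        also have "\<dots> \<le> 2 * real c * g (r i)"
        proof -
          have "r i * g (2 * real c * r i) \<le> (2 * real c * r i) * g (r i)"
            using True c by (intro quot) auto
          then have "r i * g (2 * real c * r i) \<le> r i * (2 * real c * g (r i))" by (simp add: mult_ac)
          then show ?thesis using True by (simp add: mult_le_cancel_left_pos)
        qed
        finally show "g (diameter (C i j)) \<le> 2 * real c * g (r i)" .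
      next
        case False
        then show "g (diameter (C i j)) \<le> 2 * real c * g (r i)" using nonneg xr(1) by (auto simp: C_def zero)
      qed
      have "(\<Sum>j. ennreal (g (diameter (C i j)))) = (\<Sum>j<2. ennreal (g (diameter (C i j))))"
        by (rule suminf_finite) (auto simp: C_def zero)
      also have "\<dots> \<le> (\<Sum>j<(2::nat). ennreal (2 * real c * g (r i)))" by (intro sum_mono le)
      also have "\<dots> = ennreal (4 * real c) * ennreal (g (r i))"
        using nonneg[of "r i"] xr(1)[of i] by (subst sum_ennreal) (auto simp: ennreal_mult[symmetric] mult_ac)
      finally show "(\<Sum>j. ennreal (g (diameter (C i j)))) \<le> ennreal (4 * real c) * ennreal (g (r i))" .
    qed auto
    also have "\<dots> = ennreal (4 * real c) * (\<Sum>i. ennreal (g (r i)))" by simp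
    also have "\<dots> \<le> ennreal (4 * real c) * ennreal \<eta>" by (intro mult_left_mono xr(3)) auto
    also have "\<dots> = ennreal e" using \<eta> c by (simp add: ennreal_mult[symmetric] \<eta>_def)
    finally show ?thesis by simp
  qed
  have "(INF S\<in>radix_covers c J F. \<Sum>p. ennreal (g (diameter (S p)))) \<le> 0"
    by (rule ennreal_le_epsilon) (rule le)
  then show ?thesis by simp
qed

text \<open>Comparison with Lebesgue measure: \<open>g d \<ge> g 1 * d\<close> for
  \<open>d \<le> 1\<close>, so a cover costs at least \<open>g 1\<close> times the length of an
  interval in \<open>V\<close>.\<close>

lemma radix_content_pos:
  assumes c: "c \<ge> 2" and V: "open V" "V \<noteq> {}"
  shows "(INF S\<in>radix_covers c J V. \<Sum>p. ennreal (g (diameter (S p)))) > 0"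
proof -
  obtain v where "v \<in> V" using V by blast
  then obtain r where r: "r > 0" "ball v r \<subseteq> V" using V(1) by (meson open_contains_ball)
  have "ennreal (g 1 * (2 * r)) \<le> (INF S\<in>radix_covers c J V. \<Sum>p. ennreal (g (diameter (S p))))"
  proof (rule INF_greatest)
    fix S assume S: "S \<in> radix_covers c J V"
    have cell: "S p \<in> sets lborel \<and> ennreal (g 1) * emeasure lborel (S p) \<le> ennreal (g (diameter (S p)))" for p
    proof (cases "S p = {}")
      case False
      then obtain n \<kappa> where p: "S p = radix_cell c n \<kappa>" using S unfolding radix_covers_def by blast
      have cn: "real c ^ n \<ge> 1" using c by simp
      have "of_int \<kappa> / real c ^ n \<le> (of_int \<kappa> + 1) / real c ^ n"
        using c by (intro divide_right_mono) auto
      then have "emeasure lborel (S p) = ennreal ((of_int \<kappa> + 1) / real c ^ n - of_int \<kappa> / real c ^ n)"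
        unfolding p radix_cell_eq[OF c] by (rule emeasure_lborel_Ico)
      also have "(of_int \<kappa> + 1) / real c ^ n - of_int \<kappa> / real c ^ n = 1 / real c ^ n"
        by (simp add: add_divide_distrib)
      finally have em: "emeasure lborel (S p) = ennreal (1 / real c ^ n)" .
      have "1 / real c ^ n * g 1 \<le> 1 * g (1 / real c ^ n)" 
      proof (rule quot)
        show "0 < 1 / real c ^ n" using c by simp
        have "1 / real c ^ n \<le> 1 / 1" using c cn by (intro divide_left_mono) auto
        then show "1 / real c ^ n \<le> 1" by simp
      qed
      then have le: "g 1 * (1 / real c ^ n) \<le> g (diameter (S p))"
        unfolding p diameter_radix_cell[OF c] by (simp add: mult.commute)
      have "ennreal (g 1) * emeasure lborel (S p) = ennreal (g 1 * (1 / real c ^ n))"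
        unfolding em using nonneg[of 1] by (intro ennreal_mult[symmetric]) auto
      also have "\<dots> \<le> ennreal (g (diameter (S p)))" by (rule ennreal_leI[OF le])
      finally have "ennreal (g 1) * emeasure lborel (S p) \<le> ennreal (g (diameter (S p)))" .
      moreover have "S p \<in> sets lborel" unfolding p radix_cell_eq[OF c] by simp
      ultimately show ?thesis by simp
    qed simp
    have "ball v r \<subseteq> (\<Union>p. S p)" using S r by (auto simp: radix_covers_def)
    then have "emeasure lborel {v - r<..<v + r} \<le> emeasure lborel (\<Union>p. S p)"
      using cell by (intro emeasure_mono) (auto simp: ball_eq_greaterThanLessThan)
    also have "\<dots> \<le> (\<Sum>p. emeasure lborel (S p))"
      using cell by (intro emeasure_subadditive_countably) auto
    finally have "ennreal (2 * r) \<le> (\<Sum>p. emeasure lborel (S p))" using r by simp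
    then have "ennreal (g 1) * ennreal (2 * r) \<le> ennreal (g 1) * (\<Sum>p. emeasure lborel (S p))"
      by (intro mult_left_mono) auto
    also have "\<dots> = (\<Sum>p. ennreal (g 1) * emeasure lborel (S p))" by simp
    also have "\<dots> \<le> (\<Sum>p. ennreal (g (diameter (S p))))" using cell by (intro suminf_le) auto
    finally show "ennreal (g 1 * (2 * r)) \<le> (\<Sum>p. ennreal (g (diameter (S p))))"
      using r nonneg[of 1] by (simp add: ennreal_mult)
  qed
  moreover have "0 < ennreal (g 1 * (2 * r))" using r pos[of 1] by simp
  ultimately show ?thesis by (rule less_le_trans[rotated])
qed

text \<open>Continuity at \<open>t > 0\<close> is a squeeze between
  \<open>min 1 (s / t) * g t\<close> and \<open>max 1 (s / t) * g t\<close>, both consequences of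
  \<open>mono\<close> and \<open>quot\<close>.\<close>

lemma in_gauge_D1: "g \<in> gauge_D1"
proof -
  have cont: "continuous_on {0..1} g"
    unfolding continuous_on_def
  proof
    fix t :: real assume t: "t \<in> {0..1}"
    show "(g \<longlongrightarrow> g t) (at t within {0..1})"
    proof (cases "t = 0")
      case True
      then show ?thesis using lim zero by (simp add: at_within_Icc_at_right)
    next
      case False
      then have t0: "t > 0" using t by simp
      have ev: "\<forall>\<^sub>F s in at t within {0..1}. 0 \<le> s" by (auto simp: eventually_at_filter)
      have lower: "min 1 (s / t) * g t \<le> g s" if s: "0 \<le> s" for s
      proof (cases "s \<le> t")
        case True
        then have "s * g t \<le> t * g s" using s by (intro quot')
        then show ?thesis using True t0 by (simp add: min_def field_simps)
      next
        case False
        then show ?thesis using mono[of t s] t0 by (simp add: min_def field_simps)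
      qed
      have upper: "g s \<le> max 1 (s / t) * g t" if s: "0 \<le> s" for s
      proof (cases "s \<le> t")
        case True
        then show ?thesis using mono[of s t] s t0 by (simp add: max_def field_simps)
      next
        case False
        then have "t * g s \<le> s * g t" using t0 by (intro quot) auto
        then show ?thesis using False t0 by (simp add: max_def field_simps)
      qed
      have "((\<lambda>s. min 1 (s / t) * g t) \<longlongrightarrow> min 1 (t / t) * g t) (at t within {0..1})"
        by (intro tendsto_intros) (use t0 in auto)
      moreover have "((\<lambda>s. max 1 (s / t) * g t) \<longlongrightarrow> max 1 (t / t) * g t) (at t within {0..1})"
        by (intro tendsto_intros) (use t0 in auto)
      ultimately show ?thesis
        using t0 lower upper ev by (intro tendsto_sandwich[of "\<lambda>s. min 1 (s / t) * g t" g _ "\<lambda>s. max 1 (s / t) * g t"])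
          (auto elim!: eventually_mono)
    qed
  qed
  have "antimono_on {0<..1} (\<lambda>r. g r / r)"
    by (rule monotone_onI) (use quot in \<open>auto simp: field_simps\<close>)
  then show ?thesis
    unfolding gauge_D1_def using zero cont pos mono
    by (intro CollectI conjI exI[of _ 1]) (auto intro!: monotone_onI)
qed

lemma filterlim_at_right_0: "filterlim g (at_right 0) (at_right 0)"
  unfolding filterlim_at using lim pos by (auto simp: eventually_at_filter less_imp_neq[THEN not_sym])

end

lemma dim_gauge_comp:
  assumes "dim_gauge w" "dim_gauge g"
  shows "dim_gauge (\<lambda>r. w (g r))"
proof -
  interpret w: dim_gauge w by fact
  interpret g: dim_gauge g by fact
  show ?thesis
  proof
    show "w (g 0) = 0" by (simp add: w.zero g.zero)
    show "0 < w (g r)" if "0 < r" for r using that by (intro w.pos g.pos)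
    show "w (g r) \<le> w (g t)" if "0 \<le> r" "r \<le> t" for r t using that by (intro w.mono g.mono g.nonneg)
    show "r * w (g t) \<le> t * w (g r)" if r: "0 < r" "r \<le> t" for r t
    proof -
      have gr: "0 < g r" using g.pos r by simp
      have "g r * w (g t) \<le> g t * w (g r)" using r by (intro w.quot g.pos g.mono) auto
      then have "r * (g r * w (g t)) \<le> (r * g t) * w (g r)" using r by (simp add: mult_left_mono mult.assoc)
      also have "\<dots> \<le> (t * g r) * w (g r)" using r gr w.nonneg by (intro mult_right_mono g.quot) auto
      finally have "g r * (r * w (g t)) \<le> g r * (t * w (g r))" by (simp add: mult_ac)
      then show ?thesis using gr by (simp add: mult_le_cancel_left_pos)
    qed
    show "((\<lambda>r. w (g r)) \<longlongrightarrow> 0) (at_right 0)"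
      using w.lim g.filterlim_at_right_0 by (rule filterlim_compose)
  qed
qed

section \<open>A slower gauge with convergent series\<close>

text \<open>Beyond some \<open>N\<close> the tail of the series is below \<open>e / 2\<close>; the
  first \<open>N\<close> truncated terms are at most \<open>a\<close> each, and \<open>a\<close> is
  chosen so that \<open>N * a \<le> e / 2\<close>.\<close>

lemma truncated_sum_small:
  fixes x :: "nat \<Rightarrow> real"
  assumes x: "\<And>n. 0 \<le> x n" and sum: "summable x" and e: "e > 0"
  shows "\<exists>a>0. a \<le> e \<and> (\<forall>M. (\<Sum>n<M. min (x n) a) \<le> e)"
proof -
  have "\<forall>\<^sub>F N in sequentially. (\<Sum>n. x (n + N)) < e / 2"
    using suminf_exist_split2[OF sum] e by (intro order_tendstoD) auto
  from eventually_happens'[OF sequentially_bot this]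
  obtain N where N: "(\<Sum>n. x (n + N)) < e / 2" by blast
  define a where "a = e / (2 * real (Suc N))"
  have a: "a > 0" "a \<le> e" using e by (auto simp: a_def field_simps)
  have "(\<Sum>n<M. min (x n) a) \<le> e" for M
  proof -
    have "(\<Sum>n<M. min (x n) a) \<le> (\<Sum>n<N + M. min (x n) a)" using x a by (intro sum_mono2) auto
    also have "\<dots> = (\<Sum>n<N. min (x n) a) + (\<Sum>n<M. min (x (n + N)) a)"
      by (induction M) (simp_all add: add_ac)
    also have "\<dots> \<le> real N * a + (\<Sum>n<M. x (n + N))"
      using sum_bounded_above[of "{..<N}" "\<lambda>n. min (x n) a" a] by (intro add_mono sum_mono) auto
    also have "(\<Sum>n<M. x (n + N)) \<le> (\<Sum>n. x (n + N))"
      using x sum by (intro sum_le_suminf) (auto simp: summable_iff_shift)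
    also have "real N * a \<le> e / 2" using e by (simp add: a_def field_simps)
    finally show ?thesis using N by simp
  qed
  with a show ?thesis by blast
qed

text \<open>
  The concave gauge \<open>w\<close> below is a sum of truncations \<open>min t (a k)\<close>: each of them is eventually
  linear at the origin, so \<open>w t / t\<close> tends to infinity, while \<open>a k\<close> is so small that the
  \<open>k\<close>-th truncation adds at most \<open>(1/2) ^ k\<close> to \<open>\<Sum>n. w (x n)\<close>.
\<close>

lemma exists_slower_summable_gauge:
  fixes x :: "nat \<Rightarrow> real"
  assumes x: "\<And>n. 0 \<le> x n" and sum: "summable x"
  shows "\<exists>w. dim_gauge w \<and> summable (\<lambda>n. w (x n)) \<and> filterlim (\<lambda>t. w t / t) at_top (at_right 0)"
proof -
  have "\<exists>a>0. a \<le> (1/2) ^ k \<and> (\<forall>M. (\<Sum>n<M. min (x n) a) \<le> (1/2) ^ k)" for k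
    by (rule truncated_sum_small[OF x sum]) simp
  then obtain a :: "nat \<Rightarrow> real" where a: "\<And>k. 0 < a k" "\<And>k. a k \<le> (1/2) ^ k"
      "\<And>k M. (\<Sum>n<M. min (x n) (a k)) \<le> (1/2) ^ k" by metis
  have half: "summable (\<lambda>k. (1/2::real) ^ k)" by (intro summable_geometric) simp
  have summ: "summable (\<lambda>k. min t (a k))" if "0 \<le> t" for t
  proof (rule summable_comparison_test'[OF half])
    show "norm (min t (a k)) \<le> (1/2) ^ k" for k
      using a(1)[of k] a(2)[of k] that by (auto simp: min_def)
  qed
  define w where "w t = (\<Sum>k. min t (a k))" for t
  have partial: "(\<Sum>k<N. min t (a k)) \<le> w t" if "0 \<le> t" for N t
    unfolding w_def using a that by (intro sum_le_suminf summ) (auto intro: less_imp_le)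
  have "dim_gauge w"
  proof
    show "w 0 = 0" using a by (simp add: w_def min_def less_imp_le)
    show "0 < w r" if "0 < r" for r
    proof -
      have "0 < min r (a 0)" using that a by simp
      also have "\<dots> \<le> w r" using partial[of r 1] that by simp
      finally show ?thesis .
    qed
    show "w r \<le> w t" if "0 \<le> r" "r \<le> t" for r t
      unfolding w_def using that by (intro suminf_le summ) (auto simp: min_le_iff_disj)
    show "r * w t \<le> t * w r" if r: "0 < r" "r \<le> t" for r t
    proof -
      have "r * w t = (\<Sum>k. r * min t (a k))" unfolding w_def using r by (intro suminf_mult[symmetric] summ) auto
      also have "\<dots> \<le> (\<Sum>k. t * min r (a k))"
      proof (intro suminf_le summable_mult summ)
        fix k show "r * min t (a k) \<le> t * min r (a k)"
          using r a(1)[of k] by (auto simp: min_def mult.commute mult_right_mono intro: mult_mono)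
      qed (use r in auto)
      also have "\<dots> = t * w r" unfolding w_def using r by (intro suminf_mult summ) auto
      finally show ?thesis .
    qed
    show "(w \<longlongrightarrow> 0) (at_right 0)"
    proof (rule tendstoI)
      fix e :: real assume e: "e > 0"
      have "\<forall>\<^sub>F N in sequentially. (\<Sum>k. (1/2::real) ^ (k + N)) < e / 2"
        using suminf_exist_split2[OF half] e by (intro order_tendstoD) auto
      from eventually_happens'[OF sequentially_bot this]
      obtain N where N: "(\<Sum>k. (1/2::real) ^ (k + N)) < e / 2" by blast
      have "\<forall>\<^sub>F t in at_right 0. t \<in> {0<..<e / (2 * real (Suc N))}"
        using e by (intro eventually_at_right_real) simp
      then show "\<forall>\<^sub>F t in at_right 0. dist (w t) 0 < e"
      proof eventually_elim
        case (elim t)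
        have "w t = (\<Sum>k. min t (a (k + N))) + (\<Sum>k<N. min t (a k))"
          unfolding w_def using elim by (intro suminf_split_initial_segment summ) auto
        moreover have "(\<Sum>k. min t (a (k + N))) \<le> (\<Sum>k. (1/2) ^ (k + N))"
          using summable_ignore_initial_segment[OF summ[of t], of N] summable_ignore_initial_segment[OF half, of N]
            elim a(2) by (intro suminf_le) (auto simp: min_le_iff_disj)
        moreover have "(\<Sum>k<N. min t (a k)) \<le> real N * t"
          using sum_bounded_above[of "{..<N}" "\<lambda>k. min t (a k)" t] by simp
        moreover have "real N * t \<le> real (Suc N) * t" using elim by (intro mult_right_mono) auto
        moreover have "real (Suc N) * t < e / 2" using elim by (simp add: field_simps)
        moreover have "0 \<le> w t" using partial[of t 0] elim by simp
        ultimately show ?case using N by simp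
      qed
    qed
  qed
  moreover have "summable (\<lambda>n. w (x n))"
  proof (rule bounded_imp_summable)
    show "0 \<le> w (x n)" for n using partial[of "x n" 0] x by simp
    fix M
    have "(\<Sum>n\<le>M. w (x n)) = (\<Sum>k. \<Sum>n<Suc M. min (x n) (a k))"
      unfolding w_def lessThan_Suc_atMost by (rule suminf_sum[symmetric]) (rule summ[OF x])
    also have "\<dots> \<le> (\<Sum>k. (1/2) ^ k)"
      by (intro suminf_le a(3) half summable_sum summ x)
    finally show "(\<Sum>n\<le>M. w (x n)) \<le> (\<Sum>k. (1/2) ^ k)" .
  qed
  moreover have "filterlim (\<lambda>t. w t / t) at_top (at_right 0)"
    unfolding filterlim_at_top
  proof
    fix Z :: real
    define N where "N = nat \<lceil>Z\<rceil>"
    have ZN: "Z \<le> real N" unfolding N_def by linarith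
    \<comment> \<open>For such \<open>t\<close> the first \<open>N\<close> truncations all equal
      \<open>t\<close>, so \<open>w t \<ge> N * t\<close>.\<close>
    have "\<forall>\<^sub>F t in at_right 0. \<forall>k\<in>{..<N}. t < a k"
      using a(1) by (intro eventually_ball_finite) (auto simp: eventually_at_right_field)
    then show "\<forall>\<^sub>F t in at_right 0. Z \<le> w t / t"
      using eventually_at_right_less[of 0]
    proof eventually_elim
      case (elim t)
      have "(\<Sum>k<N. min t (a k)) = (\<Sum>k<N. t)" using elim by (intro sum.cong) auto
      then have "real N * t = (\<Sum>k<N. min t (a k))" by simp
      also have "\<dots> \<le> w t" by (rule partial) (use elim in simp)
      finally have "real N \<le> w t / t" using elim by (simp add: field_simps)
      with ZN show ?case by linarith
    qed
  qed
  ultimately show ?thesis by blast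
qed

text \<open>Near zero the quotient by \<open>h\<close> is \<open>w u / u\<close> at
  \<open>u = h r\<close>. It is nonincreasing by \<open>quot\<close> for \<open>w\<close> and tends
  to infinity because \<open>w u / u\<close> does at zero.\<close>

lemma exists_prec_summable_gauge:
  assumes g: "dim_gauge (cut_gauge \<epsilon> h)" and \<epsilon>: "\<epsilon> > 0"
    and t: "\<And>n. 0 \<le> t n" and sum: "summable (\<lambda>n. cut_gauge \<epsilon> h (t n))"
  shows "\<exists>g'. dim_gauge g' \<and> gauge_prec g' h \<and> summable (\<lambda>n. g' (t n))"
proof -
  interpret dim_gauge "cut_gauge \<epsilon> h" by fact
  obtain w where w: "dim_gauge w" "summable (\<lambda>n. w (cut_gauge \<epsilon> h (t n)))"
     "filterlim (\<lambda>t. w t / t) at_top (at_right 0)"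
    using exists_slower_summable_gauge[OF nonneg[OF t] sum] by blast
  interpret w: dim_gauge w by fact
  have "antimono_on {0<..\<epsilon>} (\<lambda>r. w (cut_gauge \<epsilon> h r) / h r)"
  proof (rule monotone_onI)
    fix r u assume ru: "r \<in> {0<..\<epsilon>}" "u \<in> {0<..\<epsilon>}" "r \<le> u"
    let ?G = "cut_gauge \<epsilon> h"
    have "?G r * w (?G u) \<le> ?G u * w (?G r)" using ru by (intro w.quot pos mono) auto
    then have "w (?G u) / ?G u \<le> w (?G r) / ?G r" using pos[of r] pos[of u] ru by (simp add: field_simps)
    then show "w (?G r) / h r \<ge> w (?G u) / h u" using ru by (simp add: cut_gauge_eq)
  qed
  moreover have "filterlim (\<lambda>r. w (cut_gauge \<epsilon> h r) / h r) at_top (at_right 0)"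
  proof -
    from filterlim_compose[OF w(3) filterlim_at_right_0]
    have "filterlim (\<lambda>r. w (cut_gauge \<epsilon> h r) / cut_gauge \<epsilon> h r) at_top (at_right 0)" .
    moreover have "\<forall>\<^sub>F r in at_right 0. r < \<epsilon>" using \<epsilon> eventually_at_right_field by blast
    then have "\<forall>\<^sub>F r in at_right 0. w (cut_gauge \<epsilon> h r) / cut_gauge \<epsilon> h r = w (cut_gauge \<epsilon> h r) / h r"
      by eventually_elim (simp add: cut_gauge_eq)
    ultimately show ?thesis by (rule filterlim_mono_eventually[OF _ order_refl order_refl])
  qed
  ultimately have "gauge_prec (\<lambda>r. w (cut_gauge \<epsilon> h r)) h" using \<epsilon> unfolding gauge_prec_def by blast
  with dim_gauge_comp[OF w(1) g] w(2) show ?thesis by blast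
qed

section \<open>Membership in the large intersection class\<close>

lemma well_approximable_in_class:
  assumes c: "c \<ge> 2" and h: "h \<in> gauge_D1" and \<sigma>: "\<sigma> > 0"
    and div: "(\<Sum>q. ennreal (h (real (Suc q) powr (- (2 + \<sigma>) / 2)))) = \<infinity>"
  shows "well_approximable \<sigma> \<in> large_intersection_class c h V"
  unfolding large_intersection_class_def
proof (intro CollectI conjI ballI impI allI gdelta_well_approximable)
  fix g U assume g: "g \<in> gauge_D1" and prec: "gauge_prec g h" and U: "open U \<and> U \<subseteq> V"
  define t where "t q = real (Suc q) powr (- (2 + \<sigma>) / 2)" for q
  obtain J where J: "dim_gauge (cut_gauge (1 / real c ^ J) g)"
    "\<And>j \<kappa>. diameter (adic_interval c j \<kappa>) < gauge_eps g \<longleftrightarrow> (\<exists>n\<ge>J. j = int n)"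
    using gauge_D1_radix_cut[OF g c] by blast
  obtain \<epsilon> where \<epsilon>: "\<epsilon> > 0" "dim_gauge (cut_gauge \<epsilon> h)" using gauge_D1_cut[OF h] by blast
  have J0: "1 / real c ^ J > 0" using c by simp
  interpret G: dim_gauge "cut_gauge (1 / real c ^ J) g" by (rule J)
  interpret H: dim_gauge "cut_gauge \<epsilon> h" by (rule \<epsilon>)
  \<comment> \<open>Of the relation between \<open>g\<close> and \<open>h\<close> only this enters:
    \<open>g\<close> eventually dominates \<open>h\<close>, so its series diverges too and the
    equality of net contents can be applied to \<open>g\<close> itself.\<close>
  have "\<forall>\<^sub>F r in at_right 0. 1 \<le> g r / h r" using prec by (auto simp: gauge_prec_def filterlim_at_top)
  moreover have "\<forall>\<^sub>F r in at_right (0::real). r \<in> {0<..<min \<epsilon> (1 / real c ^ J)}"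
    using \<epsilon>(1) J0 by (intro eventually_at_right_real) simp
  ultimately have "\<forall>\<^sub>F r in at_right 0. cut_gauge \<epsilon> h r \<le> cut_gauge (1 / real c ^ J) g r"
  proof eventually_elim
    case (elim r)
    then have "0 < h r" using H.pos[of r] by (simp add: cut_gauge_eq)
    with elim show ?case by (simp add: cut_gauge_eq field_simps)
  qed
  moreover have "filterlim t (at_right 0) sequentially"
    unfolding t_def using \<sigma> by real_asymp
  ultimately have le: "\<forall>\<^sub>F q in sequentially. cut_gauge \<epsilon> h (t q) \<le> cut_gauge (1 / real c ^ J) g (t q)"
    by (rule eventually_compose_filterlim)
  have "\<not> summable (\<lambda>q. cut_gauge \<epsilon> h (t q))"
    using div suminf_eq_top_iff_cut[OF \<epsilon>(2,1) \<sigma>] by (simp add: t_def)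
  moreover have "summable (\<lambda>q. cut_gauge \<epsilon> h (t q))" if "summable (\<lambda>q. cut_gauge (1 / real c ^ J) g (t q))"
  proof (rule summable_comparison_test_ev[OF _ that])
    show "\<forall>\<^sub>F q in sequentially. norm (cut_gauge \<epsilon> h (t q)) \<le> cut_gauge (1 / real c ^ J) g (t q)"
      using le by eventually_elim (simp add: t_def H.nonneg)
  qed
  ultimately have "\<not> summable (\<lambda>q. cut_gauge (1 / real c ^ J) g (t q))" by blast
  then have "\<not> summable (\<lambda>q. cut_gauge (1 / real c ^ J) g (real (Suc q) powr (- (2 + \<sigma>) / 2)))"
    unfolding t_def .
  from G.net_content_eq_open[OF c this \<sigma>, of U J] U
  show "net_content c g (well_approximable \<sigma> \<inter> U) = net_content c g U"
    using net_content_eq[OF c _ J(2)] g by (simp add: gauge_D1_def)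
qed

lemma well_approximable_not_in_class:
  assumes c: "c \<ge> 2" and h: "h \<in> gauge_D1" and \<sigma>: "\<sigma> > 0" and V: "open V" "V \<noteq> {}"
    and conv: "(\<Sum>q. ennreal (h (real (Suc q) powr (- (2 + \<sigma>) / 2)))) \<noteq> \<infinity>"
  shows "well_approximable \<sigma> \<notin> large_intersection_class c h V"
proof
  assume "well_approximable \<sigma> \<in> large_intersection_class c h V"
  then have eq_content: "\<And>g. g \<in> gauge_D1 \<Longrightarrow> gauge_prec g h \<Longrightarrow> net_content c g (well_approximable \<sigma> \<inter> V) = net_content c g V"
    using V(1) unfolding large_intersection_class_def by blast
  obtain \<epsilon> where \<epsilon>: "\<epsilon> > 0" "dim_gauge (cut_gauge \<epsilon> h)" using gauge_D1_cut[OF h] by blast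
  have "summable (\<lambda>q. cut_gauge \<epsilon> h (real (Suc q) powr (- (2 + \<sigma>) / 2)))"
    using conv suminf_eq_top_iff_cut[OF \<epsilon>(2,1) \<sigma>] by blast
  from exists_prec_summable_gauge[OF \<epsilon>(2,1) _ this]
  obtain g where g: "dim_gauge g" "gauge_prec g h" "summable (\<lambda>q. g (real (Suc q) powr (- (2 + \<sigma>) / 2)))"
    by auto
  interpret g: dim_gauge g by fact
  have gD: "g \<in> gauge_D1" by (rule g.in_gauge_D1)
  obtain J where J: "dim_gauge (cut_gauge (1 / real c ^ J) g)"
    "\<And>j \<kappa>. diameter (adic_interval c j \<kappa>) < gauge_eps g \<longleftrightarrow> (\<exists>n\<ge>J. j = int n)"
    using gauge_D1_radix_cut[OF gD c] by blast
  interpret G: dim_gauge "cut_gauge (1 / real c ^ J) g" by (rule J)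
  \<comment> \<open>The net content of \<open>g\<close> refers to its cut at generation
    \<open>J\<close>; the cut lies below \<open>g\<close>, so convergence is inherited.\<close>
  have "summable (\<lambda>q. cut_gauge (1 / real c ^ J) g (real (Suc q) powr (- (2 + \<sigma>) / 2)))"
  proof (rule summable_comparison_test'[OF g(3)])
    fix q :: nat
    show "norm (cut_gauge (1 / real c ^ J) g (real (Suc q) powr (- (2 + \<sigma>) / 2))) \<le> g (real (Suc q) powr (- (2 + \<sigma>) / 2))"
      unfolding cut_gauge_def real_norm_def by (subst abs_of_nonneg) (auto intro!: g.nonneg g.mono)
  qed
  then have "G.null_covered (well_approximable \<sigma> \<inter> V)"
    using G.null_covered_well_approximable[OF _ \<sigma>] G.null_covered_subset by blast
  from G.radix_content_null[OF c this] have "net_content c g (well_approximable \<sigma> \<inter> V) = 0"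
    unfolding net_content_eq[OF c g.zero J(2)] .
  moreover have "net_content c g V > 0"
    unfolding net_content_eq[OF c g.zero J(2)] by (rule G.radix_content_pos[OF c V])
  ultimately show False using eq_content[OF gD g(2)] by simp
qed

theorem theorem10:
  fixes c :: nat and h :: "real \<Rightarrow> real" and V :: "real set" and \<sigma> :: real
  assumes "c \<ge> 2"
    and "h \<in> gauge_D1"
    and "open V" and "V \<noteq> {}"
    and "\<sigma> > 0"
  shows
    "((\<Sum>q. ennreal (h (real (Suc q) powr (- (2 + \<sigma>) / 2)))) = \<infinity> \<longrightarrow>
        hausdorff_measure h (well_approximable \<sigma> \<inter> V) = \<infinity>) \<and>
     ((\<Sum>q. ennreal (h (real (Suc q) powr (- (2 + \<sigma>) / 2)))) < \<infinity> \<longrightarrow>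
        hausdorff_measure h (well_approximable \<sigma> \<inter> V) = 0) \<and>
     (well_approximable \<sigma> \<in> large_intersection_class c h V \<longleftrightarrow>
        (\<Sum>q. ennreal (h (real (Suc q) powr (- (2 + \<sigma>) / 2)))) = \<infinity>)"
proof -
  obtain \<epsilon> where \<epsilon>: "\<epsilon> > 0" "dim_gauge (cut_gauge \<epsilon> h)" using gauge_D1_cut[OF assms(2)] by blast
  interpret dim_gauge "cut_gauge \<epsilon> h" by (rule \<epsilon>)
  have eq: "h r = cut_gauge \<epsilon> h r" if "0 \<le> r" "r \<le> \<epsilon>" for r using that by (simp add: cut_gauge_eq)
  note iff = suminf_eq_top_iff_cut[OF \<epsilon>(2,1) assms(5)]
  show ?thesis
  proof (intro conjI impI iffI)
    assume top: "(\<Sum>q. ennreal (h (real (Suc q) powr (- (2 + \<sigma>) / 2)))) = \<infinity>"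
    show "hausdorff_measure h (well_approximable \<sigma> \<inter> V) = \<infinity>"
      by (rule hausdorff_measure_infinite[OF iff[THEN iffD1, OF top] assms(5) \<epsilon>(1) eq assms(3,4)])
    show "well_approximable \<sigma> \<in> large_intersection_class c h V"
      by (rule well_approximable_in_class[OF assms(1,2,5) top])
  next
    assume "(\<Sum>q. ennreal (h (real (Suc q) powr (- (2 + \<sigma>) / 2)))) < \<infinity>"
    then have "(\<Sum>q. ennreal (h (real (Suc q) powr (- (2 + \<sigma>) / 2)))) \<noteq> \<infinity>"
      by (rule less_imp_neq)
    then have "summable (\<lambda>q. cut_gauge \<epsilon> h (real (Suc q) powr (- (2 + \<sigma>) / 2)))"
      using iff by blast
    then have "null_covered (well_approximable \<sigma> \<inter> V)"
      using null_covered_well_approximable[OF _ assms(5)] null_covered_subset by blast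
    then show "hausdorff_measure h (well_approximable \<sigma> \<inter> V) = 0"
      by (rule hausdorff_measure_null[OF _ \<epsilon>(1) eq])
  next
    assume "well_approximable \<sigma> \<in> large_intersection_class c h V"
    then show "(\<Sum>q. ennreal (h (real (Suc q) powr (- (2 + \<sigma>) / 2)))) = \<infinity>"
      using well_approximable_not_in_class[OF assms(1,2,5,3,4)] by blast
  qed
qed

end
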